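(* Let $\vec G$ be an orientation of the Coxeter diagram $s_1-s_2-\cdots-s_{n-1}$ of $S_n$, and let $Q(\vec G)$ be a polygon as described below. Then the Cambrian lattice $\mathcal C(\vec G)$ is isomorphic to the partial order on the triangulations of $Q(\vec G)$ whose cover relations are the diagonal flips, where going up in a cover relation corresponds to increasing the slope of the flipped diagonal (i.e. $T\lessdot T'$ iff $T'$ is obtained from $T$ by replacing a diagonal $d$ by a diagonal $d'$ with the slope of $d'$ greater than the slope of $d$).
   Context: Weak order on $S_n$: $x\le y$ iff $I(x)\subseteq I(y)$, $I(x)=\{(x_j,x_i):i<j,x_i>x_j\}$; $s_i=(i,i+1)$. The Cambrian congruence $\Theta(\vec G)$ is the smallest lattice congruence of the weak order with $t\equiv ts$ for every directed edge $s\to t$ of $\vec G$; $\mathcal C(\vec G)$ is the weak order modulo $\Theta(\vec G)$. Define a partition $[n]=U\sqcup D$ by: for $b\in[2,n-1]$, $b\in U$ if the edge is directed $s_b\to s_{b-1}$ and $b\in D$ if $s_{b-1}\to s_b$; the indices $1$ and $n$ are placed in $U$ or $D$ arbitrarily. $Q(\vec G)$ is a convex polygon in $\mathbb R^2$ with vertices $v_0,\dots,v_{n+1}$ whose $x$-coordinates strictly increase with index, with $v_0,v_{n+1}$ on the $x$-axis, $v_i$ above the axis for $i\in U$ and below for $i\in D$; slopes are measured in these coordinates. A diagonal is a segment between non-adjacent vertices; a triangulation is a maximal set of pairwise non-crossing diagonals; a diagonal flip removes one diagonal and inserts the other diagonal of the resulting quadrilateral. *)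

theory Defs
  imports "HOL-Analysis.Analysis" "HOL-Combinatorics.Permutations"
begin

type_synonym perm = "nat \<Rightarrow> nat"

definition perms :: "nat \<Rightarrow> perm set" where
  "perms n = {x. x permutes {1..n}}"

text \<open>One-line notation: x_i = x i. Products are composition: (x y)(k) = x (y k).\<close>

definition inv_set :: "nat \<Rightarrow> perm \<Rightarrow> (nat \<times> nat) set" where
  "inv_set n x = {(x j, x i) | i j. 1 \<le> i \<and> i < j \<and> j \<le> n \<and> x i > x j}"

definition weak_le :: "nat \<Rightarrow> perm \<Rightarrow> perm \<Rightarrow> bool" where
  "weak_le n x y \<longleftrightarrow> inv_set n x \<subseteq> inv_set n y"

definition sgen :: "nat \<Rightarrow> perm" where
  "sgen i = (\<lambda>k. if k = i then i + 1 else if k = i + 1 then i else k)"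

definition is_join :: "nat \<Rightarrow> perm \<Rightarrow> perm \<Rightarrow> perm \<Rightarrow> bool" where
  "is_join n x y z \<longleftrightarrow> z \<in> perms n \<and> weak_le n x z \<and> weak_le n y z \<and>
     (\<forall>w\<in>perms n. weak_le n x w \<and> weak_le n y w \<longrightarrow> weak_le n z w)"

definition is_meet :: "nat \<Rightarrow> perm \<Rightarrow> perm \<Rightarrow> perm \<Rightarrow> bool" where
  "is_meet n x y z \<longleftrightarrow> z \<in> perms n \<and> weak_le n z x \<and> weak_le n z y \<and>
     (\<forall>w\<in>perms n. weak_le n w x \<and> weak_le n w y \<longrightarrow> weak_le n w z)"

definition lattice_congruence :: "nat \<Rightarrow> (perm \<times> perm) set \<Rightarrow> bool" where
  "lattice_congruence n \<Theta> \<longleftrightarrow> equiv (perms n) \<Theta> \<and>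
     (\<forall>x y z j j'. (x, y) \<in> \<Theta> \<and> z \<in> perms n \<and> is_join n x z j \<and> is_join n y z j'
         \<longrightarrow> (j, j') \<in> \<Theta>) \<and>
     (\<forall>x y z m m'. (x, y) \<in> \<Theta> \<and> z \<in> perms n \<and> is_meet n x z m \<and> is_meet n y z m'
         \<longrightarrow> (m, m') \<in> \<Theta>)"

text \<open>A directed edge s_a \<rightarrow> s_b is encoded as the index pair (a, b).\<close>
definition orientation :: "nat \<Rightarrow> (nat \<times> nat) set \<Rightarrow> bool" where
  "orientation n E \<longleftrightarrow>
     E \<subseteq> {(i, i + 1) | i. 1 \<le> i \<and> i + 1 \<le> n - 1} \<union> {(i + 1, i) | i. 1 \<le> i \<and> i + 1 \<le> n - 1} \<and>
     (\<forall>i. 1 \<le> i \<and> i + 1 \<le> n - 1 \<longrightarrow> ((i, i + 1) \<in> E \<longleftrightarrow> (i + 1, i) \<notin> E))"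

definition cambrian_gens :: "(nat \<times> nat) set \<Rightarrow> (perm \<times> perm) set" where
  "cambrian_gens E = {(sgen b, sgen b \<circ> sgen a) | a b. (a, b) \<in> E}"

definition cambrian_cong :: "nat \<Rightarrow> (nat \<times> nat) set \<Rightarrow> (perm \<times> perm) set" where
  "cambrian_cong n E = \<Inter> {\<Theta>. lattice_congruence n \<Theta> \<and> cambrian_gens E \<subseteq> \<Theta>}"

definition class_le :: "nat \<Rightarrow> perm set \<Rightarrow> perm set \<Rightarrow> bool" where
  "class_le n X Y \<longleftrightarrow> (\<exists>x\<in>X. \<exists>y\<in>Y. weak_le n x y)"

type_synonym pt = "real \<times> real"

definition polygon_Q :: "nat \<Rightarrow> nat set \<Rightarrow> (nat \<Rightarrow> pt) \<Rightarrow> bool" where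
  "polygon_Q n U v \<longleftrightarrow>
     (\<forall>i j. i < j \<and> j \<le> n + 1 \<longrightarrow> fst (v i) < fst (v j)) \<and>
     snd (v 0) = 0 \<and> snd (v (n + 1)) = 0 \<and>
     (\<forall>i\<in>{1..n}. (i \<in> U \<longrightarrow> snd (v i) > 0) \<and> (i \<notin> U \<longrightarrow> snd (v i) < 0)) \<and>
     (\<forall>i\<le>n + 1. v i \<notin> convex hull (v ` ({0..n + 1} - {i})))"

text \<open>Diagonals: segments between non-adjacent vertices, i.e. vertex pairs whose
  segment is not an edge (not contained in the boundary) of the polygon.
  A diagonal is encoded as an index pair (i, j) with i < j.\<close>
definition diagonals :: "nat \<Rightarrow> (nat \<Rightarrow> pt) \<Rightarrow> (nat \<times> nat) set" where
  "diagonals n v = {(i, j). i < j \<and> j \<le> n + 1 \<and>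
      \<not> closed_segment (v i) (v j) \<subseteq> frontier (convex hull (v ` {0..n + 1}))}"

definition crosses :: "(nat \<Rightarrow> pt) \<Rightarrow> nat \<times> nat \<Rightarrow> nat \<times> nat \<Rightarrow> bool" where
  "crosses v d e \<longleftrightarrow>
     \<not> (closed_segment (v (fst d)) (v (snd d)) \<inter> closed_segment (v (fst e)) (v (snd e))
         \<subseteq> v ` ({fst d, snd d} \<inter> {fst e, snd e}))"

definition triangulation :: "nat \<Rightarrow> (nat \<Rightarrow> pt) \<Rightarrow> (nat \<times> nat) set \<Rightarrow> bool" where
  "triangulation n v T \<longleftrightarrow> T \<subseteq> diagonals n v \<and>
     pairwise (\<lambda>d e. \<not> crosses v d e) T \<and>
     (\<forall>d\<in>diagonals n v - T. \<exists>e\<in>T. crosses v d e)"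

definition slope :: "(nat \<Rightarrow> pt) \<Rightarrow> nat \<times> nat \<Rightarrow> real" where
  "slope v d = (snd (v (snd d)) - snd (v (fst d))) / (fst (v (snd d)) - fst (v (fst d)))"

text \<open>Upward flip: T' arises from T by removing a diagonal d and inserting another
  diagonal d' (necessarily the other diagonal of the resulting quadrilateral),
  with slope d < slope d'.\<close>
definition flip_up :: "nat \<Rightarrow> (nat \<Rightarrow> pt) \<Rightarrow> (nat \<times> nat) set \<Rightarrow> (nat \<times> nat) set \<Rightarrow> bool" where
  "flip_up n v T T' \<longleftrightarrow> triangulation n v T \<and> triangulation n v T' \<and>
     (\<exists>d\<in>T. \<exists>d'. d' \<notin> T \<and> T' = insert d' (T - {d}) \<and> slope v d < slope v d')"

definition tri_le :: "nat \<Rightarrow> (nat \<Rightarrow> pt) \<Rightarrow> (nat \<times> nat) set \<Rightarrow> (nat \<times> nat) set \<Rightarrow> bool" where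
  "tri_le n v = (flip_up n v)\<^sup>*\<^sup>*"

definition tri_covers :: "nat \<Rightarrow> (nat \<Rightarrow> pt) \<Rightarrow> (nat \<times> nat) set \<Rightarrow> (nat \<times> nat) set \<Rightarrow> bool" where
  "tri_covers n v T T' \<longleftrightarrow> T \<noteq> T' \<and> tri_le n v T T' \<and>
     \<not> (\<exists>Z. triangulation n v Z \<and> Z \<noteq> T \<and> Z \<noteq> T' \<and> tri_le n v T Z \<and> tri_le n v Z T')"

end

(*  Everything is phrased with inversion sets, i.e. biclosed sets of pairs. A permutation x yields
    the triangulation of all diagonals d such that the vertices on or below d are read before
    the vertices on or above d; this is Reading's lattice path map. Two diagonals
    cross iff each passes above the other at some vertex, which makes these sets non-crossing; cutting
    the word at a suitable place produces a path edge crossing any further diagonal, so they are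
    maximal. The "read before" relation of a non-crossing set is acyclic, hence every
    triangulation arises.

    For each b, sorting the letters to one side of b (left or right according to whether b is down
    or up) into those smaller and those larger than b is a monotone operator which does not change
    the triangulation. Iterating these operators gives the least and greatest elements of the
    fibres, so the fibres form a lattice congruence. It is the least one containing the generators
    by a forcing argument that propagates the contraction of a cover transposing b - 1 and b + 1 to
    all covers transposing some a < b < c with b on the same side.

    A cover in the weak order either keeps the triangulation or flips one diagonal upwards, and
    conversely each fibre has an element in which a given flip is an adjacent transposition. *)

theory Submission
  imports Defs
begin

text \<open>Passing to biclosed sets turns the weak order into inclusion and the join into a
  transitive closure. The complement in \<open>prs n\<close> reverses the word, so constructions
  come in mirror pairs: \<open>bmeet\<close> from \<open>bjoin\<close>, \<open>Rset\<close> from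
  \<open>rset\<close>. Monotone sorting alone does not give compatibility with joins. What ties the
  two directions together is that \<open>Rset\<close> recovers at least what \<open>rset\<close>
  removed at the same \<open>b\<close>: an antisortable set above the sorted set contains the
  original one. Triangulations are maximal, so an inclusion between two of them is an equality, and
  one inclusion suffices whenever two are to be identified. In the forcing argument a cover has to
  be labelled by its two letters together with the set of intermediate letters to their left,
  because contraction depends on that set as well. Upper end points count as below a diagonal and
  lower ones as above it. A vertex in \<open>lo\<close> of one diagonal and in \<open>hi\<close> of
  another is then strictly off at least one of the two lines, which makes combinatorial and
  geometric crossing agree.\<close>

section \<open>Biclosed sets and the precedence order of letters\<close>

definition biclosed :: "nat \<Rightarrow> (nat \<times> nat) set \<Rightarrow> bool" where
  "biclosed n I \<longleftrightarrow> (\<forall>a c. (a, c) \<in> I \<longrightarrow> 1 \<le> a \<and> a < c \<and> c \<le> n) \<and>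
     (\<forall>a b c. (a, b) \<in> I \<and> (b, c) \<in> I \<longrightarrow> (a, c) \<in> I) \<and>
     (\<forall>a b c. (a, c) \<in> I \<and> a < b \<and> b < c \<longrightarrow> (a, b) \<in> I \<or> (b, c) \<in> I)"

text \<open>\<open>bf I p q\<close>: the letter \<open>p\<close> precedes \<open>q\<close> in the word with inversion set \<open>I\<close>.\<close>
definition bf :: "(nat \<times> nat) set \<Rightarrow> nat \<Rightarrow> nat \<Rightarrow> bool" where
  "bf I p q \<longleftrightarrow> (if p < q then (p, q) \<notin> I else (q, p) \<in> I)"

lemma biclosed_range: "biclosed n I \<Longrightarrow> (a, c) \<in> I \<Longrightarrow> 1 \<le> a \<and> a < c \<and> c \<le> n"
  unfolding biclosed_def by blast

lemma biclosed_trans: "biclosed n I \<Longrightarrow> (a, b) \<in> I \<Longrightarrow> (b, c) \<in> I \<Longrightarrow> (a, c) \<in> I"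
  unfolding biclosed_def by blast

lemma biclosed_cotrans:
  "biclosed n I \<Longrightarrow> (a, c) \<in> I \<Longrightarrow> a < b \<Longrightarrow> b < c \<Longrightarrow> (a, b) \<in> I \<or> (b, c) \<in> I"
  unfolding biclosed_def by blast

lemma biclosedI:
  assumes "\<And>a c. (a, c) \<in> I \<Longrightarrow> 1 \<le> a \<and> a < c \<and> c \<le> n"
    and "\<And>a b c. (a, b) \<in> I \<Longrightarrow> (b, c) \<in> I \<Longrightarrow> (a, c) \<in> I"
    and "\<And>a b c. (a, c) \<in> I \<Longrightarrow> a < b \<Longrightarrow> b < c \<Longrightarrow> (a, b) \<in> I \<or> (b, c) \<in> I"
  shows "biclosed n I"
  using assms unfolding biclosed_def by blast

lemma biclosed_subset: "biclosed n I \<Longrightarrow> I \<subseteq> {1..n} \<times> {1..n}"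
  by (auto dest: biclosed_range)

lemma biclosed_finite: "biclosed n I \<Longrightarrow> finite I"
  by (rule finite_subset[OF biclosed_subset]) auto

lemma bf_irrefl: "biclosed n I \<Longrightarrow> \<not> bf I p p"
  unfolding bf_def by (auto dest: biclosed_range)

lemma bf_total: "p \<noteq> q \<Longrightarrow> bf I p q \<or> bf I q p"
  unfolding bf_def by auto

lemma bf_asym: "biclosed n I \<Longrightarrow> bf I p q \<Longrightarrow> \<not> bf I q p"
  unfolding bf_def by (cases "p = q") (auto dest: biclosed_range split: if_splits)

text \<open>Each of the six relative orders of three distinct letters is settled by one use of
  transitivity or cotransitivity.\<close>

lemma bf_trans:
  assumes I: "biclosed n I" and "bf I p q" "bf I q r"
  shows "bf I p r"
proof (cases "p = r")
  case True
  then show ?thesis using assms bf_asym by blast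
next
  case False
  have "p \<noteq> q" "q \<noteq> r" using assms bf_irrefl by blast+
  then consider "p < q \<and> q < r" | "p < r \<and> r < q" | "q < p \<and> p < r" | "q < r \<and> r < p"
    | "r < p \<and> p < q" | "r < q \<and> q < p"
    using False by linarith
  then show ?thesis
    using assms(2,3) biclosed_cotrans[OF I, of p r q] biclosed_trans[OF I, of p r q]
      biclosed_trans[OF I, of q p r] biclosed_cotrans[OF I, of q p r]
      biclosed_cotrans[OF I, of r q p] biclosed_trans[OF I, of r q p]
    by cases (auto simp: bf_def)
qed

lemma bf_trans_le:
  "biclosed n I \<Longrightarrow> p = q \<or> bf I p q \<Longrightarrow> bf I q r \<Longrightarrow> bf I p r"
  by (blast intro: bf_trans)

text \<open>This converse allows a modified word to be checked through its precedence order, where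
  an exchange of neighbours is easy to describe.\<close>

lemma biclosed_of_bf_trans:
  assumes "\<And>a c. (a, c) \<in> I \<Longrightarrow> 1 \<le> a \<and> a < c \<and> c \<le> n"
    and "\<And>p q r. p \<in> {1..n} \<Longrightarrow> q \<in> {1..n} \<Longrightarrow> r \<in> {1..n} \<Longrightarrow>
      bf I p q \<Longrightarrow> bf I q r \<Longrightarrow> bf I p r"
  shows "biclosed n I"
proof (rule biclosedI)
  show "1 \<le> a \<and> a < c \<and> c \<le> n" if "(a, c) \<in> I" for a c using assms(1)[OF that] .
  show "(a, c) \<in> I" if "(a, b) \<in> I" "(b, c) \<in> I" for a b c
    using assms(1)[OF that(1)] assms(1)[OF that(2)] assms(2)[of c b a] that
    by (auto simp: bf_def split: if_splits)
  show "(a, b) \<in> I \<or> (b, c) \<in> I" if "(a, c) \<in> I" "a < b" "b < c" for a b c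
    using assms(1)[OF that(1)] assms(2)[of a b c] that
    by (auto simp: bf_def split: if_splits)
qed

lemma biclosed_key:
  fixes r :: "nat \<Rightarrow> nat"
  assumes "inj_on r {1..n}"
  shows "biclosed n {(a, c). 1 \<le> a \<and> a < c \<and> c \<le> n \<and> r c < r a}"
  by (rule biclosedI) auto

subsection \<open>Inversion sets of permutations\<close>

lemma inv_set_pos:
  assumes x: "x \<in> perms n"
  shows "inv_set n x = {(a, c). 1 \<le> a \<and> a < c \<and> c \<le> n \<and> inv x c < inv x a}"
proof -
  have px: "x permutes {1..n}" using x by (simp add: perms_def)
  note pi = permutes_inv[OF px]
  have xi: "x (inv x k) = k" "inv x (x k) = k" for k
    using permutes_inverses[OF px] by auto
  have rng: "inv x k \<in> {1..n} \<longleftrightarrow> k \<in> {1..n}" "x k \<in> {1..n} \<longleftrightarrow> k \<in> {1..n}" for k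
    using permutes_in_image[OF pi] permutes_in_image[OF px] by blast+
  show ?thesis
  proof (intro set_eqI iffI)
    fix z assume "z \<in> inv_set n x"
    then have "\<exists>i j. z = (x j, x i) \<and> 1 \<le> i \<and> i < j \<and> j \<le> n \<and> x i > x j"
      unfolding inv_set_def by (rule CollectD)
    then obtain i j where z: "z = (x j, x i)" and ij: "1 \<le> i" "i < j" "j \<le> n" "x i > x j"
      by (elim exE conjE) (rule that)
    have "x i \<in> {1..n}" "x j \<in> {1..n}" using ij by (simp_all only: rng(2)) auto
    then show "z \<in> {(a, c). 1 \<le> a \<and> a < c \<and> c \<le> n \<and> inv x c < inv x a}"
      unfolding z using ij by (simp add: xi)
  next
    fix z assume "z \<in> {(a, c). 1 \<le> a \<and> a < c \<and> c \<le> n \<and> inv x c < inv x a}"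
    then obtain a c where z: "z = (a, c)" and ac: "1 \<le> a" "a < c" "c \<le> n" "inv x c < inv x a"
      by auto
    have "inv x a \<in> {1..n}" "inv x c \<in> {1..n}" using ac by (simp_all only: rng(1)) auto
    then show "z \<in> inv_set n x" unfolding inv_set_def z using ac
      by (intro CollectI exI[of _ "inv x c"] exI[of _ "inv x a"]) (simp add: xi)
  qed
qed

lemma inv_set_biclosed: "x \<in> perms n \<Longrightarrow> biclosed n (inv_set n x)"
  unfolding inv_set_pos
  by (intro biclosed_key)
    (auto simp: perms_def intro: inj_on_subset[OF permutes_inj] dest: permutes_inv)

lemma bf_inv_set:
  assumes "x \<in> perms n" "p \<in> {1..n}" "q \<in> {1..n}"
  shows "bf (inv_set n x) p q \<longleftrightarrow> inv x p < inv x q"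
proof -
  have "inj (inv x)" using assms by (auto simp: perms_def dest: permutes_inv permutes_inj)
  then have "inv x p = inv x q \<longleftrightarrow> p = q" by (auto dest: injD)
  then show ?thesis using assms(2,3)
    unfolding bf_def inv_set_pos[OF assms(1)] by auto
qed

text \<open>The position of a letter is the number of letters weakly before it, and the inversion
  set determines this count.\<close>

lemma inv_set_inj:
  assumes "x \<in> perms n" "y \<in> perms n" "inv_set n x = inv_set n y"
  shows "x = y"
proof -
  have pos: "inv z p = card {q \<in> {1..n}. q = p \<or> bf (inv_set n z) q p}"
    if z: "z \<in> perms n" and p: "p \<in> {1..n}" for z p
  proof -
    have pz: "inv z permutes {1..n}" using z by (auto simp: perms_def dest: permutes_inv)
    have ip: "inv z p \<in> {1..n}" using permutes_in_image[OF pz] p by blast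
    have "inv z ` {q \<in> {1..n}. q = p \<or> bf (inv_set n z) q p} = {1..inv z p}"
    proof
      show "inv z ` {q \<in> {1..n}. q = p \<or> bf (inv_set n z) q p} \<subseteq> {1..inv z p}"
        using permutes_in_image[OF pz] bf_inv_set[OF z _ p] by fastforce
      show "{1..inv z p} \<subseteq> inv z ` {q \<in> {1..n}. q = p \<or> bf (inv_set n z) q p}"
      proof
        fix k assume k: "k \<in> {1..inv z p}"
        then have "k \<in> {1..n}" using ip by auto
        then obtain q where q: "q \<in> {1..n}" "k = inv z q"
          using permutes_image[OF pz] by blast
        have "q = p \<or> inv z q < inv z p"
          using k q injD[OF permutes_inj[OF pz], of q p] by auto
        then show "k \<in> inv z ` {q \<in> {1..n}. q = p \<or> bf (inv_set n z) q p}"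
          using q bf_inv_set[OF z _ p] by auto
      qed
    qed
    moreover have "inj_on (inv z) {q \<in> {1..n}. q = p \<or> bf (inv_set n z) q p}"
      using permutes_inj[OF pz] by (rule inj_on_subset) auto
    ultimately show ?thesis using card_image[of "inv z"] by fastforce
  qed
  have px: "x permutes {1..n}" "y permutes {1..n}" using assms by (auto simp: perms_def)
  have "inv x p = inv y p" for p
  proof (cases "p \<in> {1..n}")
    case True
    then show ?thesis using pos assms by simp
  next
    case False
    then show ?thesis using px permutes_inv by (metis permutes_not_in)
  qed
  then have "inv x = inv y" by auto
  then show ?thesis using px by (metis permutes_inv_inv)
qed

text \<open>Ranking each letter by the number of letters weakly before it in the total order
  \<open>bf I\<close> gives the inverse of the wanted permutation.\<close>

lemma biclosed_perm:
  assumes I: "biclosed n I"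
  obtains x where "x \<in> perms n" "inv_set n x = I"
proof -
  \<comment> \<open>Outside \<open>{1..n}\<close> the rank is the identity, as
    \<open>permutes\<close> demands.\<close>
  define r where "r p = (if p \<in> {1..n} then card {q \<in> {1..n}. q = p \<or> bf I q p} else p)" for p
  have mono: "r p < r q" if "p \<in> {1..n}" "q \<in> {1..n}" "bf I p q" for p q
  proof -
    have sub: "{u \<in> {1..n}. u = p \<or> bf I u p} \<subset> {u \<in> {1..n}. u = q \<or> bf I u q}"
    proof (rule psubsetI)
      show "{u \<in> {1..n}. u = p \<or> bf I u p} \<subseteq> {u \<in> {1..n}. u = q \<or> bf I u q}"
        using bf_trans_le[OF I _ that(3)] by blast
      have "q \<notin> {u \<in> {1..n}. u = p \<or> bf I u p}"
        using that bf_asym[OF I that(3)] bf_irrefl[OF I, of p] by auto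
      then show "{u \<in> {1..n}. u = p \<or> bf I u p} \<noteq> {u \<in> {1..n}. u = q \<or> bf I u q}"
        using that by blast
    qed
    show ?thesis using that psubset_card_mono[OF _ sub] unfolding r_def by auto
  qed
  have iff: "r p < r q \<longleftrightarrow> bf I p q" if "p \<in> {1..n}" "q \<in> {1..n}" for p q
    using mono[OF that] mono[OF that(2,1)] bf_total[of p q I] by fastforce
  have inj: "inj_on r {1..n}"
    by (rule inj_onI) (metis iff bf_total less_irrefl)
  have "r p \<in> {1..n}" if "p \<in> {1..n}" for p
  proof -
    have "p \<in> {q \<in> {1..n}. q = p \<or> bf I q p}" using that by auto
    then have "card {q \<in> {1..n}. q = p \<or> bf I q p} > 0" by (subst card_gt_0_iff) auto
    moreover have "card {q \<in> {1..n}. q = p \<or> bf I q p} \<le> card {1..n}"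
      by (rule card_mono) auto
    ultimately show ?thesis using that unfolding r_def by auto
  qed
  then have "r ` {1..n} = {1..n}"
    using inj by (intro card_subset_eq) (auto simp: card_image)
  then have pr: "r permutes {1..n}"
    using inj unfolding r_def by (intro bij_imp_permutes) (auto simp: bij_betw_def)
  define x where "x = inv r"
  have x: "x \<in> perms n" using pr by (auto simp: perms_def x_def permutes_inv)
  have "inv x = r" using pr by (simp add: x_def permutes_inv_inv)
  then have "inv_set n x = {(a, c). 1 \<le> a \<and> a < c \<and> c \<le> n \<and> r c < r a}"
    using inv_set_pos[OF x] by simp
  also have "\<dots> = I"
  proof -
    have "(1 \<le> a \<and> a < c \<and> c \<le> n \<and> r c < r a) \<longleftrightarrow> (a, c) \<in> I" for a c
      using iff[of c a] biclosed_range[OF I, of a c] by (auto simp: bf_def)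
    then show ?thesis by auto
  qed
  finally show thesis using that x by blast
qed

subsection \<open>Joins and meets\<close>

definition prs :: "nat \<Rightarrow> (nat \<times> nat) set" where
  "prs n = {(a, c). 1 \<le> a \<and> a < c \<and> c \<le> n}"

definition bjoin :: "(nat \<times> nat) set \<Rightarrow> (nat \<times> nat) set \<Rightarrow> (nat \<times> nat) set" where
  "bjoin I J = (I \<union> J)\<^sup>+"

definition bmeet :: "nat \<Rightarrow> (nat \<times> nat) set \<Rightarrow> (nat \<times> nat) set \<Rightarrow> (nat \<times> nat) set" where
  "bmeet n I J = prs n - bjoin (prs n - I) (prs n - J)"

lemma biclosed_compl: "biclosed n I \<Longrightarrow> biclosed n (prs n - I)"
proof (rule biclosedI)
  assume I: "biclosed n I"
  show "1 \<le> a \<and> a < c \<and> c \<le> n" if "(a, c) \<in> prs n - I" for a c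
    using that by (simp add: prs_def)
  show "(a, c) \<in> prs n - I" if "(a, b) \<in> prs n - I" "(b, c) \<in> prs n - I" for a b c
    using that biclosed_cotrans[OF I, of a c b] by (auto simp: prs_def)
  show "(a, b) \<in> prs n - I \<or> (b, c) \<in> prs n - I"
    if "(a, c) \<in> prs n - I" "a < b" "b < c" for a b c
    using that biclosed_trans[OF I, of a b c] by (auto simp: prs_def)
qed

lemma biclosed_prs: "biclosed n I \<Longrightarrow> I \<subseteq> prs n"
  unfolding biclosed_def prs_def by blast

text \<open>Only cotransitivity needs an argument: along a chain from \<open>a\<close> to
  \<open>c\<close> some link arrives at \<open>b\<close> or jumps over it, and a link that jumps
  over \<open>b\<close> splits there because it lies in \<open>I\<close> or in
  \<open>J\<close>.\<close>

lemma bjoin_biclosed: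
  assumes "biclosed n I" "biclosed n J"
  shows "biclosed n (bjoin I J)"
proof (rule biclosedI)
  show "1 \<le> a \<and> a < c \<and> c \<le> n" if "(a, c) \<in> bjoin I J" for a c
    using that unfolding bjoin_def
    by (induction rule: trancl_induct) (use assms in \<open>auto dest: biclosed_range\<close>)
  show "(a, c) \<in> bjoin I J" if "(a, b) \<in> bjoin I J" "(b, c) \<in> bjoin I J" for a b c
    using that unfolding bjoin_def by (rule trancl_trans)
  show "(a, b) \<in> bjoin I J \<or> (b, c) \<in> bjoin I J"
    if "(a, c) \<in> bjoin I J" "a < b" "b < c" for a b c
    using that unfolding bjoin_def
  proof (induction rule: trancl_induct)
    case (base y)
    then show ?case using assms biclosed_cotrans by blast
  next
    case (step y z)
    consider "b < y" | "b = y" | "y < b" by linarith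
    then show ?case
    proof cases
      case 1
      then show ?thesis using step by (metis trancl.trancl_into_trancl)
    next
      case 2
      then show ?thesis using step by blast
    next
      case 3
      then have "(y, b) \<in> I \<union> J \<or> (b, z) \<in> I \<union> J"
        using step assms biclosed_cotrans by blast
      then show ?thesis using step by (metis r_into_trancl' trancl.trancl_into_trancl)
    qed
  qed
qed

lemma bjoin_upper1: "I \<subseteq> bjoin I J"
  unfolding bjoin_def by auto

lemma bjoin_upper2: "J \<subseteq> bjoin I J"
  unfolding bjoin_def by auto

lemma bjoin_least:
  assumes "biclosed n K" "I \<subseteq> K" "J \<subseteq> K"
  shows "bjoin I J \<subseteq> K"
proof -
  have "trans K" using biclosed_trans[OF assms(1)] by (auto intro: transI)
  then have "K\<^sup>+ = K" by (rule trancl_id)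
  moreover have "(I \<union> J)\<^sup>+ \<subseteq> K\<^sup>+"
    using assms(2,3) by (intro subsetI) (erule trancl_mono, auto)
  ultimately show ?thesis unfolding bjoin_def by simp
qed

lemma bmeet_biclosed: "biclosed n I \<Longrightarrow> biclosed n J \<Longrightarrow> biclosed n (bmeet n I J)"
  unfolding bmeet_def by (intro biclosed_compl bjoin_biclosed)

lemma bmeet_lower1: "bmeet n I J \<subseteq> I"
  unfolding bmeet_def using bjoin_upper1[of "prs n - I" "prs n - J"] by auto

lemma bmeet_lower2: "bmeet n I J \<subseteq> J"
  unfolding bmeet_def using bjoin_upper2[of "prs n - J" "prs n - I"] by auto

lemma bmeet_greatest:
  assumes "biclosed n K" "K \<subseteq> I" "K \<subseteq> J"
  shows "K \<subseteq> bmeet n I J"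
proof -
  have "bjoin (prs n - I) (prs n - J) \<subseteq> prs n - K"
    using assms by (intro bjoin_least[OF biclosed_compl[OF assms(1)]]) auto
  then show ?thesis unfolding bmeet_def using biclosed_prs[OF assms(1)] by auto
qed

subsection \<open>Adjacent transpositions\<close>

text \<open>Either letter may be the larger one: a flip is first realised as an exchange of
  neighbours, and only the slopes decide its direction.\<close>

definition adj :: "nat \<Rightarrow> (nat \<times> nat) set \<Rightarrow> nat \<Rightarrow> nat \<Rightarrow> bool" where
  "adj n I a c \<longleftrightarrow> a \<in> {1..n} \<and> c \<in> {1..n} \<and> bf I a c \<and> (\<forall>e\<in>{1..n}. \<not> (bf I a e \<and> bf I e c))"

definition swp :: "(nat \<times> nat) set \<Rightarrow> nat \<Rightarrow> nat \<Rightarrow> (nat \<times> nat) set" where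
  "swp I a c = (if a < c then insert (a, c) I else I - {(c, a)})"

lemma bf_swp:
  "a \<noteq> c \<Longrightarrow> bf I a c \<Longrightarrow> bf (swp I a c) p q \<longleftrightarrow> (p = c \<and> q = a) \<or> (bf I p q \<and> \<not> (p = a \<and> q = c))"
  unfolding bf_def swp_def by auto

lemma adj_neq: "biclosed n I \<Longrightarrow> adj n I a c \<Longrightarrow> a \<noteq> c"
  unfolding adj_def using bf_irrefl by blast

lemma swp_biclosed:
  assumes I: "biclosed n I" and ac: "adj n I a c"
  shows "biclosed n (swp I a c)"
proof (rule biclosed_of_bf_trans)
  note neq = adj_neq[OF I ac]
  have bac: "bf I a c" using ac by (simp add: adj_def)
  show "1 \<le> u \<and> u < w \<and> w \<le> n" if "(u, w) \<in> swp I a c" for u w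
    using that ac biclosed_range[OF I, of u w] unfolding swp_def adj_def
    by (auto split: if_splits)
  fix p q r assume pqr: "p \<in> {1..n}" "q \<in> {1..n}" "r \<in> {1..n}"
    and "bf (swp I a c) p q" "bf (swp I a c) q r"
  then show "bf (swp I a c) p r"
    unfolding bf_swp[OF neq bac]
    using ac bf_trans[OF I] bf_asym[OF I] bf_irrefl[OF I] bf_total[of _ _ I]
    unfolding adj_def by metis
qed

lemma adj_of_cover:
  assumes I: "biclosed n I" and J: "biclosed n (insert (a, c) I)" and ni: "(a, c) \<notin> I"
  shows "adj n I a c"
proof -
  have r: "1 \<le> a" "a < c" "c \<le> n" using biclosed_range[OF J] by auto
  have b: "bf I a c" using r ni by (simp add: bf_def)
  have s: "insert (a, c) I = swp I a c" using r by (simp add: swp_def)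
  have bs: "bf (insert (a, c) I) p q \<longleftrightarrow> (p = c \<and> q = a) \<or> (bf I p q \<and> \<not> (p = a \<and> q = c))" for p q
    unfolding s using bf_swp[OF _ b] r by auto
  have "\<not> (bf I a e \<and> bf I e c)" for e
  proof
    assume e: "bf I a e \<and> bf I e c"
    then have "e \<noteq> a" "e \<noteq> c" using bf_irrefl[OF I] by auto
    then have "bf (insert (a, c) I) a e" "bf (insert (a, c) I) e c"
      using e bs[of a e] bs[of e c] by blast+
    then have "bf (insert (a, c) I) a c" by (rule bf_trans[OF J])
    then show False using bs[of a c] r by simp
  qed
  then show ?thesis using r b by (auto simp: adj_def)
qed

text \<open>Among the inversions to be added, take one whose letters have the fewest letters between
  them in the word of \<open>I\<close>. A letter \<open>e\<close> between them would give closer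
  pairs \<open>(a, e)\<close> and \<open>(e, c)\<close>, so \<open>J\<close> would still read
  \<open>a\<close> before \<open>e\<close> before \<open>c\<close>, although it reads
  \<open>c\<close> before \<open>a\<close>.\<close>

lemma biclosed_chain_step:
  assumes I: "biclosed n I" and J: "biclosed n J" and "I \<subset> J"
  obtains a c where "(a, c) \<in> J" "(a, c) \<notin> I" "biclosed n (insert (a, c) I)"
proof -
  define bt where "bt z = {e \<in> {1..n}. bf I (fst z) e \<and> bf I e (snd z)}" for z
  define Q where "Q z \<longleftrightarrow> z \<in> J \<and> z \<notin> I" for z
  obtain z0 where "Q z0" using assms(3) unfolding Q_def by blast
  then obtain z where "Q z" and min: "\<And>w. Q w \<Longrightarrow> card (bt z) \<le> card (bt w)"
    using ex_has_least_nat[of Q z0 "\<lambda>z. card (bt z)"] by blast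
  obtain a c where z: "z = (a, c)" by (cases z)
  have ac: "(a, c) \<in> J" "(a, c) \<notin> I" using \<open>Q z\<close> z by (auto simp: Q_def)
  have r: "1 \<le> a" "a < c" "c \<le> n" using biclosed_range[OF J ac(1)] by auto
  have b: "bf I a c" "bf J c a" using ac r by (auto simp: bf_def)
  have less: "card (bt w) < card (bt z)" if "bt w \<subset> bt z" for w
    using that by (intro psubset_card_mono) (auto simp: bt_def)
  have le: "bf J p q" if "bf I p q" "\<not> (p < q \<and> Q (p, q))" for p q
    using that \<open>I \<subset> J\<close> by (auto simp: bf_def Q_def split: if_splits)
  have "\<not> (bf I a e \<and> bf I e c)" if e: "e \<in> {1..n}" for e
  proof
    assume ae: "bf I a e \<and> bf I e c"
    have "e \<in> bt z" using ae e by (simp add: bt_def z)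
    moreover have "e \<notin> bt (a, e)" "e \<notin> bt (e, c)"
      using bf_irrefl[OF I, of e] by (auto simp: bt_def)
    moreover have "bt (a, e) \<subseteq> bt z" "bt (e, c) \<subseteq> bt z"
      using ae by (auto simp: bt_def z intro: bf_trans[OF I])
    ultimately have "bt (a, e) \<subset> bt z" "bt (e, c) \<subset> bt z" by blast+
    then have "\<not> Q (a, e)" "\<not> Q (e, c)" using min less leD by blast+
    then have "bf J a e" "bf J e c" using le ae by blast+
    then show False using b bf_trans[OF J] bf_asym[OF J] by blast
  qed
  then have "adj n I a c" using r b by (auto simp: adj_def)
  then have "biclosed n (swp I a c)" by (rule swp_biclosed[OF I])
  then show thesis using that ac r by (simp add: swp_def)
qed

subsection \<open>Triangulations read off from inversion sets\<close>

text \<open>The vertices in the horizontal range of \<open>d\<close> that lie on or below, respectively on or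
  above it. The endpoints are distributed so that \<open>lo\<close> are the letters read before, and \<open>hi\<close> those
  read after, the times when \<open>d\<close> is an edge of the current lattice path.\<close>
definition lo :: "nat \<Rightarrow> nat set \<Rightarrow> nat \<times> nat \<Rightarrow> nat set" where
  "lo n U d = {k \<in> {1..n}. fst d < k \<and> k < snd d \<and> k \<notin> U \<or> (k = fst d \<or> k = snd d) \<and> k \<in> U}"

definition hi :: "nat \<Rightarrow> nat set \<Rightarrow> nat \<times> nat \<Rightarrow> nat set" where
  "hi n U d = {k \<in> {1..n}. fst d < k \<and> k < snd d \<and> k \<in> U \<or> (k = fst d \<or> k = snd d) \<and> k \<notin> U}"

text \<open>Nonemptiness of both sets excludes the sides of the polygon. The vertices
  \<open>0\<close> and \<open>n + 1\<close> are not letters and never count.\<close>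

definition diag :: "nat \<Rightarrow> nat set \<Rightarrow> (nat \<times> nat) set" where
  "diag n U = {d. fst d < snd d \<and> snd d \<le> n + 1 \<and> lo n U d \<noteq> {} \<and> hi n U d \<noteq> {}}"

text \<open>The two diagonals demand opposite orders of one pair of letters.\<close>

definition ccross :: "nat \<Rightarrow> nat set \<Rightarrow> nat \<times> nat \<Rightarrow> nat \<times> nat \<Rightarrow> bool" where
  "ccross n U d e \<longleftrightarrow> lo n U d \<inter> hi n U e \<noteq> {} \<and> hi n U d \<inter> lo n U e \<noteq> {}"

definition tri :: "nat \<Rightarrow> nat set \<Rightarrow> (nat \<times> nat) set \<Rightarrow> (nat \<times> nat) set" where
  "tri n U I = {d \<in> diag n U. \<forall>p\<in>lo n U d. \<forall>q\<in>hi n U d. bf I p q}"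

definition ctri :: "nat \<Rightarrow> nat set \<Rightarrow> (nat \<times> nat) set \<Rightarrow> bool" where
  "ctri n U T \<longleftrightarrow> T \<subseteq> diag n U \<and> (\<forall>d\<in>T. \<forall>e\<in>T. \<not> ccross n U d e) \<and>
     (\<forall>d\<in>diag n U - T. \<exists>e\<in>T. ccross n U d e)"

lemma lo_range: "k \<in> lo n U d \<Longrightarrow> fst d \<le> snd d \<Longrightarrow> k \<in> {1..n} \<and> fst d \<le> k \<and> k \<le> snd d"
  unfolding lo_def by auto

lemma hi_range: "k \<in> hi n U d \<Longrightarrow> fst d \<le> snd d \<Longrightarrow> k \<in> {1..n} \<and> fst d \<le> k \<and> k \<le> snd d"
  unfolding hi_def by auto

lemma lo_or_hi: "k \<in> {1..n} \<Longrightarrow> fst d \<le> k \<Longrightarrow> k \<le> snd d \<Longrightarrow> k \<in> lo n U d \<or> k \<in> hi n U d"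
  unfolding lo_def hi_def by auto

lemma lo_not_hi: "k \<in> lo n U d \<Longrightarrow> fst d < snd d \<Longrightarrow> k \<notin> hi n U d"
  unfolding lo_def hi_def by auto

lemma diagD: "d \<in> diag n U \<Longrightarrow> fst d < snd d \<and> snd d \<le> n + 1"
  unfolding diag_def by auto

lemma ccross_irrefl: "d \<in> diag n U \<Longrightarrow> \<not> ccross n U d d"
  unfolding ccross_def using lo_not_hi diagD by blast

lemma triD: "d \<in> tri n U I \<Longrightarrow> p \<in> lo n U d \<Longrightarrow> q \<in> hi n U d \<Longrightarrow> bf I p q"
  unfolding tri_def by auto

lemma tri_diag: "d \<in> tri n U I \<Longrightarrow> d \<in> diag n U"
  unfolding tri_def by auto

lemma tri_noncross:
  assumes "biclosed n I" "d \<in> tri n U I" "e \<in> tri n U I"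
  shows "\<not> ccross n U d e"
proof
  assume "ccross n U d e"
  then obtain p q where "p \<in> lo n U d" "p \<in> hi n U e" "q \<in> hi n U d" "q \<in> lo n U e"
    unfolding ccross_def by auto
  then have "bf I p q" "bf I q p" using assms triD by metis+
  then show False using bf_asym[OF assms(1)] by blast
qed

definition downset :: "nat \<Rightarrow> (nat \<times> nat) set \<Rightarrow> nat set \<Rightarrow> bool" where
  "downset n I S \<longleftrightarrow> (\<forall>p\<in>{1..n}. \<forall>q\<in>S. bf I p q \<longrightarrow> p \<in> S)"

lemma downset_le: "biclosed n I \<Longrightarrow> downset n I {u \<in> {1..n}. u = q \<or> bf I u q}"
  unfolding downset_def using bf_trans by blast

lemma downset_less: "biclosed n I \<Longrightarrow> downset n I {u \<in> {1..n}. bf I u q}"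
  unfolding downset_def using bf_trans by blast

text \<open>After the letters of a down-set \<open>S\<close> have been read, the current path of the paper visits
  the unread lower and the read upper vertices; \<open>f\<close> is its edge spanning \<open>p\<close> and \<open>q\<close>.\<close>
lemma path_edge:
  assumes I: "biclosed n I" and S: "downset n I S"
    and q: "q \<in> {1..n}" "q \<in> S" and p: "p \<in> {1..n}" "p \<notin> S"
    and gap: "\<And>m. min p q < m \<Longrightarrow> m < max p q \<Longrightarrow> m \<in> U \<longleftrightarrow> m \<notin> S"
  obtains f where "f \<in> tri n U I" "lo n U f \<subseteq> S" "hi n U f \<inter> S = {}"
    "q \<in> lo n U f" "p \<in> hi n U f"
proof -
  define V where "V = {0, n + 1} \<union> {m \<in> {1..n}. m \<in> U \<longleftrightarrow> m \<in> S}"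
  define k where "k = Max {m \<in> V. m \<le> min p q}"
  define l where "l = Min {m \<in> V. max p q \<le> m}"
  have fin: "finite V" unfolding V_def by auto
  have ne: "0 \<in> {m \<in> V. m \<le> min p q}" "n + 1 \<in> {m \<in> V. max p q \<le> m}"
    using p q by (auto simp: V_def)
  have "k \<in> {m \<in> V. m \<le> min p q}"
    using ne(1) fin unfolding k_def by (intro Max_in) auto
  then have k: "k \<in> V" "k \<le> min p q" by auto
  have "l \<in> {m \<in> V. max p q \<le> m}"
    using ne(2) fin unfolding l_def by (intro Min_in) auto
  then have l: "l \<in> V" "max p q \<le> l" by auto
  \<comment> \<open>By extremality of \<open>k\<close> and \<open>l\<close> such a vertex would lie
    strictly between \<open>p\<close> and \<open>q\<close>, where \<open>gap\<close> says that the
    path visits nothing.\<close>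
  have noV: "m \<notin> V" if "k < m" "m < l" for m
  proof
    assume m: "m \<in> V"
    have "m \<le> k" if "m \<le> min p q" unfolding k_def using that fin m by (intro Max_ge) auto
    moreover have "l \<le> m" if "max p q \<le> m" unfolding l_def using that fin m by (intro Min_le) auto
    ultimately have "min p q < m" "m < max p q" using that by linarith+
    then show False using gap[of m] m p q unfolding V_def by auto
  qed
  have ln: "l \<le> n + 1" using l(1) unfolding V_def by auto
  have pq: "p \<noteq> q" using p q by auto
  have kl: "k < l" using k(2) l(2) pq by auto
  define f where "f = (k, l)"
  have los: "lo n U f \<subseteq> S"
    using noV k(1) l(1) unfolding lo_def f_def V_def by fastforce
  have his: "hi n U f \<inter> S = {}"
    using noV k(1) l(1) unfolding hi_def f_def V_def by fastforce
  have ql: "q \<in> lo n U f" using lo_or_hi[of q n f U] q his k(2) l(2) by (auto simp: f_def)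
  have ph: "p \<in> hi n U f" using lo_or_hi[of p n f U] p los k(2) l(2) by (auto simp: f_def)
  have "bf I x y" if "x \<in> lo n U f" "y \<in> hi n U f" for x y
  proof -
    have "x \<in> S" "y \<notin> S" "y \<in> {1..n}" using that los his by (auto simp: hi_def)
    then have "x \<noteq> y" "\<not> bf I y x" using S unfolding downset_def by blast+
    then show ?thesis using bf_total by blast
  qed
  then have "f \<in> tri n U I" using ql ph kl ln unfolding tri_def diag_def by (auto simp: f_def)
  then show thesis using that los his ql ph by blast
qed

text \<open>Take a violating pair whose letters are closest in value. A vertex between them on the
  path after reading \<open>S\<close> would form a closer violating pair with one of them, so the
  path has an edge spanning both.\<close>

lemma crossing_edge:
  assumes I: "biclosed n I" and S: "downset n I S" and d: "d \<in> diag n U"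
    and q: "q \<in> hi n U d" "q \<in> S" and p: "p \<in> lo n U d" "p \<notin> S"
  obtains f where "f \<in> tri n U I" "lo n U f \<subseteq> S" "hi n U f \<inter> S = {}" "ccross n U d f"
proof -
  define Q where "Q z \<longleftrightarrow> fst z \<in> hi n U d \<and> fst z \<in> S \<and> snd z \<in> lo n U d \<and> snd z \<notin> S" for z
  define w where "w z = max (fst z) (snd z) - min (fst z) (snd z)" for z :: "nat \<times> nat"
  have "Q (q, p)" using p q by (simp add: Q_def)
  then obtain z where Qz: "Q z" and minz: "\<And>y. Q y \<Longrightarrow> w z \<le> w y"
    using ex_has_least_nat[of Q "(q, p)" w] by blast
  obtain q' p' where z: "z = (q', p')" by (cases z)
  have q': "q' \<in> hi n U d" "q' \<in> S" and p': "p' \<in> lo n U d" "p' \<notin> S"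
    using Qz by (auto simp: Q_def z)
  have dd: "fst d < snd d" using d diagD by blast
  have rg: "q' \<in> {1..n}" "fst d \<le> q'" "q' \<le> snd d" "p' \<in> {1..n}" "fst d \<le> p'" "p' \<le> snd d"
    using hi_range[OF q'(1)] lo_range[OF p'(1)] dd by auto
  have gap: "m \<in> U \<longleftrightarrow> m \<notin> S" if m: "min p' q' < m" "m < max p' q'" for m
  proof (rule ccontr)
    assume c: "\<not> ?thesis"
    have mr: "m \<in> {1..n}" "fst d < m" "m < snd d" using m rg by (auto simp: min_def max_def split: if_splits)
    show False
    proof (cases "m \<in> U")
      case True
      then have "Q (m, p')" using c mr p' by (auto simp: Q_def hi_def)
      then show False using minz[of "(m, p')"] m by (auto simp: w_def z min_def max_def split: if_splits)
    next
      case False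
      then have "Q (q', m)" using c mr q' by (auto simp: Q_def lo_def)
      then show False using minz[of "(q', m)"] m by (auto simp: w_def z min_def max_def split: if_splits)
    qed
  qed
  obtain f where "f \<in> tri n U I" "lo n U f \<subseteq> S" "hi n U f \<inter> S = {}" "q' \<in> lo n U f" "p' \<in> hi n U f"
    using path_edge[OF I S rg(1) q'(2) rg(4) p'(2) gap] by blast
  then show thesis using that p' q' unfolding ccross_def by blast
qed

lemma tri_violation:
  assumes "d \<in> diag n U" "d \<notin> tri n U I"
  obtains p q where "p \<in> lo n U d" "q \<in> hi n U d" "bf I q p"
proof -
  obtain p q where pq: "p \<in> lo n U d" "q \<in> hi n U d" "\<not> bf I p q"
    using assms unfolding tri_def by blast
  then have "p \<noteq> q" using lo_not_hi diagD[OF assms(1)] by blast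
  then show thesis using that pq bf_total by blast
qed

lemma tri_ctri:
  assumes I: "biclosed n I"
  shows "ctri n U (tri n U I)"
proof -
  have "\<exists>e\<in>tri n U I. ccross n U d e" if d: "d \<in> diag n U" "d \<notin> tri n U I" for d
  proof -
    obtain p q where pq: "p \<in> lo n U d" "q \<in> hi n U d" "bf I q p"
      using tri_violation[OF d] by blast
    \<comment> \<open>Cutting the word just after \<open>q\<close> leaves \<open>p\<close> unread,
      so the path at that moment has an edge across \<open>d\<close>.\<close>
    have "q \<in> {u \<in> {1..n}. u = q \<or> bf I u q}" using pq(2) by (simp add: hi_def)
    moreover have "p \<notin> {u \<in> {1..n}. u = q \<or> bf I u q}"
      using bf_asym[OF I pq(3)] bf_irrefl[OF I] pq(3) by auto
    ultimately obtain f where "f \<in> tri n U I" "ccross n U d f"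
      by (rule crossing_edge[OF I downset_le[OF I, of q] d(1) pq(2) _ pq(1)])
    then show ?thesis by blast
  qed
  then show ?thesis unfolding ctri_def using tri_diag tri_noncross[OF I] by blast
qed

lemma ctri_max:
  assumes "ctri n U T" "ctri n U T'" "T \<subseteq> T'"
  shows "T = T'"
proof -
  have "d \<in> T" if d: "d \<in> T'" for d
  proof (rule ccontr)
    assume "d \<notin> T"
    then obtain e where "e \<in> T" "ccross n U d e"
      using assms(1,2) d unfolding ctri_def by blast
    then show False using assms(2,3) d unfolding ctri_def by blast
  qed
  then show ?thesis using assms(3) by auto
qed

lemma tri_eqI: "biclosed n I \<Longrightarrow> biclosed n J \<Longrightarrow> tri n U I \<subseteq> tri n U J \<Longrightarrow> tri n U I = tri n U J"
  by (rule ctri_max) (auto intro: tri_ctri)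

subsection \<open>Every triangulation arises\<close>

text \<open>A cycle of \<open>R\<close> could be shortened at its largest letter, eventually
  contradicting asymmetry; so \<open>short\<close> is acyclicity in a form suited to inserting the
  letters in increasing order.\<close>

lemma linear_extension:
  fixes R :: "nat \<Rightarrow> nat \<Rightarrow> bool"
  assumes asym: "\<And>p q. R p q \<Longrightarrow> \<not> R q p"
    and short: "\<And>p m q. R p m \<Longrightarrow> R m q \<Longrightarrow> p < m \<Longrightarrow> q < m \<Longrightarrow> R p q"
  shows "\<exists>I. biclosed m I \<and> (\<forall>p\<in>{1..m}. \<forall>q\<in>{1..m}. R p q \<longrightarrow> bf I p q)"
proof (induction m)
  case 0
  have "biclosed 0 {}" by (rule biclosedI) auto
  then show ?case by auto
next
  case (Suc m)
  then obtain I where I: "biclosed m I"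
    and RI: "\<And>p q. p \<in> {1..m} \<Longrightarrow> q \<in> {1..m} \<Longrightarrow> R p q \<Longrightarrow> bf I p q" by blast
  define M where "M = Suc m"
  \<comment> \<open>The letters that must follow the new largest letter \<open>M\<close>: those
    required directly and all that come after them in \<open>I\<close>. \<open>M\<close> is inserted
    just before them.\<close>
  define W where "W = {u \<in> {1..m}. \<exists>q\<in>{1..m}. R M q \<and> (q = u \<or> bf I q u)}"
  define I' where "I' = I \<union> {(u, M) |u. u \<in> W}"
  have mem: "(a, c) \<in> I' \<longleftrightarrow> (a, c) \<in> I \<or> (c = M \<and> a \<in> W)" for a c
    unfolding I'_def by auto
  have rI: "1 \<le> a \<and> a < c \<and> c \<le> m" if "(a, c) \<in> I" for a c
    using biclosed_range[OF I that] .
  have up: "v \<in> W" if "u \<in> W" "bf I u v" "v \<in> {1..m}" for u v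
    using that bf_trans[OF I] unfolding W_def by blast
  have "biclosed (Suc m) I'"
  proof (rule biclosedI)
    show "1 \<le> a \<and> a < c \<and> c \<le> Suc m" if "(a, c) \<in> I'" for a c
      using that rI[of a c] unfolding mem by (auto simp: W_def M_def)
    show "(a, c) \<in> I'" if ab: "(a, b) \<in> I'" and bc: "(b, c) \<in> I'" for a b c
    proof -
      have "b < M" using bc rI[of b c] unfolding mem by (auto simp: W_def M_def)
      then have ab': "(a, b) \<in> I" using ab unfolding mem by auto
      show ?thesis
      proof (cases "(b, c) \<in> I")
        case True
        then show ?thesis using ab' biclosed_trans[OF I] unfolding mem by blast
      next
        case False
        then have "c = M" "b \<in> W" using bc unfolding mem by auto
        moreover have "bf I b a" using ab' rI[OF ab'] by (simp add: bf_def)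
        ultimately show ?thesis using up[of b a] rI[OF ab'] unfolding mem by auto
      qed
    qed
    show "(a, b) \<in> I' \<or> (b, c) \<in> I'" if ac: "(a, c) \<in> I'" and o: "a < b" "b < c" for a b c
    proof (cases "(a, c) \<in> I")
      case True
      then show ?thesis using biclosed_cotrans[OF I _ o] unfolding mem by blast
    next
      case False
      then have c: "c = M" "a \<in> W" using ac unfolding mem by auto
      have "b \<in> W" if "(a, b) \<notin> I"
        using up[OF c(2), of b] that o c(1) unfolding bf_def M_def by auto
      then show ?thesis using c(1) unfolding mem by blast
    qed
  qed
  moreover have "bf I' p q" if pq: "p \<in> {1..Suc m}" "q \<in> {1..Suc m}" "R p q" for p q
  proof -
    have neq: "p \<noteq> q" using asym pq(3) by blast
    consider "p \<le> m \<and> q \<le> m" | "p \<le> m \<and> q = M" | "p = M \<and> q \<le> m"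
      using neq pq unfolding M_def by fastforce
    then show ?thesis
    proof cases
      case 1
      then have "bf I p q" using RI pq by auto
      then show ?thesis using 1 by (auto simp: bf_def mem M_def)
    next
      case 2
      \<comment> \<open>Otherwise \<open>short\<close> at the peak \<open>M\<close> would contradict
        the order already built.\<close>
      have "p \<notin> W"
      proof
        assume "p \<in> W"
        then obtain u where u: "u \<in> {1..m}" "R M u" "u = p \<or> bf I u p" by (auto simp: W_def)
        have "R p u" using short[of p M u] pq 2 u by (auto simp: M_def)
        then have "bf I p u" using RI pq 2 u by auto
        then show False using u(3) bf_asym[OF I] bf_irrefl[OF I] by blast
      qed
      then show ?thesis using 2 rI[of p M] by (auto simp: bf_def mem M_def)
    next
      case 3
      then have "q \<in> W" using pq by (auto simp: W_def)
      then show ?thesis using 3 by (auto simp: bf_def mem M_def)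
    qed
  qed
  ultimately show ?case by blast
qed

lemma ctri_surj:
  assumes T: "ctri n U T"
  obtains I where "biclosed n I" "tri n U I = T"
proof -
  define R where "R p q \<longleftrightarrow> (\<exists>d\<in>T. p \<in> lo n U d \<and> q \<in> hi n U d)" for p q
  have dT: "fst d < snd d" if "d \<in> T" for d using that T diagD unfolding ctri_def by blast
  have asym: "\<not> R q p" if "R p q" for p q
    using that T unfolding R_def ctri_def ccross_def by blast
  \<comment> \<open>The larger of \<open>p\<close> and \<open>q\<close> lies in value between the
    other one and \<open>m\<close>, hence in the span of the diagonal relating those two. It is on
    the \<open>lo\<close> or the \<open>hi\<close> side there, and one of the answers contradicts
    asymmetry.\<close>
  have short: "R p q" if pm: "R p m" and mq: "R m q" and lt: "p < m" "q < m" for p m q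
  proof -
    obtain e where e: "e \<in> T" "p \<in> lo n U e" "m \<in> hi n U e" using pm R_def by auto
    obtain f where f: "f \<in> T" "m \<in> lo n U f" "q \<in> hi n U f" using mq R_def by auto
    have er: "p \<in> {1..n}" "fst e \<le> p" "m \<le> snd e"
      using lo_range[OF e(2)] hi_range[OF e(3)] dT[OF e(1)] by auto
    have fr: "q \<in> {1..n}" "fst f \<le> q" "m \<le> snd f"
      using lo_range[OF f(2)] hi_range[OF f(3)] dT[OF f(1)] by auto
    have "p \<noteq> q" using asym pm mq by blast
    then consider "p < q" | "q < p" by linarith
    then show ?thesis
    proof cases
      case 1
      then have "q \<in> lo n U e \<or> q \<in> hi n U e" using lo_or_hi[of q n e U] er fr lt by auto
      then show ?thesis using asym[OF mq] e unfolding R_def by blast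
    next
      case 2
      then have "p \<in> lo n U f \<or> p \<in> hi n U f" using lo_or_hi[of p n f U] er fr lt by auto
      then show ?thesis using asym[OF pm] f unfolding R_def by blast
    qed
  qed
  have "\<exists>I. biclosed n I \<and> (\<forall>p\<in>{1..n}. \<forall>q\<in>{1..n}. R p q \<longrightarrow> bf I p q)"
  proof (rule linear_extension)
    show "\<not> R q p" if "R p q" for p q using asym that .
    show "R p q" if "R p m" "R m q" "p < m" "q < m" for p m q using short that .
  qed
  then obtain I where I: "biclosed n I" and RI: "\<forall>p\<in>{1..n}. \<forall>q\<in>{1..n}. R p q \<longrightarrow> bf I p q"
    by blast
  have "T \<subseteq> tri n U I"
  proof
    fix d assume d: "d \<in> T"
    have "bf I p q" if "p \<in> lo n U d" "q \<in> hi n U d" for p q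
      using RI that d lo_range hi_range dT unfolding R_def by (metis less_imp_le)
    then show "d \<in> tri n U I" using d T unfolding tri_def ctri_def by blast
  qed
  then show thesis using that I ctri_max[OF T tri_ctri[OF I]] by blast
qed

subsection \<open>Local sorting operators\<close>

text \<open>\<open>rset\<close> sorts, stably, the letters after \<open>b\<close> (for \<open>b\<close> up) or before \<open>b\<close> (for \<open>b\<close> down) so that
  those smaller than \<open>b\<close> come first; \<open>Rset\<close> puts those larger than \<open>b\<close> first.
  Both stay within a Cambrian class, and both are monotone.\<close>
definition rset :: "nat set \<Rightarrow> nat \<Rightarrow> (nat \<times> nat) set \<Rightarrow> (nat \<times> nat) set" where
  "rset U b I = {(a, c) \<in> I. a < b \<and> b < c \<longrightarrow> (if b \<in> U then (b, c) \<in> I else (a, b) \<in> I)}"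

text \<open>Complementing reverses the word and so exchanges the letters before \<open>b\<close>
  with those after it; hence \<open>U\<close> is complemented too.\<close>

definition Rset :: "nat \<Rightarrow> nat set \<Rightarrow> nat \<Rightarrow> (nat \<times> nat) set \<Rightarrow> (nat \<times> nat) set" where
  "Rset n U b I = prs n - rset (- U) b (prs n - I)"

lemma rset_mem: "(a, c) \<in> rset U b I \<longleftrightarrow>
    (a, c) \<in> I \<and> (a < b \<and> b < c \<longrightarrow> (if b \<in> U then (b, c) \<in> I else (a, b) \<in> I))"
  unfolding rset_def by auto

lemma Rset_mem: "biclosed n I \<Longrightarrow> (a, c) \<in> Rset n U b I \<longleftrightarrow>
    (a, c) \<in> I \<or> (1 \<le> a \<and> a < b \<and> b < c \<and> c \<le> n \<and> (if b \<in> U then (a, b) \<in> I else (b, c) \<in> I))"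
  unfolding Rset_def rset_def by (auto simp: prs_def dest: biclosed_range)

lemma rset_subset: "rset U b I \<subseteq> I"
  unfolding rset_def by auto

lemma rset_mono: "I \<subseteq> J \<Longrightarrow> rset U b I \<subseteq> rset U b J"
  unfolding rset_def by (auto split: if_splits)

lemma Rset_mono: "I \<subseteq> J \<Longrightarrow> Rset n U b I \<subseteq> Rset n U b J"
  unfolding Rset_def using rset_mono[of "prs n - J" "prs n - I" "- U" b] by auto

lemma Rset_superset: "biclosed n I \<Longrightarrow> I \<subseteq> Rset n U b I"
  using Rset_mem by fastforce

lemma rset_biclosed:
  assumes I: "biclosed n I"
  shows "biclosed n (rset U b I)"
proof (rule biclosedI)
  show "1 \<le> a \<and> a < c \<and> c \<le> n" if "(a, c) \<in> rset U b I" for a c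
    using that biclosed_range[OF I] unfolding rset_mem by blast
  show "(a, e) \<in> rset U b I" if "(a, c) \<in> rset U b I" "(c, e) \<in> rset U b I" for a c e
  proof -
    have ae: "(a, e) \<in> I" using that biclosed_trans[OF I] unfolding rset_mem by blast
    consider "b < c" | "b = c" | "c < b" by linarith
    then show ?thesis
      using that ae biclosed_trans[OF I, of b c e] biclosed_trans[OF I, of a c b]
        biclosed_range[OF I, of a c] biclosed_range[OF I, of c e]
      unfolding rset_mem by cases (auto split: if_splits)
  qed
  show "(a, c) \<in> rset U b I \<or> (c, e) \<in> rset U b I"
    if "(a, e) \<in> rset U b I" "a < c" "c < e" for a c e
  proof -
    have ae: "(a, c) \<in> I \<or> (c, e) \<in> I" using that biclosed_cotrans[OF I] unfolding rset_mem by blast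
    consider "b < c" | "b = c" | "c < b" by linarith
    then show ?thesis
      using that ae biclosed_cotrans[OF I, of b e c] biclosed_cotrans[OF I, of a b c]
      unfolding rset_mem by cases (auto split: if_splits)
  qed
qed

lemma Rset_biclosed: "biclosed n I \<Longrightarrow> biclosed n (Rset n U b I)"
  unfolding Rset_def by (intro biclosed_compl rset_biclosed)

text \<open>A letter \<open>b\<close> strictly inside the span of \<open>d\<close> is in
  \<open>hi\<close> if up and in \<open>lo\<close> if down, so it is read after every
  \<open>lo\<close> letter or before every \<open>hi\<close> letter respectively. Hence a
  \<open>lo\<close> and a \<open>hi\<close> letter never both stand on the side of \<open>b\<close>
  that gets sorted, and their order survives.\<close>

lemma tri_rset:
  assumes I: "biclosed n I"
  shows "tri n U (rset U b I) = tri n U I"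
proof (rule tri_eqI[symmetric, OF I rset_biclosed[OF I]], rule subsetI)
  fix d assume d: "d \<in> tri n U I"
  have dd: "fst d < snd d" using d tri_diag diagD by blast
  have "bf (rset U b I) p q" if pq: "p \<in> lo n U d" "q \<in> hi n U d" for p q
  proof -
    have b1: "bf I p q" using triD[OF d pq] .
    have rg: "p \<in> {1..n}" "fst d \<le> p" "p \<le> snd d" "q \<in> {1..n}" "fst d \<le> q" "q \<le> snd d"
      using lo_range[OF pq(1)] hi_range[OF pq(2)] dd by auto
    show ?thesis
    proof (cases "q < b \<and> b < p")
      case True
      then have br: "b \<in> {1..n}" "fst d < b" "b < snd d" using rg by auto
      have "bf I p b" if "b \<in> U" using br that triD[OF d pq(1), of b] by (simp add: hi_def)
      moreover have "bf I b q" if "b \<notin> U" using br that triD[OF d _ pq(2), of b] by (simp add: lo_def)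
      ultimately show ?thesis using b1 True by (auto simp: bf_def rset_mem)
    next
      case False
      then show ?thesis using b1 by (auto simp: bf_def rset_mem)
    qed
  qed
  then show "d \<in> tri n U (rset U b I)" using d unfolding tri_def by blast
qed

lemma tri_Rset:
  assumes I: "biclosed n I"
  shows "tri n U (Rset n U b I) = tri n U I"
proof (rule tri_eqI[symmetric, OF I Rset_biclosed[OF I]], rule subsetI)
  fix d assume d: "d \<in> tri n U I"
  have dd: "fst d < snd d" using d tri_diag diagD by blast
  have "bf (Rset n U b I) p q" if pq: "p \<in> lo n U d" "q \<in> hi n U d" for p q
  proof -
    have b1: "bf I p q" using triD[OF d pq] .
    have rg: "p \<in> {1..n}" "fst d \<le> p" "p \<le> snd d" "q \<in> {1..n}" "fst d \<le> q" "q \<le> snd d"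
      using lo_range[OF pq(1)] hi_range[OF pq(2)] dd by auto
    show ?thesis
    proof (cases "p < b \<and> b < q")
      case True
      then have br: "b \<in> {1..n}" "fst d < b" "b < snd d" using rg by auto
      have "bf I p b" if "b \<in> U" using br that triD[OF d pq(1), of b] by (simp add: hi_def)
      moreover have "bf I b q" if "b \<notin> U" using br that triD[OF d _ pq(2), of b] by (simp add: lo_def)
      ultimately show ?thesis using b1 True by (auto simp: bf_def Rset_mem[OF I])
    next
      case False
      then show ?thesis using b1 by (auto simp: bf_def Rset_mem[OF I])
    qed
  qed
  then show "d \<in> tri n U (Rset n U b I)" using d unfolding tri_def by blast
qed

text \<open>If \<open>(a, c)\<close> is removed at \<open>b\<close>, one of its halves at
  \<open>b\<close> is missing from \<open>I\<close>; by cotransitivity the other half is present,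
  survives the sorting, and makes \<open>Rset\<close> put \<open>(a, c)\<close> back.\<close>

lemma Rset_rset: "biclosed n I \<Longrightarrow> I \<subseteq> Rset n U b (rset U b I)"
proof
  fix z assume I: "biclosed n I" and "z \<in> I"
  obtain a c where z: "z = (a, c)" by (cases z)
  then have ac: "(a, c) \<in> I" using \<open>z \<in> I\<close> by simp
  show "z \<in> Rset n U b (rset U b I)"
    unfolding z Rset_mem[OF rset_biclosed[OF I]]
    using ac biclosed_range[OF I ac] biclosed_cotrans[OF I ac, of b] by (auto simp: rset_mem)
qed

lemma rset_sep:
  assumes "w < b" "b < u"
    and "if b \<in> U then bf (rset U b I) b w \<and> bf (rset U b I) b u
         else bf (rset U b I) w b \<and> bf (rset U b I) u b"
  shows "bf (rset U b I) w u"
  using assms by (auto simp: bf_def rset_mem split: if_splits)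

lemma Rset_sep:
  assumes "biclosed n I" "w < b" "b < u" "1 \<le> w" "u \<le> n"
    and "if b \<in> U then bf (Rset n U b I) b w \<and> bf (Rset n U b I) b u
         else bf (Rset n U b I) w b \<and> bf (Rset n U b I) u b"
  shows "bf (Rset n U b I) u w"
  using assms by (auto simp: bf_def Rset_mem split: if_splits)

lemma rset_bf_other:
  "\<not> (p < b \<and> b < q) \<Longrightarrow> \<not> (q < b \<and> b < p) \<Longrightarrow> bf (rset U b I) p q \<longleftrightarrow> bf I p q"
  by (auto simp: bf_def rset_mem)

lemma Rset_bf_other:
  "biclosed n I \<Longrightarrow> \<not> (p < b \<and> b < q) \<Longrightarrow> \<not> (q < b \<and> b < p) \<Longrightarrow>
    bf (Rset n U b I) p q \<longleftrightarrow> bf I p q"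
  by (auto simp: bf_def Rset_mem)

subsection \<open>Least and greatest elements of the classes\<close>

definition sortable :: "nat set \<Rightarrow> (nat \<times> nat) set \<Rightarrow> bool" where
  "sortable U I \<longleftrightarrow> (\<forall>b. I \<subseteq> rset U b I)"

definition antisortable :: "nat \<Rightarrow> nat set \<Rightarrow> (nat \<times> nat) set \<Rightarrow> bool" where
  "antisortable n U I \<longleftrightarrow> (\<forall>b. Rset n U b I \<subseteq> I)"

definition rstep :: "nat \<Rightarrow> nat set \<Rightarrow> (nat \<times> nat) set \<Rightarrow> (nat \<times> nat) set \<Rightarrow> bool" where
  "rstep n U I J \<longleftrightarrow> biclosed n I \<and> (\<exists>b. J = rset U b I)"

definition Rstep :: "nat \<Rightarrow> nat set \<Rightarrow> (nat \<times> nat) set \<Rightarrow> (nat \<times> nat) set \<Rightarrow> bool" where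
  "Rstep n U I J \<longleftrightarrow> biclosed n I \<and> (\<exists>b. J = Rset n U b I)"

text \<open>Sorting steps may be taken in any order, so some terminal set is chosen. Independence of
  the choice follows once the result is seen to be the greatest sortable subset.\<close>

definition dn :: "nat \<Rightarrow> nat set \<Rightarrow> (nat \<times> nat) set \<Rightarrow> (nat \<times> nat) set" where
  "dn n U I = (SOME Z. (rstep n U)\<^sup>*\<^sup>* I Z \<and> sortable U Z)"

definition up :: "nat \<Rightarrow> nat set \<Rightarrow> (nat \<times> nat) set \<Rightarrow> (nat \<times> nat) set" where
  "up n U I = (SOME Z. (Rstep n U)\<^sup>*\<^sup>* I Z \<and> antisortable n U Z)"

lemma dn_steps:
  assumes "biclosed n I"
  shows "(rstep n U)\<^sup>*\<^sup>* I (dn n U I) \<and> sortable U (dn n U I)"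
  unfolding dn_def
proof (rule someI_ex, use assms in \<open>induction "card I" arbitrary: I rule: less_induct\<close>)
  case less
  show ?case
  proof (cases "sortable U I")
    case True
    then show ?thesis by blast
  next
    case False
    then obtain b where "\<not> I \<subseteq> rset U b I" unfolding sortable_def by blast
    then have "rset U b I \<subset> I" using rset_subset[of U b I] by blast
    then have "card (rset U b I) < card I"
      by (rule psubset_card_mono[OF biclosed_finite[OF less.prems]])
    then obtain Z where "(rstep n U)\<^sup>*\<^sup>* (rset U b I) Z \<and> sortable U Z"
      using less.hyps rset_biclosed[OF less.prems] by blast
    moreover have "rstep n U I (rset U b I)" using less.prems unfolding rstep_def by blast
    ultimately show ?thesis by (blast intro: converse_rtranclp_into_rtranclp)
  qed
qed

lemma finite_prs: "finite (prs n)"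
  by (rule finite_subset[of _ "{1..n} \<times> {1..n}"]) (auto simp: prs_def)

lemma up_steps:
  assumes "biclosed n I"
  shows "(Rstep n U)\<^sup>*\<^sup>* I (up n U I) \<and> antisortable n U (up n U I)"
  unfolding up_def
proof (rule someI_ex, use assms in \<open>induction "card (prs n - I)" arbitrary: I rule: less_induct\<close>)
  case less
  show ?case
  proof (cases "antisortable n U I")
    case True
    then show ?thesis by blast
  next
    case False
    then obtain b where b: "\<not> Rset n U b I \<subseteq> I" unfolding antisortable_def by blast
    have "I \<subseteq> Rset n U b I" "Rset n U b I \<subseteq> prs n"
      using Rset_superset[OF less.prems] biclosed_prs[OF Rset_biclosed[OF less.prems]] .
    then have "prs n - Rset n U b I \<subset> prs n - I" using b by auto
    then have "card (prs n - Rset n U b I) < card (prs n - I)"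
      by (intro psubset_card_mono) (simp_all add: finite_prs)
    then obtain Z where "(Rstep n U)\<^sup>*\<^sup>* (Rset n U b I) Z \<and> antisortable n U Z"
      using less.hyps Rset_biclosed[OF less.prems] by blast
    moreover have "Rstep n U I (Rset n U b I)" using less.prems unfolding Rstep_def by blast
    ultimately show ?thesis by (blast intro: converse_rtranclp_into_rtranclp)
  qed
qed

text \<open>The last clause links the two directions: an antisortable set containing the sorted set
  is closed under \<open>Rset\<close>, hence contains everything that sorting removed.\<close>

lemma rsteps_props:
  assumes "(rstep n U)\<^sup>*\<^sup>* I Z" "biclosed n I"
  shows "biclosed n Z \<and> Z \<subseteq> I \<and> tri n U Z = tri n U I \<and>
    (\<forall>W. sortable U W \<and> W \<subseteq> I \<longrightarrow> W \<subseteq> Z) \<and> (\<forall>W. antisortable n U W \<and> Z \<subseteq> W \<longrightarrow> I \<subseteq> W)"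
  using assms
proof (induction rule: rtranclp_induct)
  case base
  then show ?case by blast
next
  case (step Y Z)
  from step(2) obtain b where Y: "biclosed n Y" and Z: "Z = rset U b Y" unfolding rstep_def by auto
  have "Y \<subseteq> W" if W: "antisortable n U W" "Z \<subseteq> W" for W
  proof -
    have "Y \<subseteq> Rset n U b Z" unfolding Z by (rule Rset_rset[OF Y])
    also have "\<dots> \<subseteq> Rset n U b W" by (rule Rset_mono[OF W(2)])
    also have "\<dots> \<subseteq> W" using W(1) by (simp add: antisortable_def)
    finally show ?thesis .
  qed
  moreover have "W \<subseteq> Z" if W: "sortable U W" "W \<subseteq> Y" for W
    using rset_mono[OF W(2), of U b] W(1) unfolding Z sortable_def by auto
  moreover have "biclosed n Z" "Z \<subseteq> Y" "tri n U Z = tri n U Y"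
    unfolding Z by (auto simp: tri_rset[OF Y] rset_biclosed[OF Y] dest: subsetD[OF rset_subset])
  ultimately show ?case using step by (metis subset_trans)
qed

lemma Rsteps_props:
  assumes "(Rstep n U)\<^sup>*\<^sup>* I Z" "biclosed n I"
  shows "biclosed n Z \<and> I \<subseteq> Z \<and> tri n U Z = tri n U I \<and>
    (\<forall>W. antisortable n U W \<and> I \<subseteq> W \<longrightarrow> Z \<subseteq> W)"
  using assms
proof (induction rule: rtranclp_induct)
  case base
  then show ?case by blast
next
  case (step Y Z)
  from step(2) obtain b where Y: "biclosed n Y" and Z: "Z = Rset n U b Y" unfolding Rstep_def by auto
  have "Z \<subseteq> W" if W: "antisortable n U W" "Y \<subseteq> W" for W
    using Rset_mono[OF W(2), of n U b] W(1) unfolding Z antisortable_def by auto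
  moreover have "biclosed n Z" "Y \<subseteq> Z" "tri n U Z = tri n U Y"
    unfolding Z by (auto simp: tri_Rset[OF Y] Rset_biclosed[OF Y] dest: subsetD[OF Rset_superset[OF Y]])
  ultimately show ?case using step by (metis subset_trans)
qed

lemmas dn_props = rsteps_props[OF conjunct1[OF dn_steps]]
lemmas up_props = Rsteps_props[OF conjunct1[OF up_steps]]

lemma dn_biclosed: "biclosed n I \<Longrightarrow> biclosed n (dn n U I)"
  by (simp add: dn_props)

lemma dn_subset: "biclosed n I \<Longrightarrow> dn n U I \<subseteq> I"
  by (simp add: dn_props)

lemma tri_dn: "biclosed n I \<Longrightarrow> tri n U (dn n U I) = tri n U I"
  by (simp add: dn_props)

lemma dn_greatest: "biclosed n I \<Longrightarrow> sortable U W \<Longrightarrow> W \<subseteq> I \<Longrightarrow> W \<subseteq> dn n U I"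
  by (simp add: dn_props)

lemma dn_antisortable: "biclosed n I \<Longrightarrow> antisortable n U W \<Longrightarrow> dn n U I \<subseteq> W \<Longrightarrow> I \<subseteq> W"
  using dn_props[of n I U] by simp

lemma dn_sortable: "biclosed n I \<Longrightarrow> sortable U (dn n U I)"
  by (simp add: dn_steps)

lemma up_antisortable: "biclosed n I \<Longrightarrow> antisortable n U (up n U I)"
  by (simp add: up_steps)

lemma up_biclosed: "biclosed n I \<Longrightarrow> biclosed n (up n U I)"
  by (simp add: up_props)

lemma up_superset: "biclosed n I \<Longrightarrow> I \<subseteq> up n U I"
  by (simp add: up_props)

lemma tri_up: "biclosed n I \<Longrightarrow> tri n U (up n U I) = tri n U I"
  by (simp add: up_props)

lemma up_least: "biclosed n I \<Longrightarrow> antisortable n U W \<Longrightarrow> I \<subseteq> W \<Longrightarrow> up n U I \<subseteq> W"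
  by (simp add: up_props)

section \<open>Sortable sets as least elements of fibres\<close>

text \<open>Take an inversion \<open>(a, c)\<close> of \<open>Z\<close> missing from
  \<open>Y\<close> with \<open>c - a\<close> least, and cut the word of \<open>Z\<close> after
  \<open>c\<close>. Sortability places the upper letters between \<open>a\<close> and
  \<open>c\<close> after \<open>c\<close>, and minimality places the lower ones before it. So a path
  edge has \<open>c\<close> on its \<open>lo\<close> and \<open>a\<close> on its \<open>hi\<close>
  side; it belongs to the triangulation of \<open>Y\<close> too and forces \<open>c\<close> before
  \<open>a\<close> there.\<close>

lemma sortable_le:
  assumes z: "biclosed n Z" "sortable U Z" and y: "biclosed n Y" and t: "tri n U Z \<subseteq> tri n U Y"
  shows "Z \<subseteq> Y"
proof (rule ccontr)
  assume "\<not> Z \<subseteq> Y"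
  define Q where "Q w \<longleftrightarrow> w \<in> Z \<and> w \<notin> Y" for w
  obtain w0 where "Q w0" using \<open>\<not> Z \<subseteq> Y\<close> unfolding Q_def by blast
  then obtain w where Qw: "Q w" and minw: "\<And>v. Q v \<Longrightarrow> snd w - fst w \<le> snd v - fst v"
    using ex_has_least_nat[of Q w0 "\<lambda>w. snd w - fst w"] by blast
  obtain a c where w: "w = (a, c)" by (cases w)
  have ac: "(a, c) \<in> Z" "(a, c) \<notin> Y" using Qw by (auto simp: Q_def w)
  have rg: "1 \<le> a" "a < c" "c \<le> n" using biclosed_range[OF z(1) ac(1)] by auto
  have small: "(u, v) \<in> Y" if "(u, v) \<in> Z" "v - u < c - a" for u v
    using minw[of "(u, v)"] that by (auto simp: Q_def w)
  define S where "S = {u \<in> {1..n}. u = c \<or> bf Z u c}"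
  have srt: "(m, c) \<in> Z" if "m \<in> U" "a < m" "m < c" for m
    using z(2) ac(1) that unfolding sortable_def by (meson rset_mem subsetD)
  have srt': "(a, m) \<in> Z" if "m \<notin> U" "a < m" "m < c" for m
    using z(2) ac(1) that unfolding sortable_def by (meson rset_mem subsetD)
  have aS: "a \<notin> S" using ac rg by (auto simp: S_def bf_def)
  have gap: "m \<in> U \<longleftrightarrow> m \<notin> S" if m: "min a c < m" "m < max a c" for m
  proof (cases "m \<in> U")
    case True
    then show ?thesis using srt[of m] m rg by (auto simp: S_def bf_def)
  next
    case False
    have m': "a < m" "m < c" using m rg by auto
    have "(a, m) \<in> Y" using small[OF srt'[OF False m']] m' by auto
    then have "(m, c) \<notin> Z" using small[of m c] m' ac biclosed_trans[OF y, of a m c] by auto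
    then show ?thesis using m' rg False by (auto simp: S_def bf_def)
  qed
  have "downset n Z S" unfolding S_def by (rule downset_le[OF z(1)])
  moreover have "c \<in> {1..n}" "c \<in> S" "a \<in> {1..n}" using rg by (auto simp: S_def)
  ultimately obtain f where "f \<in> tri n U Z" "c \<in> lo n U f" "a \<in> hi n U f"
    using path_edge[OF z(1) _ _ _ _ aS, of c U] gap by metis
  then have "bf Y c a" using t triD by blast
  then show False using ac rg by (simp add: bf_def)
qed

lemma tri_subset_dn:
  assumes "biclosed n I" "biclosed n J" "tri n U I = tri n U J"
  shows "dn n U I \<subseteq> J"
  using assms tri_dn[OF assms(1)]
  by (intro sortable_le[OF dn_biclosed[OF assms(1)] dn_sortable[OF assms(1)] assms(2)]) simp

lemma tri_eq_dn:
  assumes I: "biclosed n I" and J: "biclosed n J" and t: "tri n U I = tri n U J"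
  shows "dn n U I = dn n U J"
proof
  show "dn n U I \<subseteq> dn n U J"
    by (rule dn_greatest[OF J dn_sortable[OF I] tri_subset_dn[OF I J t]])
  show "dn n U J \<subseteq> dn n U I"
    by (rule dn_greatest[OF I dn_sortable[OF J] tri_subset_dn[OF J I t[symmetric]]])
qed

subsection \<open>Flips\<close>

text \<open>A vertex on the \<open>lo\<close> side of one diagonal and the \<open>hi\<close> side of
  the other would be read strictly between the neighbours \<open>a\<close> and \<open>c\<close>. If
  the diagonals had different end points, one of these would be such a vertex.\<close>

lemma adj_unique:
  assumes I: "biclosed n I" and ac: "adj n I a c"
    and d: "d \<in> tri n U I" "a \<in> lo n U d" "c \<in> hi n U d"
    and e: "e \<in> tri n U I" "a \<in> lo n U e" "c \<in> hi n U e"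
  shows "d = e"
proof -
  have not_both: "\<not> (u \<in> lo n U x \<and> u \<in> hi n U y)"
    if x: "x \<in> tri n U I" "c \<in> hi n U x" and y: "y \<in> tri n U I" "a \<in> lo n U y" for u x y
  proof
    assume u: "u \<in> lo n U x \<and> u \<in> hi n U y"
    have "bf I u c" "bf I a u" using triD[OF x(1) _ x(2)] triD[OF y(1) y(2)] u by blast+
    moreover have "u \<in> {1..n}" using u by (simp add: lo_def)
    ultimately show False using ac unfolding adj_def by blast
  qed
  have nb: "\<not> (u \<in> lo n U d \<and> u \<in> hi n U e)" "\<not> (u \<in> lo n U e \<and> u \<in> hi n U d)" for u
    using not_both d e by blast+
  have dd: "fst d < snd d" "fst e < snd e" "snd d \<le> n + 1" "snd e \<le> n + 1"
    using d e tri_diag diagD by blast+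
  have rg: "a \<in> {1..n}" "c \<in> {1..n}" "fst d \<le> a" "a \<le> snd d" "fst e \<le> a" "a \<le> snd e"
    "fst d \<le> c" "c \<le> snd d" "fst e \<le> c" "c \<le> snd e"
    using lo_range[OF d(2)] lo_range[OF e(2)] hi_range[OF d(3)] hi_range[OF e(3)] dd by auto
  have ne: "a \<noteq> c" using adj_neq[OF I ac] .
  have "fst d = fst e"
  proof (rule ccontr)
    assume "fst d \<noteq> fst e"
    \<comment> \<open>The inner of the two left ends is an interior vertex of one diagonal and an
      end point of the other, and \<open>lo\<close> and \<open>hi\<close> treat these two roles
      oppositely.\<close>
    then consider "fst d < fst e" | "fst e < fst d" by linarith
    then show False
    proof cases
      case 1
      then show False using nb[of "fst e"] dd rg ne
        by (cases "fst e \<in> U") (auto simp: lo_def hi_def)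
    next
      case 2
      then show False using nb[of "fst d"] dd rg ne
        by (cases "fst d \<in> U") (auto simp: lo_def hi_def)
    qed
  qed
  moreover have "snd d = snd e"
  proof (rule ccontr)
    assume "snd d \<noteq> snd e"
    then consider "snd d < snd e" | "snd e < snd d" by linarith
    then show False
    proof cases
      case 1
      then show False using nb[of "snd d"] dd rg ne
        by (cases "snd d \<in> U") (auto simp: lo_def hi_def)
    next
      case 2
      then show False using nb[of "snd e"] dd rg ne
        by (cases "snd e \<in> U") (auto simp: lo_def hi_def)
    qed
  qed
  ultimately show ?thesis by (simp add: prod_eq_iff)
qed

lemma adj_swp:
  assumes I: "biclosed n I" and ac: "adj n I a c"
  shows "adj n (swp I a c) c a"
proof -
  note ne = adj_neq[OF I ac]
  have b: "bf I a c" using ac by (simp add: adj_def)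
  have "\<not> (bf (swp I a c) c e \<and> bf (swp I a c) e a)" for e
    unfolding bf_swp[OF ne b]
    using b bf_asym[OF I] bf_trans[OF I] bf_irrefl[OF I] ne by metis
  then show ?thesis using ac ne unfolding adj_def bf_swp[OF ne b] by blast
qed

lemma tri_swp_diff:
  assumes I: "biclosed n I" and ac: "adj n I a c" and e: "e \<in> tri n U I" "e \<notin> tri n U (swp I a c)"
  shows "a \<in> lo n U e" "c \<in> hi n U e"
proof -
  note ne = adj_neq[OF I ac]
  have b: "bf I a c" using ac by (simp add: adj_def)
  obtain p q where pq: "p \<in> lo n U e" "q \<in> hi n U e" "bf (swp I a c) q p"
    using tri_violation[OF tri_diag[OF e(1)] e(2)] .
  have "bf I p q" using triD[OF e(1) pq(1,2)] .
  then have "q = c \<and> p = a" using pq(3) bf_asym[OF I] unfolding bf_swp[OF ne b] by blast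
  then show "a \<in> lo n U e" "c \<in> hi n U e" using pq by auto
qed

lemma swp_swp: "biclosed n I \<Longrightarrow> adj n I a c \<Longrightarrow> swp (swp I a c) c a = I"
  using adj_neq[of n I a c] unfolding adj_def swp_def bf_def by (auto split: if_splits)

text \<open>A diagonal lost by the exchange demands \<open>a\<close> before \<open>c\<close>, a
  gained one the opposite, and there is at most one of each kind. If anything changes, maximality
  makes both exist.\<close>

lemma adj_flip:
  assumes I: "biclosed n I" and ac: "adj n I a c" and ne: "tri n U (swp I a c) \<noteq> tri n U I"
  obtains d d' where "d \<in> tri n U I" "d' \<notin> tri n U I"
    "tri n U (swp I a c) = insert d' (tri n U I - {d})"
    "a \<in> lo n U d" "c \<in> hi n U d" "c \<in> lo n U d'" "a \<in> hi n U d'"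
proof -
  let ?J = "swp I a c"
  have J: "biclosed n ?J" by (rule swp_biclosed[OF I ac])
  have ca: "adj n ?J c a" by (rule adj_swp[OF I ac])
  have sw: "swp ?J c a = I" by (rule swp_swp[OF I ac])
  obtain d where d: "d \<in> tri n U I" "d \<notin> tri n U ?J" using tri_eqI[OF I J] ne by blast
  obtain d' where d': "d' \<in> tri n U ?J" "d' \<notin> tri n U I" using tri_eqI[OF J I] ne by blast
  note dl = tri_swp_diff[OF I ac d]
  have d'l: "c \<in> lo n U d'" "a \<in> hi n U d'" using tri_swp_diff[OF J ca d'(1)] d'(2) sw by auto
  have "e = d" if "e \<in> tri n U I" "e \<notin> tri n U ?J" for e
    using adj_unique[OF I ac that(1) tri_swp_diff[OF I ac that] d(1) dl] .
  moreover have "e = d'" if e: "e \<in> tri n U ?J" "e \<notin> tri n U I" for e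
    using adj_unique[OF J ca e(1) _ _ d'(1) d'l] tri_swp_diff[OF J ca e(1)] e(2) sw by auto
  ultimately have "tri n U ?J = insert d' (tri n U I - {d})" using d d' by blast
  then show thesis using that d(1) d'(2) dl d'l by blast
qed

section \<open>Realising a flip as an exchange of neighbours\<close>

lemma bf_last:
  assumes I: "biclosed n I" and "finite S" "S \<noteq> {}"
  shows "\<exists>a\<in>S. \<forall>p\<in>S. p = a \<or> bf I p a"
  using assms(2,3)
proof (induction rule: finite_ne_induct)
  case (insert x F)
  then obtain a where a: "a \<in> F" "\<forall>p\<in>F. p = a \<or> bf I p a" by blast
  then have "a \<noteq> x" using insert by blast
  then consider "bf I x a" | "bf I a x" using bf_total by blast
  then show ?case
  proof cases
    case 1
    then show ?thesis using a by blast
  next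
    case 2
    have "p = x \<or> bf I p x" if "p \<in> insert x F" for p
      using that a(2) bf_trans_le[OF I _ 2] by auto
    then show ?thesis by blast
  qed
qed blast

lemma bf_first:
  assumes I: "biclosed n I" and "finite S" "S \<noteq> {}"
  shows "\<exists>a\<in>S. \<forall>p\<in>S. p = a \<or> bf I a p"
  using assms(2,3)
proof (induction rule: finite_ne_induct)
  case (insert x F)
  then obtain a where a: "a \<in> F" "\<forall>p\<in>F. p = a \<or> bf I a p" by blast
  then have "a \<noteq> x" using insert by blast
  then consider "bf I x a" | "bf I a x" using bf_total by blast
  then show ?case
  proof cases
    case 1
    have "p = x \<or> bf I x p" if "p \<in> insert x F" for p
      using that a(2) 1 bf_trans[OF I 1] by auto
    then show ?thesis by blast
  next
    case 2
    then show ?thesis using a by blast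
  qed
qed blast

text \<open>Letters to the left of the interval of \<open>d\<close> can be moved out of the way without changing
  the triangulation, by sorting at the left end of \<open>d\<close>; similarly on the right.\<close>
lemma clear_left:
  assumes I: "biclosed n I" and d: "d \<in> tri n U I"
  obtains J where "biclosed n J" "tri n U J = tri n U I"
    "\<And>w. w \<in> {1..n} \<Longrightarrow> w < fst d \<Longrightarrow>
       \<not> ((\<forall>p\<in>lo n U d. bf J p w) \<and> (\<forall>q\<in>hi n U d. bf J w q))"
proof -
  have dd: "fst d < snd d" "snd d \<le> n + 1" "lo n U d \<noteq> {}" "hi n U d \<noteq> {}"
    using tri_diag[OF d] by (auto simp: diag_def)
  define i where "i = fst d"
  define J where "J = (if i \<in> U then Rset n U i I else rset U i I)"
  have J: "biclosed n J" "tri n U J = tri n U I"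
    unfolding J_def using rset_biclosed[OF I] Rset_biclosed[OF I] tri_rset[OF I] tri_Rset[OF I] by auto
  have dJ: "d \<in> tri n U J" using d J by simp
  have "\<not> ((\<forall>p\<in>lo n U d. bf J p w) \<and> (\<forall>q\<in>hi n U d. bf J w q))" if w: "w \<in> {1..n}" "w < fst d" for w
  proof
    assume h: "(\<forall>p\<in>lo n U d. bf J p w) \<and> (\<forall>q\<in>hi n U d. bf J w q)"
    have i: "i \<in> {1..n}" "w < i" using w dd by (auto simp: i_def)
    show False
    proof (cases "i \<in> U")
      case True
      then have il: "i \<in> lo n U d" using i by (simp add: lo_def i_def)
      obtain q where q: "q \<in> hi n U d" using dd by blast
      have "q \<noteq> i" using lo_not_hi[OF il dd(1)] q by blast
      then have qr: "i < q" "q \<le> n" using hi_range[OF q] dd by (auto simp: i_def)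
      have "bf J i w" "bf J i q" "bf J w q" using h il q triD[OF dJ il q] by blast+
      then have "bf J q w" unfolding J_def
        using True Rset_sep[OF I i(2) qr(1) _ qr(2), of U] w by auto
      then show False using \<open>bf J w q\<close> bf_asym[OF J(1)] by blast
    next
      case False
      then have ih: "i \<in> hi n U d" using i by (simp add: hi_def i_def)
      obtain p where p: "p \<in> lo n U d" using dd by blast
      have "p \<noteq> i" using lo_not_hi[OF p dd(1)] ih by blast
      then have pr: "i < p" "p \<le> n" using lo_range[OF p] dd by (auto simp: i_def)
      have "bf J w i" "bf J p i" "bf J p w" using h ih p triD[OF dJ p ih] by blast+
      then have "bf J w p" unfolding J_def
        using False rset_sep[OF i(2) pr(1), of U] by auto
      then show False using \<open>bf J p w\<close> bf_asym[OF J(1)] by blast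
    qed
  qed
  then show thesis using that J by blast
qed

lemma clear_right:
  assumes I: "biclosed n I" and d: "d \<in> tri n U I"
  obtains J where "biclosed n J" "tri n U J = tri n U I"
    "\<And>w. w \<in> {1..n} \<Longrightarrow> snd d < w \<Longrightarrow>
       \<not> ((\<forall>p\<in>lo n U d. bf J p w) \<and> (\<forall>q\<in>hi n U d. bf J w q))"
    "\<And>p q. p \<le> snd d \<Longrightarrow> q \<le> snd d \<Longrightarrow> bf J p q \<longleftrightarrow> bf I p q"
proof -
  have dd: "fst d < snd d" "snd d \<le> n + 1" "lo n U d \<noteq> {}" "hi n U d \<noteq> {}"
    using tri_diag[OF d] by (auto simp: diag_def)
  define j where "j = snd d"
  \<comment> \<open>For \<open>j\<close> in \<open>U\<close>, \<open>j\<close> is in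
    \<open>lo\<close>, and an intruding \<open>w\<close> and a \<open>hi\<close> letter
    \<open>q\<close> both follow it; \<open>rset\<close> then puts the smaller letter
    \<open>q\<close> first. For \<open>j\<close> outside \<open>U\<close> the mirrored argument uses
    \<open>Rset\<close>. Letters up to \<open>j\<close> keep their order, so what was cleared on the
    left stays cleared.\<close>
  define J where "J = (if j \<in> U then rset U j I else Rset n U j I)"
  have J: "biclosed n J" "tri n U J = tri n U I"
    unfolding J_def using rset_biclosed[OF I] Rset_biclosed[OF I] tri_rset[OF I] tri_Rset[OF I] by auto
  have dJ: "d \<in> tri n U J" using d J by simp
  have "\<not> ((\<forall>p\<in>lo n U d. bf J p w) \<and> (\<forall>q\<in>hi n U d. bf J w q))" if w: "w \<in> {1..n}" "snd d < w" for w
  proof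
    assume h: "(\<forall>p\<in>lo n U d. bf J p w) \<and> (\<forall>q\<in>hi n U d. bf J w q)"
    have j: "j \<in> {1..n}" "j < w" "w \<le> n" using w dd by (auto simp: j_def)
    show False
    proof (cases "j \<in> U")
      case True
      then have jl: "j \<in> lo n U d" using j by (simp add: lo_def j_def)
      obtain q where q: "q \<in> hi n U d" using dd by blast
      have "q \<noteq> j" using lo_not_hi[OF jl dd(1)] q by blast
      then have qr: "q < j" using hi_range[OF q] dd by (auto simp: j_def)
      have "bf J j w" "bf J j q" "bf J w q" using h jl q triD[OF dJ jl q] by blast+
      then have "bf J q w" unfolding J_def
        using True rset_sep[OF qr j(2), of U] by auto
      then show False using \<open>bf J w q\<close> bf_asym[OF J(1)] by blast
    next
      case False
      then have jh: "j \<in> hi n U d" using j by (simp add: hi_def j_def)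
      obtain p where p: "p \<in> lo n U d" using dd by blast
      have "p \<noteq> j" using lo_not_hi[OF p dd(1)] jh by blast
      then have pr: "p < j" "1 \<le> p" using lo_range[OF p] dd by (auto simp: j_def)
      have "bf J w j" "bf J p j" "bf J p w" using h jh p triD[OF dJ p jh] by blast+
      then have "bf J w p" unfolding J_def
        using False Rset_sep[OF I pr(1) j(2) pr(2) j(3), of U] by auto
      then show False using \<open>bf J p w\<close> bf_asym[OF J(1)] by blast
    qed
  qed
  moreover have "bf J p q \<longleftrightarrow> bf I p q" if "p \<le> snd d" "q \<le> snd d" for p q
    using that rset_bf_other[of p j q U I] Rset_bf_other[OF I, of p j q U] unfolding J_def j_def by auto
  ultimately show thesis using that J by blast
qed

text \<open>After both ends are cleared, take the last \<open>lo\<close> letter and the first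
  \<open>hi\<close> letter. A letter read between them would separate all of \<open>lo\<close> from
  all of \<open>hi\<close>: outside the span this has been excluded, and inside it the letter is
  itself in \<open>lo\<close> or \<open>hi\<close>.\<close>

lemma adjacent_representative:
  assumes I: "biclosed n I" and d: "d \<in> tri n U I"
  obtains J a c where "biclosed n J" "tri n U J = tri n U I"
    "adj n J a c" "a \<in> lo n U d" "c \<in> hi n U d"
proof -
  have dd: "fst d < snd d" "snd d \<le> n + 1" "lo n U d \<noteq> {}" "hi n U d \<noteq> {}"
    using tri_diag[OF d] by (auto simp: diag_def)
  have rg: "u \<in> {1..n} \<and> u \<le> snd d" if "u \<in> lo n U d \<or> u \<in> hi n U d" for u
    using that lo_range[of u n U d] hi_range[of u n U d] dd by auto
  obtain I1 where I1: "biclosed n I1" "tri n U I1 = tri n U I"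
    and left: "\<And>w. w \<in> {1..n} \<Longrightarrow> w < fst d \<Longrightarrow>
       \<not> ((\<forall>p\<in>lo n U d. bf I1 p w) \<and> (\<forall>q\<in>hi n U d. bf I1 w q))"
    using clear_left[OF I d] by blast
  have d1: "d \<in> tri n U I1" using d I1 by simp
  obtain J where J: "biclosed n J" "tri n U J = tri n U I1"
    and right: "\<And>w. w \<in> {1..n} \<Longrightarrow> snd d < w \<Longrightarrow>
       \<not> ((\<forall>p\<in>lo n U d. bf J p w) \<and> (\<forall>q\<in>hi n U d. bf J w q))"
    and same: "\<And>p q. p \<le> snd d \<Longrightarrow> q \<le> snd d \<Longrightarrow> bf J p q \<longleftrightarrow> bf I1 p q"
    using clear_right[OF I1(1) d1] by blast
  have left': "\<not> ((\<forall>p\<in>lo n U d. bf J p w) \<and> (\<forall>q\<in>hi n U d. bf J w q))"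
    if "w \<in> {1..n}" "w < fst d" for w
    using left[OF that] same[of _ w] same[of w] rg that(2) dd(1) by (meson less_imp_le less_trans)
  have fin: "finite (lo n U d)" "finite (hi n U d)" by (auto simp: lo_def hi_def)
  obtain a where a: "a \<in> lo n U d" "\<forall>p\<in>lo n U d. p = a \<or> bf J p a"
    using bf_last[OF J(1) fin(1) dd(3)] by blast
  obtain c where c: "c \<in> hi n U d" "\<forall>q\<in>hi n U d. q = c \<or> bf J c q"
    using bf_first[OF J(1) fin(2) dd(4)] by blast
  have dJ: "d \<in> tri n U J" using d1 J by simp
  have "\<not> (bf J a e \<and> bf J e c)" if e: "e \<in> {1..n}" for e
  proof
    assume h: "bf J a e \<and> bf J e c"
    have "bf J p e" if "p \<in> lo n U d" for p
      using a(2) that h by (intro bf_trans_le[OF J(1), of p a e]) auto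
    moreover have "bf J e q" if "q \<in> hi n U d" for q
      using c(2) that h bf_trans[OF J(1), of e c q] by auto
    ultimately have "\<not> e < fst d" "\<not> snd d < e" using left'[OF e] right[OF e] by auto
    then have "fst d \<le> e" "e \<le> snd d" by auto
    then have "e \<in> lo n U d \<or> e \<in> hi n U d" using lo_or_hi[OF e] by blast
    moreover have "\<not> bf J e a" "\<not> bf J c e" using h bf_asym[OF J(1)] by blast+
    moreover have "e \<noteq> a" "e \<noteq> c" using h bf_irrefl[OF J(1)] by auto
    ultimately show False using a(2) c(2) by auto
  qed
  then have "adj n J a c" using triD[OF dJ a(1) c(1)] rg a(1) c(1) by (simp add: adj_def)
  then show thesis using that J I1 a(1) c(1) by simp
qed

text \<open>With \<open>a\<close> and \<open>c\<close> adjacent, theirs is the only pair in the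
  wrong order for \<open>d'\<close>, so exchanging them creates \<open>d'\<close> and destroys
  nothing but \<open>d\<close>.\<close>

lemma flip_representative:
  assumes I: "biclosed n I" and T': "ctri n U T'"
    and d: "d \<in> tri n U I" "d' \<notin> tri n U I" "T' = insert d' (tri n U I - {d})"
  obtains J a c where "biclosed n J" "tri n U J = tri n U I" "adj n J a c"
    "tri n U (swp J a c) = T'" "a \<in> lo n U d" "c \<in> hi n U d" "c \<in> lo n U d'" "a \<in> hi n U d'"
proof -
  obtain J a c where J: "biclosed n J" "tri n U J = tri n U I"
    and ac: "adj n J a c" "a \<in> lo n U d" "c \<in> hi n U d"
    using adjacent_representative[OF I d(1)] by blast
  have dJ: "d \<in> tri n U J" using J d by simp
  have bac: "bf J a c" using ac(1) by (simp add: adj_def)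
  have nac: "a \<noteq> c" using adj_neq[OF J(1) ac(1)] .
  have d'D: "d' \<in> diag n U" using T' d(3) unfolding ctri_def by blast
  have d'J: "d' \<notin> tri n U J" using d J by simp
  \<comment> \<open>All other diagonals survive in \<open>T'\<close>, where nothing crosses
    \<open>d'\<close>.\<close>
  have only_d: "f = d" if "f \<in> tri n U J" "ccross n U d' f" for f
    using that T' J(2) unfolding d(3) ctri_def by blast
  have viol: "p = c \<and> q = a" if p: "p \<in> lo n U d'" and q: "q \<in> hi n U d'" and qp: "bf J q p" for p q
  proof -
    have rg: "p \<in> {1..n}" "q \<in> {1..n}" using p q by (auto simp: lo_def hi_def)
    \<comment> \<open>Cut just before \<open>p\<close>: the edge found crosses \<open>d'\<close>, so
      it is \<open>d\<close>. Thus \<open>a\<close> is read before \<open>p\<close> and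
      \<open>c\<close> is not, and adjacency leaves \<open>p = c\<close>.\<close>
    have "p \<notin> {u \<in> {1..n}. bf J u p}" "q \<in> {u \<in> {1..n}. bf J u p}"
      using bf_irrefl[OF J(1)] qp rg by auto
    then obtain f where f: "f \<in> tri n U J" "lo n U f \<subseteq> {u \<in> {1..n}. bf J u p}"
      "hi n U f \<inter> {u \<in> {1..n}. bf J u p} = {}" "ccross n U d' f"
      using crossing_edge[OF J(1) downset_less[OF J(1), of p] d'D q _ p] by blast
    then have "f = d" using only_d by blast
    then have "bf J a p" "\<not> bf J c p" using f ac by (auto simp: hi_def)
    then have pc: "p = c" using ac(1) rg bf_total[of p c J] unfolding adj_def by blast
    \<comment> \<open>Cutting just after \<open>q\<close> instead gives \<open>q = a\<close> in the
      same way.\<close>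
    have "p \<notin> {u \<in> {1..n}. u = q \<or> bf J u q}" "q \<in> {u \<in> {1..n}. u = q \<or> bf J u q}"
      using bf_irrefl[OF J(1)] bf_asym[OF J(1) qp] qp rg by auto
    then obtain f where f: "f \<in> tri n U J" "lo n U f \<subseteq> {u \<in> {1..n}. u = q \<or> bf J u q}"
      "hi n U f \<inter> {u \<in> {1..n}. u = q \<or> bf J u q} = {}" "ccross n U d' f"
      using crossing_edge[OF J(1) downset_le[OF J(1), of q] d'D q _ p] by blast
    then have "f = d" using only_d by blast
    then have "a = q \<or> bf J a q" "\<not> (c = q \<or> bf J c q)" using f ac by (auto simp: hi_def)
    then have "q = a" using ac(1) rg bf_total[of q c J] unfolding adj_def by blast
    then show ?thesis using pc by blast
  qed
  obtain p q where "p \<in> lo n U d'" "q \<in> hi n U d'" "bf J q p"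
    using tri_violation[OF d'D d'J] .
  then have cl: "c \<in> lo n U d'" "a \<in> hi n U d'" using viol by blast+
  let ?K = "swp J a c"
  have K: "biclosed n ?K" by (rule swp_biclosed[OF J(1) ac(1)])
  have "bf ?K p q" if "p \<in> lo n U d'" "q \<in> hi n U d'" for p q
  proof (cases "bf J q p")
    case True
    then show ?thesis using viol[OF that] bf_swp[OF nac bac] by blast
  next
    case False
    have "p \<noteq> q" using lo_not_hi[OF that(1)] that(2) diagD[OF d'D] by blast
    then have "bf J p q" using False bf_total by blast
    moreover have "\<not> (p = a \<and> q = c)" using lo_not_hi[OF that(1)] cl diagD[OF d'D] by blast
    ultimately show ?thesis using bf_swp[OF nac bac] by blast
  qed
  then have "d' \<in> tri n U ?K" using d'D unfolding tri_def by blast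
  moreover have "e \<in> tri n U ?K" if e: "e \<in> tri n U J" "e \<noteq> d" for e
    using tri_swp_diff[OF J(1) ac(1) e(1)] adj_unique[OF J(1) ac(1) e(1) _ _ dJ ac(2,3)] e(2) by blast
  ultimately have "T' \<subseteq> tri n U ?K" using d(3) J(2) by blast
  then have "tri n U ?K = T'" using ctri_max[OF T' tri_ctri[OF K]] by simp
  then show thesis using that J ac cl by blast
qed

subsection \<open>Forcing\<close>

text \<open>Lattice congruences, transported to inversion sets.\<close>
definition bcong :: "nat \<Rightarrow> ((nat \<times> nat) set \<times> (nat \<times> nat) set) set \<Rightarrow> bool" where
  "bcong n R \<longleftrightarrow> equiv {I. biclosed n I} R \<and>
     (\<forall>I J K. (I, J) \<in> R \<and> biclosed n K \<longrightarrow>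
        (bjoin I K, bjoin J K) \<in> R \<and> (bmeet n I K, bmeet n J K) \<in> R)"

definition cov :: "nat \<Rightarrow> (nat \<times> nat) set \<Rightarrow> nat \<Rightarrow> nat \<Rightarrow> bool" where
  "cov n I a c \<longleftrightarrow> biclosed n I \<and> (a, c) \<notin> I \<and> biclosed n (insert (a, c) I)"

text \<open>\<open>R\<close> contracts the covers that transpose \<open>a\<close> and \<open>c\<close> and have exactly the letters of \<open>A\<close>,
  among those between \<open>a\<close> and \<open>c\<close> in value, to their left.\<close>
definition contracts ::
    "nat \<Rightarrow> ((nat \<times> nat) set \<times> (nat \<times> nat) set) set \<Rightarrow> nat \<Rightarrow> nat \<Rightarrow> nat set \<Rightarrow> bool" where
  "contracts n R a c A \<longleftrightarrow> (\<forall>P. cov n P a c \<and> (\<forall>u. a < u \<and> u < c \<longrightarrow> (bf P u a \<longleftrightarrow> u \<in> A)) \<longrightarrow>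
     (P, insert (a, c) P) \<in> R)"

text \<open>The inversion set of the join-irreducible word whose only descent is \<open>c a\<close>, preceded by \<open>A\<close>;
  its complement for \<open>- A\<close> is the corresponding meet-irreducible.\<close>
definition sml :: "nat \<Rightarrow> nat \<Rightarrow> nat set \<Rightarrow> (nat \<times> nat) set" where
  "sml a c A = {(u, w). a \<le> u \<and> u < w \<and> w \<le> c \<and> (u = a \<or> u \<notin> A) \<and> (w = c \<or> w \<in> A)}"

lemma sml_biclosed:
  assumes "1 \<le> a" "c \<le> n"
  shows "biclosed n (sml a c A)"
  using assms by (intro biclosedI) (auto simp: sml_def)

lemma sml_minus_biclosed:
  assumes "1 \<le> a" "c \<le> n"
  shows "biclosed n (sml a c A - {(a, c)})"
  using assms by (intro biclosedI) (auto simp: sml_def)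

lemma sml_top: "a < c \<Longrightarrow> (a, c) \<in> sml a c A"
  by (simp add: sml_def)

lemma cov_bf:
  assumes I: "cov n I a c" and u: "u \<in> {1..n}" "u \<noteq> a" "u \<noteq> c"
  shows "bf I u a \<longleftrightarrow> bf I u c" "\<not> bf I u a \<Longrightarrow> bf I c u" "\<not> bf I u a \<Longrightarrow> bf I a u"
proof -
  have b: "biclosed n I" and adj: "adj n I a c"
    using I adj_of_cover unfolding cov_def by blast+
  have ac: "bf I a c" using adj by (simp add: adj_def)
  have nb: "\<not> (bf I a u \<and> bf I u c)" using adj u(1) by (simp add: adj_def)
  show "bf I u a \<longleftrightarrow> bf I u c"
    using nb bf_trans[OF b _ ac] bf_total[OF u(2)] by blast
  then show "\<not> bf I u a \<Longrightarrow> bf I c u" using bf_total[OF u(3)] by blast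
  show "\<not> bf I u a \<Longrightarrow> bf I a u" using bf_total[OF u(2)] by blast
qed

lemma cov_range: "cov n I a c \<Longrightarrow> 1 \<le> a \<and> a < c \<and> c \<le> n"
  unfolding cov_def by (auto dest: biclosed_range)

lemma cov_between:
  assumes I: "cov n I a c" and A: "\<forall>u. a < u \<and> u < c \<longrightarrow> (bf I u a \<longleftrightarrow> u \<in> A)"
    and u: "a < u" "u < c"
  shows "u \<in> A \<longleftrightarrow> (a, u) \<in> I" "u \<in> A \<longleftrightarrow> (u, c) \<notin> I"
proof -
  have r: "u \<in> {1..n}" "u \<noteq> a" "u \<noteq> c" using cov_range[OF I] u by auto
  have e: "u \<in> A \<longleftrightarrow> bf I u a" using A u by blast
  show "u \<in> A \<longleftrightarrow> (a, u) \<in> I" unfolding e using u by (simp add: bf_def)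
  show "u \<in> A \<longleftrightarrow> (u, c) \<notin> I" unfolding e cov_bf(1)[OF I r] using u by (simp add: bf_def)
qed

text \<open>All covers with the same label lie over one join-irreducible: their tops contain it,
  while their bottoms miss \<open>(a, c)\<close>. The dual statement for the meet-irreducible
  follows.\<close>

lemma sml_subset_cov:
  assumes I: "cov n I a c" and A: "\<forall>u. a < u \<and> u < c \<longrightarrow> (bf I u a \<longleftrightarrow> u \<in> A)"
  shows "sml a c A \<subseteq> insert (a, c) I"
proof (clarify)
  fix u w assume "(u, w) \<in> sml a c A" and ni: "(u, w) \<notin> I"
  then have r: "a \<le> u" "u < w" "w \<le> c" "u = a \<or> u \<notin> A" "w = c \<or> w \<in> A" by (auto simp: sml_def)
  have b: "biclosed n (insert (a, c) I)" using I by (simp add: cov_def)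
  have "(u, c) \<in> insert (a, c) I" if "u \<noteq> a"
    using cov_between(2)[OF I A, of u] r that by auto
  then have uc: "(u, c) \<in> insert (a, c) I" by auto
  have aw: "(a, w) \<in> insert (a, c) I"
    using cov_between(1)[OF I A, of w] r by (cases "w = c") auto
  have "bf I c u \<or> u = a" using cov_between(2)[OF I A, of u] r by (auto simp: bf_def)
  moreover have "bf I w a \<or> w = c" using cov_between(1)[OF I A, of w] r by (auto simp: bf_def)
  moreover have "bf I u w" using ni r by (simp add: bf_def)
  moreover have bI: "biclosed n I" and ac: "bf I a c"
    using I cov_range[OF I] by (auto simp: cov_def bf_def)
  ultimately have "u = a \<and> w = c"
    using bf_trans[OF bI] bf_asym[OF bI] by metis
  then show "u = a \<and> w = c" .
qed

lemma cov_disjoint_sml: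
  assumes I: "cov n I a c" and A: "\<forall>u. a < u \<and> u < c \<longrightarrow> (bf I u a \<longleftrightarrow> u \<in> A)"
  shows "I \<subseteq> prs n - sml a c (- A)"
proof (clarify)
  fix u w assume uw: "(u, w) \<in> I"
  have b: "biclosed n I" using I by (simp add: cov_def)
  have "(u, w) \<notin> sml a c (- A)"
  proof
    assume "(u, w) \<in> sml a c (- A)"
    then have r: "a \<le> u" "u < w" "w \<le> c" "u = a \<or> u \<in> A" "w = c \<or> w \<notin> A" by (auto simp: sml_def)
    have "(a, w) \<in> I" using uw r cov_between(1)[OF I A, of u] biclosed_trans[OF b, of a u w]
      by (cases "u = a") auto
    then have "w = c" using r cov_between(1)[OF I A, of w] by (cases "w < c") auto
    then show False using \<open>(a, w) \<in> I\<close> I by (simp add: cov_def)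
  qed
  then show "(u, w) \<in> prs n - sml a c (- A)" using uw biclosed_prs[OF b] by blast
qed

text \<open>Joining the contracted cover at the join-irreducible for \<open>(a0, c0)\<close> with
  \<open>I\<close>, then meeting with \<open>insert (a, c) I\<close>, gives exactly the required
  cover. The side conditions put \<open>(a, a0)\<close> and \<open>(c0, c)\<close> in
  \<open>I\<close> unless the ends coincide, so adding \<open>(a0, c0)\<close> yields
  \<open>(a, c)\<close> by transitivity.\<close>

lemma force_join:
  assumes R: "bcong n R" and Q: "contracts n R a0 c0 A"
    and o: "a \<le> a0" "a0 < c0" "c0 \<le> c" and ca: "a0 = a \<or> a0 \<in> A" and cc: "c0 = c \<or> c0 \<notin> A"
  shows "contracts n R a c A"
  unfolding contracts_def
proof (intro allI impI, elim conjE)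
  fix I assume I: "cov n I a c" and A: "\<forall>u. a < u \<and> u < c \<longrightarrow> (bf I u a \<longleftrightarrow> u \<in> A)"
  have bI: "biclosed n I" and bI': "biclosed n (insert (a, c) I)" and ni: "(a, c) \<notin> I"
    using I by (auto simp: cov_def)
  have rg: "1 \<le> a" "c \<le> n" using cov_range[OF I] by auto
  then have rg0: "1 \<le> a0" "c0 \<le> n" using o by auto
  define P where "P = sml a0 c0 A - {(a0, c0)}"
  have P': "insert (a0, c0) P = sml a0 c0 A" using sml_top[OF o(2)] by (auto simp: P_def)
  have bP: "biclosed n P" and bP': "biclosed n (insert (a0, c0) P)"
    unfolding P' using sml_minus_biclosed[OF rg0] sml_biclosed[OF rg0] by (auto simp: P_def)
  have "cov n P a0 c0" unfolding cov_def using bP bP' by (auto simp: P_def)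
  moreover have "\<forall>u. a0 < u \<and> u < c0 \<longrightarrow> (bf P u a0 \<longleftrightarrow> u \<in> A)"
    by (auto simp: bf_def P_def sml_def)
  ultimately have PR: "(P, insert (a0, c0) P) \<in> R" using Q unfolding contracts_def by blast
  define X where "X = bjoin P I"
  define Y where "Y = bjoin (insert (a0, c0) P) I"
  have bX: "biclosed n X" "biclosed n Y" using bjoin_biclosed bI bP bP' by (auto simp: X_def Y_def)
  have "(bmeet n X (insert (a, c) I), bmeet n Y (insert (a, c) I)) \<in> R"
    using R PR bI bI' unfolding bcong_def X_def Y_def by blast
  moreover have "bmeet n X (insert (a, c) I) = I"
  proof
    \<comment> \<open>The bottom does not acquire \<open>(a, c)\<close>, since \<open>P\<close> and
      \<open>I\<close> both lie below the meet-irreducible that omits it.\<close>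
    have M: "biclosed n (prs n - sml a c (- A))"
      by (rule biclosed_compl[OF sml_biclosed[OF rg]])
    have "P \<subseteq> prs n - sml a c (- A)"
      using biclosed_prs[OF bP] o ca cc by (auto simp: P_def sml_def)
    then have "X \<subseteq> prs n - sml a c (- A)"
      unfolding X_def by (rule bjoin_least[OF M _ cov_disjoint_sml[OF I A]])
    then have "(a, c) \<notin> X" using sml_top[of a c "- A"] cov_range[OF I] by auto
    then show "bmeet n X (insert (a, c) I) \<subseteq> I"
      using bmeet_lower1[of n X] bmeet_lower2[of n X "insert (a, c) I"] by blast
    show "I \<subseteq> bmeet n X (insert (a, c) I)"
      using bjoin_upper2[of I P] by (intro bmeet_greatest[OF bI]) (auto simp: X_def)
  qed
  moreover have "bmeet n Y (insert (a, c) I) = insert (a, c) I"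
  proof
    have IY: "I \<subseteq> Y" unfolding Y_def by (rule bjoin_upper2)
    have "(a0, c0) \<in> Y" using bjoin_upper1[of "insert (a0, c0) P" I] by (auto simp: Y_def)
    moreover have "a0 = a \<or> (a, a0) \<in> Y" using ca cov_between(1)[OF I A, of a0] o IY by force
    moreover have "c0 = c \<or> (c0, c) \<in> Y" using cc cov_between(2)[OF I A, of c0] o IY by force
    ultimately have "(a, c) \<in> Y" using biclosed_trans[OF bX(2)] by metis
    then show "insert (a, c) I \<subseteq> bmeet n Y (insert (a, c) I)"
      using IY by (intro bmeet_greatest[OF bI']) auto
  qed (rule bmeet_lower2)
  ultimately show "(I, insert (a, c) I) \<in> R" by simp
qed

text \<open>Mirror image of the join case, starting at the meet-irreducible for
  \<open>(a0, c0)\<close>: the side conditions now keep \<open>(a, a0)\<close> and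
  \<open>(c0, c)\<close> out of \<open>I\<close>, and cotransitivity excludes \<open>(a, c)\<close>
  from the lower meet.\<close>

lemma force_meet:
  assumes R: "bcong n R" and Q: "contracts n R a0 c0 A"
    and o: "a \<le> a0" "a0 < c0" "c0 \<le> c" and ca: "a0 = a \<or> a0 \<notin> A" and cc: "c0 = c \<or> c0 \<in> A"
  shows "contracts n R a c A"
  unfolding contracts_def
proof (intro allI impI, elim conjE)
  fix I assume I: "cov n I a c" and A: "\<forall>u. a < u \<and> u < c \<longrightarrow> (bf I u a \<longleftrightarrow> u \<in> A)"
  have bI: "biclosed n I" and bI': "biclosed n (insert (a, c) I)" and ni: "(a, c) \<notin> I"
    using I by (auto simp: cov_def)
  have rg: "1 \<le> a" "c \<le> n" "a < c" using cov_range[OF I] by auto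
  then have rg0: "1 \<le> a0" "c0 \<le> n" using o by auto
  define P where "P = prs n - sml a0 c0 (- A)"
  have prs0: "(a0, c0) \<in> prs n" using rg0 o by (simp add: prs_def)
  have P': "insert (a0, c0) P = prs n - (sml a0 c0 (- A) - {(a0, c0)})"
    using prs0 by (auto simp: P_def)
  have bP: "biclosed n P" and bP': "biclosed n (insert (a0, c0) P)"
    unfolding P' unfolding P_def
    by (intro biclosed_compl sml_minus_biclosed sml_biclosed rg0)+
  have "cov n P a0 c0" unfolding cov_def using bP bP' sml_top[OF o(2)] by (auto simp: P_def)
  moreover have "\<forall>u. a0 < u \<and> u < c0 \<longrightarrow> (bf P u a0 \<longleftrightarrow> u \<in> A)"
    using rg0 by (auto simp: bf_def P_def sml_def prs_def)
  ultimately have PR: "(P, insert (a0, c0) P) \<in> R" using Q unfolding contracts_def by blast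
  define X where "X = bmeet n P (insert (a, c) I)"
  define Y where "Y = bmeet n (insert (a0, c0) P) (insert (a, c) I)"
  have bX: "biclosed n X" "biclosed n Y" using bmeet_biclosed bI' bP bP' by (auto simp: X_def Y_def)
  have XI: "X \<subseteq> insert (a, c) I" "Y \<subseteq> insert (a, c) I"
    unfolding X_def Y_def by (rule bmeet_lower2)+
  have "(bjoin X I, bjoin Y I) \<in> R"
    using R PR bI bI' unfolding bcong_def X_def Y_def by blast
  moreover have "bjoin X I = I"
  proof
    have "(a0, c0) \<notin> X" using bmeet_lower1[of n P] sml_top[OF o(2)] by (auto simp: X_def P_def)
    moreover have "a0 = a \<or> (a, a0) \<notin> X"
      using ca cov_between(1)[OF I A, of a0] o XI by fastforce
    moreover have "c0 = c \<or> (c0, c) \<notin> X"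
      using cc cov_between(2)[OF I A, of c0] o XI by fastforce
    ultimately have "(a, c) \<notin> X"
      using biclosed_cotrans[OF bX(1), of a c a0] biclosed_cotrans[OF bX(1), of a0 c c0] o
      by (cases "a0 = a"; cases "c0 = c") auto
    then have "X \<subseteq> I" using XI by blast
    then show "bjoin X I \<subseteq> I" by (intro bjoin_least[OF bI]) auto
  qed (rule bjoin_upper2)
  moreover have "bjoin Y I = insert (a, c) I"
  proof
    show "bjoin Y I \<subseteq> insert (a, c) I" using XI by (intro bjoin_least[OF bI']) auto
    have "sml a c A \<subseteq> insert (a0, c0) P"
      unfolding P' using biclosed_prs[OF sml_biclosed[OF rg(1,2)], of A] o ca cc
      by (auto simp: sml_def)
    then have "sml a c A \<subseteq> Y" unfolding Y_def
      by (intro bmeet_greatest[OF sml_biclosed[OF rg(1,2)]] sml_subset_cov[OF I A])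
    then have "(a, c) \<in> bjoin Y I" using sml_top[OF rg(3)] bjoin_upper1[of Y I] by blast
    then show "insert (a, c) I \<subseteq> bjoin Y I" using bjoin_upper2[of I Y] by blast
  qed
  ultimately show "(I, insert (a, c) I) \<in> R" by simp
qed

section \<open>Propagation from the generators\<close>

text \<open>Moving one end at a time leaves a single side condition, whether the old end lies in
  \<open>A\<close>, and either answer is served by one of the two forcing lemmas.\<close>

lemma contracts_extend:
  assumes R: "bcong n R" and b: "contracts n R (b - 1) (b + 1) A" and ab: "a < b" and bc: "b < c"
  shows "contracts n R a c A"
proof -
  have "contracts n R a (b + 1) A"
  proof (cases "b - 1 \<in> A")
    case True
    then show ?thesis using ab by (intro force_join[OF R b]) auto
  next
    case False
    then show ?thesis using ab by (intro force_meet[OF R b]) auto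
  qed
  note c = this
  show ?thesis
  proof (cases "b + 1 \<in> A")
    case True
    then show ?thesis using ab bc by (intro force_meet[OF R c]) auto
  next
    case False
    then show ?thesis using ab bc by (intro force_join[OF R c]) auto
  qed
qed

text \<open>Every such cover arises by joining the generating pair with its bottom \<open>I\<close>:
  that \<open>b\<close> stands to the left means that \<open>(b - 1, b)\<close> already lies in
  \<open>I\<close>.\<close>

lemma contracts_base_up:
  assumes R: "bcong n R" and g: "({(b - 1, b)}, {(b - 1, b), (b - 1, b + 1)}) \<in> R"
    and b: "1 < b" and A: "b \<in> A"
  shows "contracts n R (b - 1) (b + 1) A"
  unfolding contracts_def
proof (intro allI impI, elim conjE)
  fix I assume I: "cov n I (b - 1) (b + 1)"
    and h: "\<forall>u. b - 1 < u \<and> u < b + 1 \<longrightarrow> (bf I u (b - 1) \<longleftrightarrow> u \<in> A)"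
  have bI: "biclosed n I" and bI': "biclosed n (insert (b - 1, b + 1) I)" using I by (auto simp: cov_def)
  have i: "(b - 1, b) \<in> I" using cov_between(1)[OF I h, of b] A b by auto
  have "(bjoin {(b - 1, b)} I, bjoin {(b - 1, b), (b - 1, b + 1)} I) \<in> R"
    using R g bI unfolding bcong_def by blast
  moreover have "bjoin {(b - 1, b)} I = I"
    using i bjoin_least[OF bI, of "{(b - 1, b)}" I] bjoin_upper2[of I "{(b - 1, b)}"] by auto
  moreover have "bjoin {(b - 1, b), (b - 1, b + 1)} I = insert (b - 1, b + 1) I"
  proof
    show "bjoin {(b - 1, b), (b - 1, b + 1)} I \<subseteq> insert (b - 1, b + 1) I"
      using i by (intro bjoin_least[OF bI']) auto
    show "insert (b - 1, b + 1) I \<subseteq> bjoin {(b - 1, b), (b - 1, b + 1)} I"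
      using bjoin_upper1[of "{(b - 1, b), (b - 1, b + 1)}" I]
        bjoin_upper2[of I "{(b - 1, b), (b - 1, b + 1)}"] by auto
  qed
  ultimately show "(I, insert (b - 1, b + 1) I) \<in> R" by simp
qed

lemma contracts_base_down:
  assumes R: "bcong n R" and g: "({(b, b + 1)}, {(b, b + 1), (b - 1, b + 1)}) \<in> R"
    and b: "1 < b" and A: "b \<notin> A"
  shows "contracts n R (b - 1) (b + 1) A"
  unfolding contracts_def
proof (intro allI impI, elim conjE)
  fix I assume I: "cov n I (b - 1) (b + 1)"
    and h: "\<forall>u. b - 1 < u \<and> u < b + 1 \<longrightarrow> (bf I u (b - 1) \<longleftrightarrow> u \<in> A)"
  have bI: "biclosed n I" and bI': "biclosed n (insert (b - 1, b + 1) I)" using I by (auto simp: cov_def)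
  have i: "(b, b + 1) \<in> I" using cov_between(2)[OF I h, of b] A b by auto
  have "(bjoin {(b, b + 1)} I, bjoin {(b, b + 1), (b - 1, b + 1)} I) \<in> R"
    using R g bI unfolding bcong_def by blast
  moreover have "bjoin {(b, b + 1)} I = I"
    using i bjoin_least[OF bI, of "{(b, b + 1)}" I] bjoin_upper2[of I "{(b, b + 1)}"] by auto
  moreover have "bjoin {(b, b + 1), (b - 1, b + 1)} I = insert (b - 1, b + 1) I"
  proof
    show "bjoin {(b, b + 1), (b - 1, b + 1)} I \<subseteq> insert (b - 1, b + 1) I"
      using i by (intro bjoin_least[OF bI']) auto
    show "insert (b - 1, b + 1) I \<subseteq> bjoin {(b, b + 1), (b - 1, b + 1)} I"
      using bjoin_upper1[of "{(b, b + 1), (b - 1, b + 1)}" I]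
        bjoin_upper2[of I "{(b, b + 1), (b - 1, b + 1)}"] by auto
  qed
  ultimately show "(I, insert (b - 1, b + 1) I) \<in> R" by simp
qed

lemma bcong_refl: "bcong n R \<Longrightarrow> biclosed n I \<Longrightarrow> (I, I) \<in> R"
  unfolding bcong_def by (auto dest: equivE refl_onD)

lemma bcong_sym: "bcong n R \<Longrightarrow> (I, J) \<in> R \<Longrightarrow> (J, I) \<in> R"
  unfolding bcong_def by (blast dest: equivE symD)

lemma bcong_trans: "bcong n R \<Longrightarrow> (I, J) \<in> R \<Longrightarrow> (J, K) \<in> R \<Longrightarrow> (I, K) \<in> R"
  unfolding bcong_def by (blast dest: equivE transD)

text \<open>Climb from \<open>rset U b I\<close> to \<open>I\<close> by covers. Each adds an
  inversion \<open>(a, c)\<close> that sorting removed, so \<open>a < b < c\<close>, and the half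
  missing from \<open>I\<close> tells where \<open>b\<close> stands: to the left of the pair exactly
  when \<open>b\<close> is up.\<close>

lemma contracts_rset:
  assumes R: "bcong n R" and I: "biclosed n I"
    and b: "\<And>a c A. 1 \<le> a \<Longrightarrow> a < b \<Longrightarrow> b < c \<Longrightarrow> c \<le> n \<Longrightarrow> b \<in> A \<longleftrightarrow> b \<in> U \<Longrightarrow> contracts n R a c A"
  shows "(rset U b I, I) \<in> R"
proof -
  have "(K, I) \<in> R" if "biclosed n K" "rset U b I \<subseteq> K" "K \<subseteq> I" for K
    using that
  proof (induction "card (I - K)" arbitrary: K rule: less_induct)
    case less
    note K = less.prems(1)
    show ?case
    proof (cases "K = I")
      case True
      then show ?thesis using bcong_refl[OF R I] by simp
    next
      case False
      then have "K \<subset> I" using less.prems by blast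
      then obtain a c where ac: "(a, c) \<in> I" "(a, c) \<notin> K" and K': "biclosed n (insert (a, c) K)"
        using biclosed_chain_step[OF K I] by blast
      have "(a, c) \<notin> rset U b I" using ac less.prems by blast
      then have abc: "a < b" "b < c" and nb: "if b \<in> U then (b, c) \<notin> I else (a, b) \<notin> I"
        using ac unfolding rset_mem by (auto split: if_splits)
      have cv: "cov n K a c" using K K' ac by (simp add: cov_def)
      have rg: "1 \<le> a" "c \<le> n" using cov_range[OF cv] by auto
      define A where "A = {u. bf K u a}"
      have h: "\<forall>u. a < u \<and> u < c \<longrightarrow> (bf K u a \<longleftrightarrow> u \<in> A)" by (simp add: A_def)
      have "b \<in> A \<longleftrightarrow> b \<in> U"
        using cov_between[OF cv h abc] nb less.prems(3) by (auto split: if_splits)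
      then have "contracts n R a c A" using b[OF rg(1) abc rg(2)] by blast
      then have 1: "(K, insert (a, c) K) \<in> R" using cv h unfolding contracts_def by blast
      have "card (I - insert (a, c) K) < card (I - K)"
        using ac by (intro psubset_card_mono) (auto simp: biclosed_finite[OF I])
      then have "(insert (a, c) K, I) \<in> R"
        using less.hyps K' less.prems ac(1) by auto
      then show ?thesis using bcong_trans[OF R 1] by blast
    qed
  qed
  then show ?thesis using rset_biclosed[OF I] rset_subset by blast
qed

lemma bcong_dn:
  assumes R: "bcong n R" and I: "biclosed n I"
    and b: "\<And>b a c A. 1 \<le> a \<Longrightarrow> a < b \<Longrightarrow> b < c \<Longrightarrow> c \<le> n \<Longrightarrow> b \<in> A \<longleftrightarrow> b \<in> U \<Longrightarrow> contracts n R a c A"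
  shows "(I, dn n U I) \<in> R"
proof -
  have "(I, Z) \<in> R" if "(rstep n U)\<^sup>*\<^sup>* I Z" for Z
    using that
  proof (induction rule: rtranclp_induct)
    case base
    then show ?case by (rule bcong_refl[OF R I])
  next
    case (step Y Z)
    from step(2) obtain b' where Y: "biclosed n Y" and Z: "Z = rset U b' Y"
      unfolding rstep_def by auto
    have "(Z, Y) \<in> R" unfolding Z by (rule contracts_rset[OF R Y b])
    then show ?case using step(3) bcong_sym[OF R] bcong_trans[OF R] by blast
  qed
  then show ?thesis using dn_steps[OF I] by blast
qed

subsection \<open>The Cambrian congruence\<close>

lemma is_join_iff:
  assumes "x \<in> perms n" "y \<in> perms n" "z \<in> perms n"
  shows "is_join n x y z \<longleftrightarrow> inv_set n z = bjoin (inv_set n x) (inv_set n y)"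
proof
  have b: "biclosed n (bjoin (inv_set n x) (inv_set n y))"
    using assms by (intro bjoin_biclosed inv_set_biclosed)
  then obtain w where w: "w \<in> perms n" "inv_set n w = bjoin (inv_set n x) (inv_set n y)"
    by (rule biclosed_perm)
  assume j: "is_join n x y z"
  have "inv_set n z \<subseteq> inv_set n w"
    using j w bjoin_upper1 bjoin_upper2 unfolding is_join_def weak_le_def by blast
  moreover have "inv_set n w \<subseteq> inv_set n z" unfolding w(2)
    using j inv_set_biclosed[OF assms(3)] unfolding is_join_def weak_le_def
    by (intro bjoin_least) auto
  ultimately show "inv_set n z = bjoin (inv_set n x) (inv_set n y)" using w by simp
next
  assume z: "inv_set n z = bjoin (inv_set n x) (inv_set n y)"
  show "is_join n x y z"
    unfolding is_join_def weak_le_def z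
    using assms(3) bjoin_upper1 bjoin_upper2 bjoin_least inv_set_biclosed by metis
qed

lemma is_meet_iff:
  assumes "x \<in> perms n" "y \<in> perms n" "z \<in> perms n"
  shows "is_meet n x y z \<longleftrightarrow> inv_set n z = bmeet n (inv_set n x) (inv_set n y)"
proof
  have b: "biclosed n (bmeet n (inv_set n x) (inv_set n y))"
    using assms by (intro bmeet_biclosed inv_set_biclosed)
  then obtain w where w: "w \<in> perms n" "inv_set n w = bmeet n (inv_set n x) (inv_set n y)"
    by (rule biclosed_perm)
  assume j: "is_meet n x y z"
  have "inv_set n w \<subseteq> inv_set n z"
    using j w bmeet_lower1 bmeet_lower2 unfolding is_meet_def weak_le_def by blast
  moreover have "inv_set n z \<subseteq> inv_set n w" unfolding w(2)
    using j inv_set_biclosed[OF assms(3)] unfolding is_meet_def weak_le_def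
    by (intro bmeet_greatest) auto
  ultimately show "inv_set n z = bmeet n (inv_set n x) (inv_set n y)" using w by simp
next
  assume z: "inv_set n z = bmeet n (inv_set n x) (inv_set n y)"
  show "is_meet n x y z"
    unfolding is_meet_def weak_le_def z
    using assms(3) bmeet_lower1 bmeet_lower2 bmeet_greatest inv_set_biclosed by metis
qed

section \<open>Transport of congruences to inversion sets\<close>

definition transport :: "nat \<Rightarrow> (perm \<times> perm) set \<Rightarrow> ((nat \<times> nat) set \<times> (nat \<times> nat) set) set" where
  "transport n \<Theta> = (\<lambda>(x, y). (inv_set n x, inv_set n y)) ` \<Theta>"

lemma transport_mem:
  assumes "\<Theta> \<subseteq> perms n \<times> perms n" "x \<in> perms n" "y \<in> perms n"
  shows "(inv_set n x, inv_set n y) \<in> transport n \<Theta> \<longleftrightarrow> (x, y) \<in> \<Theta>"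
proof
  assume "(inv_set n x, inv_set n y) \<in> transport n \<Theta>"
  then obtain x' y' where xy: "(x', y') \<in> \<Theta>" "inv_set n x = inv_set n x'" "inv_set n y = inv_set n y'"
    by (auto simp: transport_def)
  have "x' \<in> perms n" "y' \<in> perms n" using xy(1) assms(1) by auto
  then have "x = x'" "y = y'" using inv_set_inj assms(2,3) xy(2,3) by blast+
  then show "(x, y) \<in> \<Theta>" using xy(1) by simp
next
  assume "(x, y) \<in> \<Theta>"
  then show "(inv_set n x, inv_set n y) \<in> transport n \<Theta>"
    unfolding transport_def by (rule rev_image_eqI) simp
qed

lemma transport_bcong:
  assumes L: "lattice_congruence n \<Theta>"
  shows "bcong n (transport n \<Theta>)"
proof -
  have eq: "equiv (perms n) \<Theta>" using L by (simp add: lattice_congruence_def)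
  then have sub: "\<Theta> \<subseteq> perms n \<times> perms n" by (auto simp: equiv_def refl_on_def)
  note mem = transport_mem[OF sub]
  have tr: "\<exists>x y. x \<in> perms n \<and> y \<in> perms n \<and> (x, y) \<in> \<Theta> \<and> I = inv_set n x \<and> J = inv_set n y"
    if "(I, J) \<in> transport n \<Theta>" for I J
    using that sub unfolding transport_def by auto
  have "equiv {I. biclosed n I} (transport n \<Theta>)"
  proof (rule equivI)
    show "transport n \<Theta> \<subseteq> {I. biclosed n I} \<times> {I. biclosed n I}"
      using tr by (force simp: inv_set_biclosed)
    show "refl_on {I. biclosed n I} (transport n \<Theta>)"
    proof (rule refl_onI)
      fix I assume "I \<in> {I. biclosed n I}"
      then obtain x where x: "x \<in> perms n" "inv_set n x = I" using biclosed_perm by blast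
      have "(x, x) \<in> \<Theta>" using eq x by (auto simp: equiv_def dest: refl_onD)
      then show "(I, I) \<in> transport n \<Theta>" using mem[of x x] x by simp
    qed
    show "sym (transport n \<Theta>)"
    proof (rule symI)
      fix I J assume "(I, J) \<in> transport n \<Theta>"
      then obtain x y where "x \<in> perms n" "y \<in> perms n" "(x, y) \<in> \<Theta>" "I = inv_set n x" "J = inv_set n y"
        using tr by blast
      moreover then have "(y, x) \<in> \<Theta>" using eq by (auto simp: equiv_def dest: symD)
      ultimately show "(J, I) \<in> transport n \<Theta>" using mem by blast
    qed
    show "trans (transport n \<Theta>)"
    proof (rule transI)
      fix I J K assume "(I, J) \<in> transport n \<Theta>" "(J, K) \<in> transport n \<Theta>"
      then obtain x y y' z where xy: "x \<in> perms n" "y \<in> perms n" "(x, y) \<in> \<Theta>" "I = inv_set n x" "J = inv_set n y"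
        and yz: "y' \<in> perms n" "z \<in> perms n" "(y', z) \<in> \<Theta>" "J = inv_set n y'" "K = inv_set n z"
        using tr by blast
      have "y = y'" using inv_set_inj[OF xy(2) yz(1)] xy(5) yz(4) by simp
      then have "(x, z) \<in> \<Theta>" using eq xy yz by (auto simp: equiv_def dest: transD)
      then show "(I, K) \<in> transport n \<Theta>" using mem xy yz by blast
    qed
  qed
  moreover have "(bjoin I K, bjoin J K) \<in> transport n \<Theta> \<and> (bmeet n I K, bmeet n J K) \<in> transport n \<Theta>"
    if IJ0: "(I, J) \<in> transport n \<Theta>" and K: "biclosed n K" for I J K
  proof -
    obtain x y where xy: "x \<in> perms n" "y \<in> perms n" "(x, y) \<in> \<Theta>" "I = inv_set n x" "J = inv_set n y"
      using tr[OF IJ0] by blast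
    obtain z where z: "z \<in> perms n" "inv_set n z = K" using biclosed_perm[OF K] by blast
    have IJ: "biclosed n I" "biclosed n J" using xy inv_set_biclosed by auto
    obtain j where j: "j \<in> perms n" "inv_set n j = bjoin I K" using biclosed_perm[OF bjoin_biclosed[OF IJ(1) K]] .
    obtain j' where j': "j' \<in> perms n" "inv_set n j' = bjoin J K" using biclosed_perm[OF bjoin_biclosed[OF IJ(2) K]] .
    obtain m where m: "m \<in> perms n" "inv_set n m = bmeet n I K" using biclosed_perm[OF bmeet_biclosed[OF IJ(1) K]] .
    obtain m' where m': "m' \<in> perms n" "inv_set n m' = bmeet n J K" using biclosed_perm[OF bmeet_biclosed[OF IJ(2) K]] .
    have "is_join n x z j" "is_join n y z j'" "is_meet n x z m" "is_meet n y z m'"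
      using xy z j j' m m' by (simp_all add: is_join_iff is_meet_iff)
    then have "(j, j') \<in> \<Theta>" "(m, m') \<in> \<Theta>"
      using L xy(3) z(1) unfolding lattice_congruence_def by blast+
    then show ?thesis using mem[of j j'] mem[of m m'] j j' m m' by simp
  qed
  ultimately show ?thesis unfolding bcong_def by blast
qed

section \<open>The fibres form a lattice congruence\<close>

definition tri_cong :: "nat \<Rightarrow> nat set \<Rightarrow> (perm \<times> perm) set" where
  "tri_cong n U = {(x, y). x \<in> perms n \<and> y \<in> perms n \<and> tri n U (inv_set n x) = tri n U (inv_set n y)}"

text \<open>The least element of the common fibre lies below \<open>I\<close>, hence below the
  antisortable set \<open>up n U (bjoin I K)\<close>. By \<open>dn_antisortable\<close> this set
  then contains \<open>J\<close> as well, and so \<open>bjoin J K\<close>.\<close>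

lemma tri_join:
  assumes b: "biclosed n I" "biclosed n J" "biclosed n K" and t: "tri n U I = tri n U J"
  shows "tri n U (bjoin I K) = tri n U (bjoin J K)"
proof -
  have le: "up n U (bjoin J K) \<subseteq> up n U (bjoin I K)"
    if b: "biclosed n I" "biclosed n J" "biclosed n K" and t: "tri n U I = tri n U J" for I J
  proof (rule up_least)
    have bI: "biclosed n (bjoin I K)" using b by (intro bjoin_biclosed)
    show "biclosed n (bjoin J K)" using b by (intro bjoin_biclosed)
    show "antisortable n U (up n U (bjoin I K))" by (rule up_antisortable[OF bI])
    have "dn n U J \<subseteq> I" by (rule tri_subset_dn[OF b(2,1) t[symmetric]])
    also have "I \<subseteq> bjoin I K" by (rule bjoin_upper1)
    also have "\<dots> \<subseteq> up n U (bjoin I K)" by (rule up_superset[OF bI])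
    finally have "J \<subseteq> up n U (bjoin I K)" by (rule dn_antisortable[OF b(2) up_antisortable[OF bI]])
    moreover have "K \<subseteq> up n U (bjoin I K)"
      by (rule subset_trans[OF bjoin_upper2 up_superset[OF bI]])
    ultimately show "bjoin J K \<subseteq> up n U (bjoin I K)"
      by (rule bjoin_least[OF up_biclosed[OF bI]])
  qed
  have "up n U (bjoin I K) = up n U (bjoin J K)" using le[OF b t] le[OF b(2,1,3) t[symmetric]] by blast
  then show ?thesis using tri_up bjoin_biclosed b by metis
qed

text \<open>Sorting the meet down gives a sortable set below \<open>I\<close>, hence below
  \<open>dn n U I\<close>, the least element of the common fibre, and so below
  \<open>J\<close>.\<close>

lemma tri_meet:
  assumes b: "biclosed n I" "biclosed n J" "biclosed n K" and t: "tri n U I = tri n U J"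
  shows "tri n U (bmeet n I K) = tri n U (bmeet n J K)"
proof -
  have le: "dn n U (bmeet n I K) \<subseteq> dn n U (bmeet n J K)"
    if b: "biclosed n I" "biclosed n J" "biclosed n K" and t: "tri n U I = tri n U J" for I J
  proof (rule dn_greatest)
    have bI: "biclosed n (bmeet n I K)" using b by (intro bmeet_biclosed)
    show "biclosed n (bmeet n J K)" using b by (intro bmeet_biclosed)
    show "sortable U (dn n U (bmeet n I K))" by (rule dn_sortable[OF bI])
    have "dn n U (bmeet n I K) \<subseteq> dn n U I"
      using dn_subset[OF bI] bmeet_lower1 by (intro dn_greatest[OF b(1) dn_sortable[OF bI]]) blast
    also have "\<dots> \<subseteq> J" by (rule tri_subset_dn[OF b(1,2) t])
    finally have "dn n U (bmeet n I K) \<subseteq> J" .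
    moreover have "dn n U (bmeet n I K) \<subseteq> K"
      by (rule subset_trans[OF dn_subset[OF bI] bmeet_lower2])
    ultimately show "dn n U (bmeet n I K) \<subseteq> bmeet n J K"
      by (rule bmeet_greatest[OF dn_biclosed[OF bI]])
  qed
  have "dn n U (bmeet n I K) = dn n U (bmeet n J K)" using le[OF b t] le[OF b(2,1,3) t[symmetric]] by blast
  then show ?thesis using tri_dn bmeet_biclosed b by metis
qed

lemma tri_cong_lattice: "lattice_congruence n (tri_cong n U)"
proof -
  have "equiv (perms n) (tri_cong n U)"
    by (rule equivI) (auto simp: tri_cong_def refl_on_def sym_def trans_def)
  moreover have "(j, j') \<in> tri_cong n U"
    if xy: "(x, y) \<in> tri_cong n U" and z: "z \<in> perms n" and j: "is_join n x z j" "is_join n y z j'"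
    for x y z j j'
  proof -
    have p: "x \<in> perms n" "y \<in> perms n" "j \<in> perms n" "j' \<in> perms n"
      using xy j by (auto simp: tri_cong_def is_join_def)
    have "inv_set n j = bjoin (inv_set n x) (inv_set n z)" "inv_set n j' = bjoin (inv_set n y) (inv_set n z)"
      using j p z by (simp_all add: is_join_iff)
    then show ?thesis using p z xy tri_join[of n "inv_set n x" "inv_set n y" "inv_set n z" U]
      by (simp add: tri_cong_def inv_set_biclosed)
  qed
  moreover have "(m, m') \<in> tri_cong n U"
    if xy: "(x, y) \<in> tri_cong n U" and z: "z \<in> perms n" and m: "is_meet n x z m" "is_meet n y z m'"
    for x y z m m'
  proof -
    have p: "x \<in> perms n" "y \<in> perms n" "m \<in> perms n" "m' \<in> perms n"
      using xy m by (auto simp: tri_cong_def is_meet_def)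
    have "inv_set n m = bmeet n (inv_set n x) (inv_set n z)" "inv_set n m' = bmeet n (inv_set n y) (inv_set n z)"
      using m p z by (simp_all add: is_meet_iff)
    then show ?thesis using p z xy tri_meet[of n "inv_set n x" "inv_set n y" "inv_set n z" U]
      by (simp add: tri_cong_def inv_set_biclosed)
  qed
  ultimately show ?thesis unfolding lattice_congruence_def by blast
qed

section \<open>Generators and minimality\<close>

lemma sgen_permutes: "1 \<le> i \<Longrightarrow> i < n \<Longrightarrow> sgen i \<in> perms n"
proof -
  assume i: "1 \<le> i" "i < n"
  have "sgen i = Transposition.transpose i (i + 1)"
    by (rule ext) (auto simp: sgen_def Transposition.transpose_def)
  then show ?thesis unfolding perms_def using i by (simp add: permutes_swap_id)
qed

lemma sgen_sgen: "sgen i \<circ> sgen i = id"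
  by (auto simp: sgen_def)

lemma inv_sgen: "inv (sgen i) = sgen i"
  by (rule inv_unique_comp[OF sgen_sgen sgen_sgen])

lemma inv_sgen_comp: "inv (sgen a \<circ> sgen b) = sgen b \<circ> sgen a"
proof (rule inv_unique_comp)
  show "sgen a \<circ> sgen b \<circ> (sgen b \<circ> sgen a) = id" for a b
    using sgen_sgen by (metis comp_assoc comp_id)
  then show "sgen b \<circ> sgen a \<circ> (sgen a \<circ> sgen b) = id" .
qed

lemma inv_set_sgen: "1 \<le> i \<Longrightarrow> i < n \<Longrightarrow> inv_set n (sgen i) = {(i, i + 1)}"
  unfolding inv_set_pos[OF sgen_permutes] inv_sgen by (auto simp: sgen_def split: if_splits)

lemma sgen_comp_perms:
  "1 \<le> i \<Longrightarrow> i < n \<Longrightarrow> 1 \<le> j \<Longrightarrow> j < n \<Longrightarrow> sgen i \<circ> sgen j \<in> perms n"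
  using sgen_permutes[of i n] sgen_permutes[of j n] unfolding perms_def by (auto intro: permutes_compose)

text \<open>The word reads \<open>b\<close>, \<open>b + 1\<close>, \<open>b - 1\<close> in places
  \<open>b - 1\<close> to \<open>b + 1\<close>.\<close>

lemma inv_set_sgen_up:
  assumes "1 < b" "b < n"
  shows "inv_set n (sgen (b - 1) \<circ> sgen b) = {(b - 1, b), (b - 1, b + 1)}"
proof -
  obtain k where k: "b = Suc k" "1 \<le> k" using assms by (cases b) auto
  have p: "sgen k \<circ> sgen (Suc k) \<in> perms n" using assms k by (intro sgen_comp_perms) auto
  \<comment> \<open>Positions are given by the inverse, which reverses the two factors.\<close>
  have r: "(sgen (Suc k) \<circ> sgen k) q =
      (if q = k then k + 2 else if q = k + 1 then k else if q = k + 2 then k + 1 else q)" for q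
    by (simp add: sgen_def)
  have "(1 \<le> a \<and> a < c \<and> c \<le> n \<and> (sgen (Suc k) \<circ> sgen k) c < (sgen (Suc k) \<circ> sgen k) a) \<longleftrightarrow>
      a = k \<and> (c = k + 1 \<or> c = k + 2)" for a c
    unfolding r using assms k by (simp split: if_split; linarith)
  then show ?thesis unfolding k(1) diff_Suc_1 inv_set_pos[OF p] inv_sgen_comp by auto
qed

text \<open>The word reads \<open>b + 1\<close>, \<open>b - 1\<close>, \<open>b\<close> in places
  \<open>b - 1\<close> to \<open>b + 1\<close>.\<close>

lemma inv_set_sgen_down:
  assumes "1 < b" "b < n"
  shows "inv_set n (sgen b \<circ> sgen (b - 1)) = {(b, b + 1), (b - 1, b + 1)}"
proof -
  obtain k where k: "b = Suc k" "1 \<le> k" using assms by (cases b) auto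
  have p: "sgen (Suc k) \<circ> sgen k \<in> perms n" using assms k by (intro sgen_comp_perms) auto
  have r: "(sgen k \<circ> sgen (Suc k)) q =
      (if q = k then k + 1 else if q = k + 1 then k + 2 else if q = k + 2 then k else q)" for q
    by (simp add: sgen_def)
  have "(1 \<le> a \<and> a < c \<and> c \<le> n \<and> (sgen k \<circ> sgen (Suc k)) c < (sgen k \<circ> sgen (Suc k)) a) \<longleftrightarrow>
      (a = k \<or> a = k + 1) \<and> c = k + 2" for a c
    unfolding r using assms k by (simp split: if_split; linarith)
  then show ?thesis unfolding k(1) diff_Suc_1 inv_set_pos[OF p] inv_sgen_comp by auto
qed

text \<open>The pair contributed by an edge at \<open>b\<close> is one sorting step at
  \<open>b\<close>, so it lies in the fibre congruence. Conversely these pairs start the forcing, by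
  which any congruence containing them identifies each element with its \<open>dn\<close>, hence all
  elements of a fibre.\<close>

lemma cambrian_cong_eq:
  assumes E: "orientation n E"
    and U: "\<forall>b\<in>{2..n - 1}. (b \<in> U \<longleftrightarrow> (b, b - 1) \<in> E) \<and> (b \<notin> U \<longleftrightarrow> (b - 1, b) \<in> E)"
  shows "cambrian_cong n E = tri_cong n U"
proof
  have up: "(b, b - 1) \<in> E" if "1 < b" "b < n" "b \<in> U" for b using U that by auto
  have down: "(b - 1, b) \<in> E" if "1 < b" "b < n" "b \<notin> U" for b using U that by auto
  have "cambrian_gens E \<subseteq> tri_cong n U"
  proof
    fix z assume "z \<in> cambrian_gens E"
    then obtain i j where z: "z = (sgen j, sgen j \<circ> sgen i)" and ij: "(i, j) \<in> E"
      by (auto simp: cambrian_gens_def)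
    have "(\<exists>k. i = k \<and> j = k + 1 \<and> 1 \<le> k \<and> k + 1 \<le> n - 1) \<or> (\<exists>k. i = k + 1 \<and> j = k \<and> 1 \<le> k \<and> k + 1 \<le> n - 1)"
      using E ij unfolding orientation_def by blast
    then have "(1 < j \<and> j < n \<and> i = j - 1) \<or> (1 < i \<and> i < n \<and> j = i - 1)" by auto
    then consider "1 < j" "j < n" "i = j - 1" | "1 < i" "i < n" "j = i - 1" by blast
    then show "z \<in> tri_cong n U"
    proof cases
      case c: 1
      define b where "b = j"
      have 1: "1 < b" "b < n" "i = b - 1" "j = b" using c by (auto simp: b_def)
      have "b \<notin> U" using U ij 1 by auto
      have s: "sgen j \<in> perms n" "sgen j \<circ> sgen i \<in> perms n"
        using 1 by (auto intro!: sgen_permutes sgen_comp_perms)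
      have e: "inv_set n (sgen j) = {(b, b + 1)}" "inv_set n (sgen j \<circ> sgen i) = {(b, b + 1), (b - 1, b + 1)}"
        using 1 inv_set_sgen[of b n] inv_set_sgen_down[of b n] by auto
      have "{(b, b + 1)} = rset U b {(b, b + 1), (b - 1, b + 1)}"
        using \<open>b \<notin> U\<close> 1 by (auto simp: rset_def)
      then have "tri n U (inv_set n (sgen j)) = tri n U (inv_set n (sgen j \<circ> sgen i))"
        unfolding e using tri_rset[of n "{(b, b + 1), (b - 1, b + 1)}" U b] inv_set_biclosed[OF s(2)] e by simp
      then show ?thesis using s z by (simp add: tri_cong_def)
    next
      case c: 2
      define b where "b = i"
      have 2: "1 < b" "b < n" "i = b" "j = b - 1" using c by (auto simp: b_def)
      have "b \<in> U" using U ij 2 by auto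
      have s: "sgen j \<in> perms n" "sgen j \<circ> sgen i \<in> perms n"
        using 2 by (auto intro!: sgen_permutes sgen_comp_perms)
      have e: "inv_set n (sgen j) = {(b - 1, b)}" "inv_set n (sgen j \<circ> sgen i) = {(b - 1, b), (b - 1, b + 1)}"
        using 2 inv_set_sgen[of "b - 1" n] inv_set_sgen_up[of b n] by auto
      have "{(b - 1, b)} = rset U b {(b - 1, b), (b - 1, b + 1)}"
        using \<open>b \<in> U\<close> 2 by (auto simp: rset_def)
      then have "tri n U (inv_set n (sgen j)) = tri n U (inv_set n (sgen j \<circ> sgen i))"
        unfolding e using tri_rset[of n "{(b - 1, b), (b - 1, b + 1)}" U b] inv_set_biclosed[OF s(2)] e by simp
      then show ?thesis using s z by (simp add: tri_cong_def)
    qed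
  qed
  then show "cambrian_cong n E \<subseteq> tri_cong n U"
    unfolding cambrian_cong_def using tri_cong_lattice by blast
  show "tri_cong n U \<subseteq> cambrian_cong n E"
    unfolding cambrian_cong_def
  proof (rule Inter_greatest)
    fix \<Theta> assume "\<Theta> \<in> {\<Theta>. lattice_congruence n \<Theta> \<and> cambrian_gens E \<subseteq> \<Theta>}"
    then have L: "lattice_congruence n \<Theta>" and g: "cambrian_gens E \<subseteq> \<Theta>" by auto
    let ?R = "transport n \<Theta>"
    have R: "bcong n ?R" by (rule transport_bcong[OF L])
    have sub: "\<Theta> \<subseteq> perms n \<times> perms n"
      using L by (auto simp: lattice_congruence_def equiv_def refl_on_def)
    have con: "contracts n ?R a c A"
      if h: "1 \<le> a" "a < b" "b < c" "c \<le> n" "b \<in> A \<longleftrightarrow> b \<in> U" for b a c A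
    proof (rule contracts_extend[OF R _ h(2,3)])
      \<comment> \<open>As \<open>b\<close> has letters on both sides in value, the orientation
        decides whether it is up or down.\<close>
      have b: "1 < b" "b < n" using h by auto
      show "contracts n ?R (b - 1) (b + 1) A"
      proof (cases "b \<in> U")
        case True
        then have "(sgen (b - 1), sgen (b - 1) \<circ> sgen b) \<in> \<Theta>"
          using g up[OF b] unfolding cambrian_gens_def by blast
        then have "(inv_set n (sgen (b - 1)), inv_set n (sgen (b - 1) \<circ> sgen b)) \<in> ?R"
          unfolding transport_def by force
        then have "({(b - 1, b)}, {(b - 1, b), (b - 1, b + 1)}) \<in> ?R"
          using inv_set_sgen[of "b - 1" n] inv_set_sgen_up[OF b] b by simp
        then show ?thesis using contracts_base_up[OF R _ b(1)] h True by blast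
      next
        case False
        then have "(sgen b, sgen b \<circ> sgen (b - 1)) \<in> \<Theta>"
          using g down[OF b] unfolding cambrian_gens_def by blast
        then have "(inv_set n (sgen b), inv_set n (sgen b \<circ> sgen (b - 1))) \<in> ?R"
          unfolding transport_def by force
        then have "({(b, b + 1)}, {(b, b + 1), (b - 1, b + 1)}) \<in> ?R"
          using inv_set_sgen[of b n] inv_set_sgen_down[OF b] b by simp
        then show ?thesis using contracts_base_down[OF R _ b(1)] h False by blast
      qed
    qed
    show "tri_cong n U \<subseteq> \<Theta>"
    proof clarify
      fix x y assume "(x, y) \<in> tri_cong n U"
      then have xy: "x \<in> perms n" "y \<in> perms n" "tri n U (inv_set n x) = tri n U (inv_set n y)"
        by (auto simp: tri_cong_def)
      have b: "biclosed n (inv_set n x)" "biclosed n (inv_set n y)" using xy inv_set_biclosed by auto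
      have "(I, dn n U I) \<in> ?R" if "biclosed n I" for I
      proof (rule bcong_dn[OF R that])
        show "contracts n ?R a c A"
          if "1 \<le> a" "a < b" "b < c" "c \<le> n" "b \<in> A \<longleftrightarrow> b \<in> U" for b a c A
          using con[OF that] .
      qed
      from this[OF b(1)] this[OF b(2)] have "(inv_set n x, inv_set n y) \<in> ?R"
        using tri_eq_dn[OF b xy(3)] bcong_sym[OF R] bcong_trans[OF R] by metis
      then show "(x, y) \<in> \<Theta>" using transport_mem[OF sub] xy by blast
    qed
  qed
qed

subsection \<open>Geometry of the polygon\<close>

text \<open>The whole line through the end points of \<open>d\<close>, as a function of the
  abscissa.\<close>

definition ht :: "(nat \<Rightarrow> pt) \<Rightarrow> nat \<times> nat \<Rightarrow> real \<Rightarrow> real" where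
  "ht v d t = snd (v (fst d)) + slope v d * (t - fst (v (fst d)))"

text \<open>Twice the signed area of the triangle; for \<open>p\<close> to the left of
  \<open>q\<close> it is positive exactly when \<open>r\<close> lies above the line.\<close>

definition det3 :: "pt \<Rightarrow> pt \<Rightarrow> pt \<Rightarrow> real" where
  "det3 p q r = (fst q - fst p) * (snd r - snd p) - (snd q - snd p) * (fst r - fst p)"

lemma polygon_mono:
  assumes "polygon_Q n U v" "i < j" "j \<le> n + 1"
  shows "fst (v i) < fst (v j)"
  using assms unfolding polygon_Q_def by blast

lemma polygon_mono_le:
  assumes "polygon_Q n U v" "i \<le> j" "j \<le> n + 1"
  shows "fst (v i) \<le> fst (v j)"
  using polygon_mono[OF assms(1)] assms(2,3) by (cases "i = j") (auto intro: less_imp_le)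

lemma ht_start: "ht v d (fst (v (fst d))) = snd (v (fst d))"
  by (simp add: ht_def)

lemma ht_end: "fst (v (fst d)) \<noteq> fst (v (snd d)) \<Longrightarrow> ht v d (fst (v (snd d))) = snd (v (snd d))"
  by (simp add: ht_def slope_def)

lemma ht_diff: "ht v d s - ht v d t = slope v d * (s - t)"
  by (simp add: ht_def algebra_simps)

lemma ht_det3:
  assumes "fst (v (fst d)) < fst (v (snd d))"
  shows "ht v d (fst z) < snd z \<longleftrightarrow> 0 < det3 (v (fst d)) (v (snd d)) z"
    and "snd z < ht v d (fst z) \<longleftrightarrow> det3 (v (fst d)) (v (snd d)) z < 0"
proof -
  have "det3 (v (fst d)) (v (snd d)) z =
      (fst (v (snd d)) - fst (v (fst d))) * (snd z - ht v d (fst z))"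
    using assms by (simp add: det3_def ht_def slope_def field_simps)
  moreover have "0 < fst (v (snd d)) - fst (v (fst d))" using assms by simp
  ultimately show "ht v d (fst z) < snd z \<longleftrightarrow> 0 < det3 (v (fst d)) (v (snd d)) z"
    "snd z < ht v d (fst z) \<longleftrightarrow> det3 (v (fst d)) (v (snd d)) z < 0"
    by (simp_all add: zero_less_mult_iff mult_less_0_iff)
qed

lemma segment_iff_ht:
  assumes "fst (v (fst d)) < fst (v (snd d))"
  shows "z \<in> closed_segment (v (fst d)) (v (snd d)) \<longleftrightarrow>
    fst (v (fst d)) \<le> fst z \<and> fst z \<le> fst (v (snd d)) \<and> snd z = ht v d (fst z)"
proof
  let ?a = "v (fst d)" let ?b = "v (snd d)"
  have s: "slope v d * (fst ?b - fst ?a) = snd ?b - snd ?a"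
    using assms by (simp add: slope_def)
  assume "z \<in> closed_segment ?a ?b"
  then obtain u where u: "0 \<le> u" "u \<le> 1" and z: "z = (1 - u) *\<^sub>R ?a + u *\<^sub>R ?b"
    by (auto simp: closed_segment_def)
  have f: "fst z = fst ?a + u * (fst ?b - fst ?a)" "snd z = snd ?a + u * (snd ?b - snd ?a)"
    by (simp_all add: z algebra_simps)
  have "u * (fst ?b - fst ?a) \<le> fst ?b - fst ?a" "0 \<le> u * (fst ?b - fst ?a)"
    using u assms by (simp_all add: mult_left_le_one_le)
  then have "fst ?a \<le> fst z" "fst z \<le> fst ?b" using f(1) by linarith+
  moreover have "snd z = ht v d (fst z)"
    unfolding f ht_def s[symmetric] by (simp add: algebra_simps)
  ultimately show "fst ?a \<le> fst z \<and> fst z \<le> fst ?b \<and> snd z = ht v d (fst z)" by simp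
next
  let ?a = "v (fst d)" let ?b = "v (snd d)"
  assume h: "fst ?a \<le> fst z \<and> fst z \<le> fst ?b \<and> snd z = ht v d (fst z)"
  define u where "u = (fst z - fst ?a) / (fst ?b - fst ?a)"
  have u: "0 \<le> u" "u \<le> 1" using h assms by (auto simp: u_def)
  have f: "u * (fst ?b - fst ?a) = fst z - fst ?a" using assms by (simp add: u_def)
  have "u * (snd ?b - snd ?a) = snd z - snd ?a"
    using h assms by (simp add: ht_def slope_def u_def)
  then have "z = (1 - u) *\<^sub>R ?a + u *\<^sub>R ?b"
    using f by (intro prod_eqI) (simp_all add: algebra_simps)
  then show "z \<in> closed_segment ?a ?b" using u by (auto simp: closed_segment_def)
qed

lemma vertical_segment:
  fixes a b x y :: real
  assumes "a \<le> y" "y \<le> b"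
  shows "(x, y) \<in> closed_segment (x, a) (x, b)"
proof (cases "a = b")
  case True
  then show ?thesis using assms by simp
next
  case False
  define u where "u = (y - a) / (b - a)"
  have "0 \<le> u" "u \<le> 1" "u * (b - a) = y - a" using assms False by (auto simp: u_def)
  moreover then have "(x, y) = (1 - u) *\<^sub>R (x, a) + u *\<^sub>R (x, b)"
    by (auto simp: algebra_simps)
  ultimately show ?thesis unfolding closed_segment_def by blast
qed

text \<open>If an upper vertex were not above the chord it would lie between that chord and the
  horizontal axis, hence in the convex hull of other vertices.\<close>
lemma vertex_side:
  assumes Q: "polygon_Q n U v" and o: "fst d < m" "m < snd d" "snd d \<le> n + 1"
  shows "m \<in> U \<Longrightarrow> ht v d (fst (v m)) < snd (v m)"
    and "m \<notin> U \<Longrightarrow> snd (v m) < ht v d (fst (v m))"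
proof -
  define C where "C = convex hull (v ` ({0..n + 1} - {m}))"
  have cC: "convex C" by (simp add: C_def)
  have inC: "v k \<in> C" if "k \<le> n + 1" "k \<noteq> m" for k
    unfolding C_def using that by (intro hull_inc) auto
  have mC: "v m \<notin> C" using Q o unfolding polygon_Q_def C_def by auto
  have sgn: "m \<in> U \<Longrightarrow> 0 < snd (v m)" "m \<notin> U \<Longrightarrow> snd (v m) < 0"
    using Q o unfolding polygon_Q_def by auto
  have x: "fst (v (fst d)) < fst (v m)" "fst (v m) < fst (v (snd d))"
    "fst (v 0) < fst (v m)" "fst (v m) < fst (v (n + 1))"
    using o by (auto intro!: polygon_mono[OF Q])
  have "snd (v 0) = 0" "snd (v (n + 1)) = 0" using Q by (auto simp: polygon_Q_def)
  then have "(fst (v m), 0) \<in> closed_segment (v 0) (v (n + 1))"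
    using segment_iff_ht[of v "(0, n + 1)" "(fst (v m), 0)"] x by (simp add: ht_def slope_def)
  then have ax: "(fst (v m), 0) \<in> C"
    using closed_segment_subset[OF inC[of 0] inC[of "n + 1"] cC] o by auto
  have "(fst (v m), ht v d (fst (v m))) \<in> closed_segment (v (fst d)) (v (snd d))"
    using x by (subst segment_iff_ht) auto
  then have ch: "(fst (v m), ht v d (fst (v m))) \<in> C"
    using closed_segment_subset[OF inC[of "fst d"] inC[of "snd d"] cC] o by auto
  have vm: "v m = (fst (v m), snd (v m))" by simp
  show "ht v d (fst (v m)) < snd (v m)" if "m \<in> U"
  proof (rule ccontr)
    assume "\<not> ?thesis"
    then have "v m \<in> closed_segment (fst (v m), 0) (fst (v m), ht v d (fst (v m)))"
      using sgn(1)[OF that] by (subst vm) (intro vertical_segment; simp)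
    then show False using closed_segment_subset[OF ax ch cC] mC by blast
  qed
  show "snd (v m) < ht v d (fst (v m))" if "m \<notin> U"
  proof (rule ccontr)
    assume "\<not> ?thesis"
    then have "v m \<in> closed_segment (fst (v m), ht v d (fst (v m))) (fst (v m), 0)"
      using sgn(2)[OF that] by (subst vm) (intro vertical_segment; simp)
    then show False using closed_segment_subset[OF ch ax cC] mC by blast
  qed
qed

lemma lo_ht:
  assumes Q: "polygon_Q n U v" and d: "fst d < snd d" "snd d \<le> n + 1" and k: "k \<in> lo n U d"
  shows "snd (v k) \<le> ht v d (fst (v k))" "k \<notin> U \<Longrightarrow> snd (v k) < ht v d (fst (v k))"
proof -
  have "snd (v k) < ht v d (fst (v k))" if "k \<notin> U"
    using vertex_side(2)[OF Q _ _ d(2), of k] k that by (auto simp: lo_def)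
  moreover have "snd (v k) = ht v d (fst (v k))" if "k \<in> U"
    using that k polygon_mono[OF Q d] ht_start[of v d] ht_end[of v d] by (auto simp: lo_def)
  ultimately show "snd (v k) \<le> ht v d (fst (v k))" "k \<notin> U \<Longrightarrow> snd (v k) < ht v d (fst (v k))"
    by fastforce+
qed

lemma hi_ht:
  assumes Q: "polygon_Q n U v" and d: "fst d < snd d" "snd d \<le> n + 1" and k: "k \<in> hi n U d"
  shows "ht v d (fst (v k)) \<le> snd (v k)" "k \<in> U \<Longrightarrow> ht v d (fst (v k)) < snd (v k)"
proof -
  have "ht v d (fst (v k)) < snd (v k)" if "k \<in> U"
    using vertex_side(1)[OF Q _ _ d(2), of k] k that by (auto simp: hi_def)
  moreover have "snd (v k) = ht v d (fst (v k))" if "k \<notin> U"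
    using that k polygon_mono[OF Q d] ht_start[of v d] ht_end[of v d] by (auto simp: hi_def)
  ultimately show "ht v d (fst (v k)) \<le> snd (v k)" "k \<in> U \<Longrightarrow> ht v d (fst (v k)) < snd (v k)"
    by fastforce+
qed

text \<open>A lower vertex in \<open>lo\<close> is strictly below \<open>d\<close>, an upper vertex
  in \<open>hi\<close> strictly above \<open>e\<close>; so one of the two comparisons is strict for
  either kind of \<open>k\<close>.\<close>

lemma lo_hi_less:
  assumes Q: "polygon_Q n U v" and d: "fst d < snd d" "snd d \<le> n + 1"
    and e: "fst e < snd e" "snd e \<le> n + 1" and k: "k \<in> lo n U d" "k \<in> hi n U e"
  shows "ht v e (fst (v k)) < ht v d (fst (v k))"
  using lo_ht[OF Q d k(1)] hi_ht[OF Q e k(2)] by (cases "k \<in> U") auto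

text \<open>The line of \<open>d\<close> runs above that of \<open>e\<close> at \<open>a\<close> and
  below it further right, at \<open>c\<close>.\<close>

lemma slope_less:
  assumes Q: "polygon_Q n U v" and d: "d \<in> diag n U" and e: "e \<in> diag n U" and ac: "a < c"
    and "a \<in> lo n U d" "c \<in> hi n U d" "c \<in> lo n U e" "a \<in> hi n U e"
  shows "slope v d < slope v e"
proof -
  note dd = diagD[OF d] diagD[OF e]
  have "c \<in> {1..n}" using assms(6) by (simp add: hi_def)
  then have x: "0 < fst (v c) - fst (v a)" using polygon_mono[OF Q ac] by auto
  have "ht v e (fst (v a)) < ht v d (fst (v a))" "ht v d (fst (v c)) < ht v e (fst (v c))"
    using assms(5-8) dd by (auto intro: lo_hi_less[OF Q])
  then have "ht v d (fst (v c)) - ht v d (fst (v a)) < ht v e (fst (v c)) - ht v e (fst (v a))"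
    by linarith
  then show ?thesis unfolding ht_diff using x by (simp add: mult_less_cancel_right)
qed

lemma ht_between:
  fixes s t r :: real
  assumes "ht v e s < ht v d s" "ht v e t < ht v d t" "s \<le> r" "r \<le> t"
  shows "ht v e r < ht v d r"
proof -
  let ?k = "slope v d - slope v e"
  have g: "(ht v d x - ht v e x) - (ht v d y - ht v e y) = ?k * (x - y)" for x y
    using ht_diff[of v d x y] ht_diff[of v e x y] by (simp add: algebra_simps)
  show ?thesis
  proof (cases "0 \<le> ?k")
    case True
    then have "0 \<le> ?k * (r - s)" using assms by simp
    then show ?thesis using g[of r s] assms(1) by linarith
  next
    case False
    then have "0 \<le> ?k * (r - t)" using assms by (intro mult_nonpos_nonpos) auto
    then show ?thesis using g[of r t] assms(2) by linarith
  qed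
qed

section \<open>Combinatorial and geometric crossing\<close>

text \<open>The difference of the heights is affine in the abscissa, positive at \<open>p\<close>
  and negative at \<open>q\<close>; its zero gives a common point.\<close>

lemma ccross_imp_crosses:
  assumes Q: "polygon_Q n U v" and d: "fst d < snd d" "snd d \<le> n + 1"
    and e: "fst e < snd e" "snd e \<le> n + 1" and c: "ccross n U d e"
  shows "crosses v d e"
proof -
  obtain p q where p: "p \<in> lo n U d" "p \<in> hi n U e" and q: "q \<in> hi n U d" "q \<in> lo n U e"
    using c unfolding ccross_def by blast
  define g where "g t = ht v d t - ht v e t" for t
  have gp: "0 < g (fst (v p))" using lo_hi_less[OF Q d e p] by (simp add: g_def)
  have gq: "g (fst (v q)) < 0" using lo_hi_less[OF Q e d q(2,1)] by (simp add: g_def)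
  define s where "s = slope v d - slope v e"
  have lin: "g x - g y = s * (x - y)" for x y
    using ht_diff[of v d x y] ht_diff[of v e x y] by (simp add: algebra_simps g_def s_def)
  \<comment> \<open>The relative position of the zero between \<open>p\<close> and
    \<open>q\<close>.\<close>
  define r where "r = g (fst (v p)) / (g (fst (v p)) - g (fst (v q)))"
  have r: "0 < r" "r < 1" using gp gq by (auto simp: r_def field_simps)
  define t where "t = fst (v p) + r * (fst (v q) - fst (v p))"
  have "g t - g (fst (v p)) = r * (g (fst (v q)) - g (fst (v p)))"
    unfolding lin by (simp add: t_def)
  then have "g t = g (fst (v p)) + r * (g (fst (v q)) - g (fst (v p)))" by simp
  also have "\<dots> = 0" using gp gq by (simp add: r_def field_simps)
  finally have gt: "ht v d t = ht v e t" by (simp add: g_def)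
  have ne: "fst (v p) \<noteq> fst (v q)" using gp gq by auto
  \<comment> \<open>\<open>t\<close> is a proper convex combination of two different abscissae, so
    it is strictly inside both spans and the common point is no shared end.\<close>
  have strict: "m < t" if "m \<le> fst (v p)" "m \<le> fst (v q)" for m
  proof -
    have "t - m = (1 - r) * (fst (v p) - m) + r * (fst (v q) - m)" by (simp add: t_def algebra_simps)
    moreover have "0 < fst (v p) - m \<or> 0 < fst (v q) - m" using ne that by auto
    ultimately show ?thesis using r that
      by (smt (verit) mult_nonneg_nonneg mult_pos_pos)
  qed
  have strict': "t < m" if "fst (v p) \<le> m" "fst (v q) \<le> m" for m
  proof -
    have "m - t = (1 - r) * (m - fst (v p)) + r * (m - fst (v q))" by (simp add: t_def algebra_simps)
    moreover have "0 < m - fst (v p) \<or> 0 < m - fst (v q)" using ne that by auto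
    ultimately show ?thesis using r that
      by (smt (verit) mult_nonneg_nonneg mult_pos_pos)
  qed
  have td: "fst (v (fst d)) < t" "t < fst (v (snd d))"
    using lo_range[OF p(1)] hi_range[OF q(1)] d
    by (intro strict strict' polygon_mono_le[OF Q]; simp)+
  have te: "fst (v (fst e)) < t" "t < fst (v (snd e))"
    using lo_range[OF q(2)] hi_range[OF p(2)] e
    by (intro strict strict' polygon_mono_le[OF Q]; simp)+
  have "(t, ht v d t) \<in> closed_segment (v (fst d)) (v (snd d))"
    using td by (subst segment_iff_ht) auto
  moreover have "(t, ht v d t) \<in> closed_segment (v (fst e)) (v (snd e))"
    using te gt by (subst segment_iff_ht) auto
  moreover have "(t, ht v d t) \<notin> v ` ({fst d, snd d} \<inter> {fst e, snd e})"
  proof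
    assume "(t, ht v d t) \<in> v ` ({fst d, snd d} \<inter> {fst e, snd e})"
    then obtain s where s: "s = fst d \<or> s = snd d" "(t, ht v d t) = v s" by auto
    have "t = fst (v s)" unfolding s(2)[symmetric] by simp
    then show False using s(1) td by auto
  qed
  ultimately show ?thesis unfolding crosses_def by blast
qed

text \<open>Compare heights at the two ends of the common span. At an end not shared by the
  diagonals one line is strictly above the other; without combinatorial crossing it is the same line
  at both ends, hence also at the common point in between. If an end is shared, agreement there and
  at the common point makes the lines coincide.\<close>

lemma crosses_imp_ccross:
  assumes Q: "polygon_Q n U v" and d: "fst d < snd d" "snd d \<le> n + 1"
    and e: "fst e < snd e" "snd e \<le> n + 1" and ne: "d \<noteq> e" and c: "crosses v d e"
  shows "ccross n U d e"
proof (rule ccontr)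
  assume nc: "\<not> ccross n U d e"
  obtain z where zd: "z \<in> closed_segment (v (fst d)) (v (snd d))"
    and ze: "z \<in> closed_segment (v (fst e)) (v (snd e))"
    and zn: "z \<notin> v ` ({fst d, snd d} \<inter> {fst e, snd e})"
    using c unfolding crosses_def by blast
  note xd = polygon_mono[OF Q d] and xe = polygon_mono[OF Q e]
  define t where "t = fst z"
  have td: "fst (v (fst d)) \<le> t" "t \<le> fst (v (snd d))" "snd z = ht v d t"
    using zd segment_iff_ht[of v d z] xd by (auto simp: t_def)
  have te: "fst (v (fst e)) \<le> t" "t \<le> fst (v (snd e))" "snd z = ht v e t"
    using ze segment_iff_ht[of v e z] xe by (auto simp: t_def)
  have zero: "ht v d t = ht v e t" using td te by simp
  have vert: "z = v k" if "t = fst (v k)" "k = fst d \<or> k = snd d" for k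
    using that td(3) ht_start[of v d] ht_end[of v d] xd by (intro prod_eqI) (auto simp: t_def)
  have common: "k \<noteq> fst d \<and> k \<noteq> snd d \<or> k \<noteq> fst e \<and> k \<noteq> snd e" if "t = fst (v k)" for k
    using vert[OF that] zn by auto
  define s where "s = slope v d - slope v e"
  have lin: "(ht v d x - ht v e x) - (ht v d y - ht v e y) = s * (x - y)" for x y
    using ht_diff[of v d x y] ht_diff[of v e x y] by (simp add: algebra_simps s_def)
  define m1 where "m1 = max (fst d) (fst e)"
  define m2 where "m2 = min (snd d) (snd e)"
  have m1t: "fst (v m1) \<le> t" and m2t: "t \<le> fst (v m2)"
    using td te by (auto simp: m1_def m2_def max_def min_def)
  have mle: "m1 \<le> m2"
  proof (rule ccontr)
    assume "\<not> ?thesis"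
    then have "fst (v m2) < fst (v m1)" using d e
      by (intro polygon_mono[OF Q]) (auto simp: m1_def m2_def)
    then show False using m1t m2t by linarith
  qed
  \<comment> \<open>A common span of one vertex would be an end of both diagonals, where meeting is
    allowed.\<close>
  have mlt: "m1 < m2"
  proof (rule ccontr)
    assume "\<not> ?thesis"
    then have "m1 = m2" using mle by simp
    then have "t = fst (v m1)" "m1 = fst d \<or> m1 = snd d" "m1 = fst e \<or> m1 = snd e"
      using m1t m2t d e by (auto simp: m1_def m2_def max_def min_def split: if_splits)
    then show False using common by blast
  qed
  have sgn: "(m \<in> lo n U d \<and> m \<in> hi n U e \<and> ht v e (fst (v m)) < ht v d (fst (v m))) \<or>
             (m \<in> hi n U d \<and> m \<in> lo n U e \<and> ht v d (fst (v m)) < ht v e (fst (v m)))"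
    if "(fst d < m \<and> m < snd d \<and> (m = fst e \<or> m = snd e)) \<or> (fst e < m \<and> m < snd e \<and> (m = fst d \<or> m = snd d))" for m
  proof -
    have "m \<in> {1..n}" using that d e by auto
    then have "(m \<in> lo n U d \<and> m \<in> hi n U e) \<or> (m \<in> hi n U d \<and> m \<in> lo n U e)"
      using that unfolding lo_def hi_def by blast
    then show ?thesis using lo_hi_less[OF Q d e] lo_hi_less[OF Q e d] by blast
  qed
  have L: "fst d = fst e \<or> (fst d < m1 \<and> m1 < snd d \<and> (m1 = fst e \<or> m1 = snd e)) \<or> (fst e < m1 \<and> m1 < snd e \<and> (m1 = fst d \<or> m1 = snd d))"
    using mlt unfolding m1_def m2_def by (auto simp: max_def min_def split: if_splits)
  have R: "snd d = snd e \<or> (fst d < m2 \<and> m2 < snd d \<and> (m2 = fst e \<or> m2 = snd e)) \<or> (fst e < m2 \<and> m2 < snd e \<and> (m2 = fst d \<or> m2 = snd d))"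
    using mlt unfolding m1_def m2_def by (auto simp: max_def min_def split: if_splits)
  have zero_at: "ht v d (fst (v m)) \<noteq> ht v e (fst (v m))"
    if "m = m1 \<and> fst d \<noteq> fst e \<or> m = m2 \<and> snd d \<noteq> snd e" for m
    using that L R sgn[of m] by auto
  show False
  proof (cases "fst d = fst e")
    case fe: True
    then have "snd d \<noteq> snd e" using ne by (simp add: prod_eq_iff)
    then have n2: "ht v d (fst (v m2)) \<noteq> ht v e (fst (v m2))" using zero_at by blast
    have z1: "ht v d (fst (v (fst d))) = ht v e (fst (v (fst d)))"
      using ht_start[of v d] ht_start[of v e] fe by simp
    have "t \<noteq> fst (v (fst d))" using common fe by auto
    then have "s = 0" using lin[of t "fst (v (fst d))"] zero z1 by simp
    then show False using lin[of "fst (v m2)" t] n2 zero by simp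
  next
    case fne: False
    have n1: "ht v d (fst (v m1)) \<noteq> ht v e (fst (v m1))" using zero_at fne by blast
    show False
    proof (cases "snd d = snd e")
      case se: True
      have z1: "ht v d (fst (v (snd d))) = ht v e (fst (v (snd d)))"
        using ht_end[of v d] ht_end[of v e] se xd xe by simp
      have "t \<noteq> fst (v (snd d))" using common se by auto
      then have "s = 0" using lin[of t "fst (v (snd d))"] zero z1 by simp
      then show False using lin[of "fst (v m1)" t] n1 zero by simp
    next
      case sne: False
      have 1: "(m1 \<in> lo n U d \<and> m1 \<in> hi n U e \<and> ht v e (fst (v m1)) < ht v d (fst (v m1))) \<or>
             (m1 \<in> hi n U d \<and> m1 \<in> lo n U e \<and> ht v d (fst (v m1)) < ht v e (fst (v m1)))"
        using L fne by (intro sgn) blast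
      have 2: "(m2 \<in> lo n U d \<and> m2 \<in> hi n U e \<and> ht v e (fst (v m2)) < ht v d (fst (v m2))) \<or>
             (m2 \<in> hi n U d \<and> m2 \<in> lo n U e \<and> ht v d (fst (v m2)) < ht v e (fst (v m2)))"
        using R sne by (intro sgn) blast
      have "(ht v e (fst (v m1)) < ht v d (fst (v m1)) \<and> ht v e (fst (v m2)) < ht v d (fst (v m2))) \<or>
        (ht v d (fst (v m1)) < ht v e (fst (v m1)) \<and> ht v d (fst (v m2)) < ht v e (fst (v m2)))"
        using 1 2 nc unfolding ccross_def by blast
      then show False using ht_between[OF _ _ m1t m2t, of v d e] ht_between[OF _ _ m1t m2t, of v e d] zero
        by fastforce
    qed
  qed
qed

section \<open>Sides and diagonals of the polygon\<close>

text \<open>\<open>vertex_side\<close> speaks of the middle one of three vertices. For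
  \<open>k\<close> outside the span the middle one is the nearer end of \<open>d\<close>, and
  exchanging two points in the determinant flips the sign.\<close>

lemma det3_side:
  assumes Q: "polygon_Q n U v" and d: "fst d < snd d" "snd d \<le> n + 1"
  shows "fst d < k \<Longrightarrow> k < snd d \<Longrightarrow> if k \<in> U then 0 < det3 (v (fst d)) (v (snd d)) (v k)
      else det3 (v (fst d)) (v (snd d)) (v k) < 0"
    and "k < fst d \<Longrightarrow> if fst d \<in> U then det3 (v (fst d)) (v (snd d)) (v k) < 0
      else 0 < det3 (v (fst d)) (v (snd d)) (v k)"
    and "snd d < k \<Longrightarrow> k \<le> n + 1 \<Longrightarrow> if snd d \<in> U then det3 (v (fst d)) (v (snd d)) (v k) < 0
      else 0 < det3 (v (fst d)) (v (snd d)) (v k)"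
proof -
  have base: "if m \<in> U then 0 < det3 (v i) (v j) (v m) else det3 (v i) (v j) (v m) < 0"
    if o: "i < m" "m < j" "j \<le> n + 1" for i m j
  proof -
    have x: "fst (v i) < fst (v j)" using polygon_mono[OF Q, of i j] o by auto
    show ?thesis
      using vertex_side[OF Q, of "(i, j)" m] ht_det3[of v "(i, j)" "v m"] o x by auto
  qed
  show "if k \<in> U then 0 < det3 (v (fst d)) (v (snd d)) (v k)
      else det3 (v (fst d)) (v (snd d)) (v k) < 0" if "fst d < k" "k < snd d"
    using base[OF that d(2)] .
  show "if fst d \<in> U then det3 (v (fst d)) (v (snd d)) (v k) < 0
      else 0 < det3 (v (fst d)) (v (snd d)) (v k)" if "k < fst d"
  proof -
    have "det3 (v (fst d)) (v (snd d)) (v k) = - det3 (v k) (v (snd d)) (v (fst d))"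
      by (simp add: det3_def algebra_simps)
    then show ?thesis using base[OF that d] by (auto split: if_splits)
  qed
  show "if snd d \<in> U then det3 (v (fst d)) (v (snd d)) (v k) < 0
      else 0 < det3 (v (fst d)) (v (snd d)) (v k)" if "snd d < k" "k \<le> n + 1"
  proof -
    have "det3 (v (fst d)) (v (snd d)) (v k) = - det3 (v (fst d)) (v k) (v (snd d))"
      by (simp add: det3_def algebra_simps)
    then show ?thesis using base[OF d(1) that] by (auto split: if_splits)
  qed
qed

text \<open>If \<open>lo\<close> is empty, inner vertices are upper and every end point other than
  \<open>v 0\<close> and \<open>v (n + 1)\<close> is lower, so no vertex is below the line.\<close>

lemma lo_empty_det3:
  assumes Q: "polygon_Q n U v" and d: "fst d < snd d" "snd d \<le> n + 1"
    and l: "lo n U d = {}" and k: "k \<le> n + 1"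
  shows "0 \<le> det3 (v (fst d)) (v (snd d)) (v k)"
proof -
  consider "k = fst d" | "k = snd d" | "fst d < k" "k < snd d" | "k < fst d" | "snd d < k" by linarith
  then show ?thesis
  proof cases
    case 3
    have "k \<notin> lo n U d" using l by simp
    then have "k \<in> U" using 3 d by (auto simp: lo_def)
    then show ?thesis using det3_side(1)[OF Q d 3] by simp
  next
    case 4
    have "fst d \<notin> lo n U d" using l by simp
    then have "fst d \<notin> U" using 4 d by (auto simp: lo_def)
    then show ?thesis using det3_side(2)[OF Q d 4] by simp
  next
    case 5
    have "snd d \<notin> lo n U d" using l by simp
    then have "snd d \<notin> U" using 5 d k by (auto simp: lo_def)
    then show ?thesis using det3_side(3)[OF Q d 5 k] by simp
  qed (simp_all add: det3_def)
qed

lemma hi_empty_det3: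
  assumes Q: "polygon_Q n U v" and d: "fst d < snd d" "snd d \<le> n + 1"
    and l: "hi n U d = {}" and k: "k \<le> n + 1"
  shows "det3 (v (fst d)) (v (snd d)) (v k) \<le> 0"
proof -
  consider "k = fst d" | "k = snd d" | "fst d < k" "k < snd d" | "k < fst d" | "snd d < k" by linarith
  then show ?thesis
  proof cases
    case 3
    have "k \<notin> hi n U d" using l by simp
    then have "k \<notin> U" using 3 d by (auto simp: hi_def)
    then show ?thesis using det3_side(1)[OF Q d 3] by simp
  next
    case 4
    have "fst d \<notin> hi n U d" using l by simp
    then have "fst d \<in> U" using 4 d by (auto simp: hi_def)
    then show ?thesis using det3_side(2)[OF Q d 4] by simp
  next
    case 5
    have "snd d \<notin> hi n U d" using l by simp
    then have "snd d \<in> U" using 5 d k by (auto simp: hi_def)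
    then show ?thesis using det3_side(3)[OF Q d 5 k] by simp
  qed (simp_all add: det3_def)
qed

text \<open>Inside the span \<open>k\<close> itself is the witness. An upper end point lies on the
  line, and then \<open>v 0\<close> or \<open>v (n + 1)\<close> beyond it is below.\<close>

lemma lo_vertex_below:
  assumes Q: "polygon_Q n U v" and d: "fst d < snd d" "snd d \<le> n + 1" and k: "k \<in> lo n U d"
  shows "\<exists>m\<le>n + 1. det3 (v (fst d)) (v (snd d)) (v m) < 0"
proof -
  have kr: "1 \<le> k" "k \<le> n" using k by (auto simp: lo_def)
  consider "fst d < k" "k < snd d" "k \<notin> U" | "k = fst d" "k \<in> U" | "k = snd d" "k \<in> U"
    using k unfolding lo_def by auto
  then show ?thesis
  proof cases
    case 1
    then show ?thesis using det3_side(1)[OF Q d 1(1,2)] kr by (intro exI[of _ k]) auto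
  next
    case 2
    then show ?thesis using det3_side(2)[OF Q d, of 0] kr by (intro exI[of _ 0]) auto
  next
    case 3
    then show ?thesis using det3_side(3)[OF Q d, of "n + 1"] kr by (intro exI[of _ "n + 1"]) auto
  qed
qed

lemma hi_vertex_above:
  assumes Q: "polygon_Q n U v" and d: "fst d < snd d" "snd d \<le> n + 1" and k: "k \<in> hi n U d"
  shows "\<exists>m\<le>n + 1. 0 < det3 (v (fst d)) (v (snd d)) (v m)"
proof -
  have kr: "1 \<le> k" "k \<le> n" using k by (auto simp: hi_def)
  consider "fst d < k" "k < snd d" "k \<in> U" | "k = fst d" "k \<notin> U" | "k = snd d" "k \<notin> U"
    using k unfolding hi_def by auto
  then show ?thesis
  proof cases
    case 1
    then show ?thesis using det3_side(1)[OF Q d 1(1,2)] kr by (intro exI[of _ k]) auto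
  next
    case 2
    then show ?thesis using det3_side(2)[OF Q d, of 0] kr by (intro exI[of _ 0]) auto
  next
    case 3
    then show ?thesis using det3_side(3)[OF Q d, of "n + 1"] kr by (intro exI[of _ "n + 1"]) auto
  qed
qed

lemma supporting_segment_frontier:
  fixes S :: "pt set" and a :: pt
  assumes a: "a \<noteq> 0" and S: "\<And>z. z \<in> S \<Longrightarrow> b \<le> a \<bullet> z"
    and pq: "p \<in> S" "q \<in> S" "a \<bullet> p = b" "a \<bullet> q = b"
  shows "closed_segment p q \<subseteq> frontier (convex hull S)"
proof
  fix z assume z: "z \<in> closed_segment p q"
  have "convex hull S \<subseteq> {z. b \<le> a \<bullet> z}"
    by (rule hull_minimal) (use S in \<open>auto intro: convex_halfspace_ge\<close>)
  then have "interior (convex hull S) \<subseteq> interior {z. a \<bullet> z \<ge> b}" by (intro interior_mono) auto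
  then have int: "interior (convex hull S) \<subseteq> {z. a \<bullet> z > b}" using interior_halfspace_ge[OF a] by simp
  have "closed_segment p q \<subseteq> {z. a \<bullet> z = b}"
    by (rule closed_segment_subset) (use pq in \<open>auto intro: convex_hyperplane\<close>)
  then have "z \<notin> interior (convex hull S)" using z int by auto
  moreover have "z \<in> convex hull S"
    using z closed_segment_subset[OF hull_inc[OF pq(1)] hull_inc[OF pq(2)] convex_convex_hull] by blast
  ultimately show "z \<in> frontier (convex hull S)"
    unfolding frontier_def using closure_subset by auto
qed

text \<open>Barycentric coordinates: \<beta> is a ratio of signed areas, and \<alpha> is solved from
  the abscissae, where \<open>p\<close> and \<open>q\<close> differ.\<close>

lemma affine_coordinates:
  fixes p q w z :: pt
  assumes x: "fst p \<noteq> fst q" and w: "det3 p q w \<noteq> 0"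
  defines "\<beta> \<equiv> det3 p q z / det3 p q w"
  defines "\<alpha> \<equiv> ((fst z - fst p) - \<beta> * (fst w - fst p)) / (fst q - fst p)"
  shows "z = (1 - \<alpha> - \<beta>) *\<^sub>R p + \<alpha> *\<^sub>R q + \<beta> *\<^sub>R w"
proof -
  have al: "\<alpha> * (fst q - fst p) = (fst z - fst p) - \<beta> * (fst w - fst p)"
    using x by (simp add: \<alpha>_def)
  have be: "\<beta> * det3 p q w = det3 p q z" using w by (simp add: \<beta>_def)
  have "(fst q - fst p) * (\<alpha> * (snd q - snd p) + \<beta> * (snd w - snd p)) =
      (\<alpha> * (fst q - fst p)) * (snd q - snd p) + \<beta> * ((fst q - fst p) * (snd w - snd p))"
    by (simp add: algebra_simps)
  also have "\<dots> = (fst z - fst p) * (snd q - snd p) + \<beta> * det3 p q w"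
    unfolding al by (simp add: det3_def algebra_simps)
  also have "\<dots> = (fst q - fst p) * (snd z - snd p)"
    unfolding be by (simp add: det3_def algebra_simps)
  finally have "\<alpha> * (snd q - snd p) + \<beta> * (snd w - snd p) = snd z - snd p" using x by simp
  then show ?thesis using al by (intro prod_eqI) (simp_all add: algebra_simps)
qed

text \<open>The midpoint is interior: the two triangles over the segment with apices
  \<open>u\<close> and \<open>w\<close> on opposite sides together contain a neighbourhood of
  it.\<close>

lemma segment_not_frontier:
  fixes S :: "pt set"
  assumes p: "p \<in> S" and q: "q \<in> S" and x: "fst p \<noteq> fst q"
    and u: "u \<in> S" "det3 p q u < 0" and w: "w \<in> S" "0 < det3 p q w"
  shows "\<not> closed_segment p q \<subseteq> frontier (convex hull S)"
proof
  assume fr: "closed_segment p q \<subseteq> frontier (convex hull S)"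
  define bt where "bt r z = det3 p q z / det3 p q r" for r z
  define al where "al r z = ((fst z - fst p) - bt r z * (fst r - fst p)) / (fst q - fst p)" for r z
  \<comment> \<open>\<open>W\<close> asks for positive weights at \<open>p\<close> and
    \<open>q\<close> in both triangles; the sign of \<open>det3 p q z\<close> then decides which
    triangle contains \<open>z\<close>.\<close>
  define W where "W = {z. 0 < al u z} \<inter> {z. 0 < 1 - al u z - bt u z} \<inter>
    ({z. 0 < al w z} \<inter> {z. 0 < 1 - al w z - bt w z})"
  have cont: "continuous_on UNIV (bt r)" "continuous_on UNIV (al r)" for r
    unfolding al_def bt_def det3_def divide_inverse by (intro continuous_intros)+
  have "open W" unfolding W_def
    by (intro open_Int open_Collect_less continuous_intros cont)
  moreover have "midpoint p q \<in> W"
  proof -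
    have f: "fst (midpoint p q) - fst p = (fst q - fst p) / 2" "snd (midpoint p q) - snd p = (snd q - snd p) / 2"
      by (simp_all add: midpoint_def field_simps)
    have "det3 p q (midpoint p q) = 0" unfolding det3_def f by simp
    then have b0: "bt r (midpoint p q) = 0" for r by (simp add: bt_def)
    have "al r (midpoint p q) = 1 / 2" for r using x by (simp add: al_def b0 f)
    from this[of u] this[of w] show ?thesis by (simp add: W_def b0)
  qed
  moreover have "W \<subseteq> convex hull S"
  proof
    fix z assume z: "z \<in> W"
    have key: "z \<in> convex hull S"
      if r: "r \<in> S" "det3 p q r \<noteq> 0" "0 < al r z" "0 < 1 - al r z - bt r z" "0 \<le> bt r z" for r
    proof -
      have "z = (1 - al r z - bt r z) *\<^sub>R p + al r z *\<^sub>R q + bt r z *\<^sub>R r"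
        unfolding al_def bt_def by (rule affine_coordinates[OF x r(2)])
      then have "z \<in> convex hull {p, q, r}"
        unfolding convex_hull_3 using r(3-5)
        by (intro CollectI exI[of _ "1 - al r z - bt r z"] exI[of _ "al r z"] exI[of _ "bt r z"]) simp
      moreover have "convex hull {p, q, r} \<subseteq> convex hull S" using p q r(1) by (intro hull_mono) auto
      ultimately show ?thesis by blast
    qed
    show "z \<in> convex hull S"
    proof (cases "0 \<le> det3 p q z")
      case True
      then have "0 \<le> bt w z" using w by (simp add: bt_def)
      then show ?thesis using key[OF w(1)] w(2) z by (simp add: W_def)
    next
      case False
      then have "0 \<le> bt u z" using u by (simp add: bt_def divide_nonpos_neg)
      then show ?thesis using key[OF u(1)] u(2) z by (simp add: W_def)
    qed
  qed
  ultimately have "midpoint p q \<in> interior (convex hull S)" by (meson interiorI)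
  moreover have "midpoint p q \<in> closed_segment p q" by simp
  ultimately show False using fr unfolding frontier_def by blast
qed

lemma diagonals_eq:
  assumes Q: "polygon_Q n U v"
  shows "diagonals n v = diag n U"
proof -
  have "closed_segment (v (fst d)) (v (snd d)) \<subseteq> frontier (convex hull (v ` {0..n + 1})) \<longleftrightarrow>
      lo n U d = {} \<or> hi n U d = {}" (is "?F \<longleftrightarrow> _") if d: "fst d < snd d" "snd d \<le> n + 1" for d
  proof
    let ?p = "v (fst d)" let ?q = "v (snd d)" let ?S = "v ` {0..n + 1}"
    have x: "fst ?p < fst ?q" by (rule polygon_mono[OF Q d])
    have pq: "?p \<in> ?S" "?q \<in> ?S" using d by auto
    \<comment> \<open>A normal vector of the segment, turning \<open>det3\<close> into an affine
      functional.\<close>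
    let ?a = "(- (snd ?q - snd ?p), fst ?q - fst ?p) :: pt"
    have a: "?a \<noteq> 0" using x by (simp add: zero_prod_def)
    have det: "det3 ?p ?q z = ?a \<bullet> z - ?a \<bullet> ?p" for z
      by (cases z) (simp add: det3_def inner_prod_def algebra_simps)
    have aq: "?a \<bullet> ?q = ?a \<bullet> ?p" using det[of ?q] by (simp add: det3_def)
    {
      assume "lo n U d = {} \<or> hi n U d = {}"
      then show ?F
      proof
        assume l: "lo n U d = {}"
        show ?F
        proof (rule supporting_segment_frontier[OF a _ pq refl aq])
          fix z assume "z \<in> ?S"
          then have "0 \<le> det3 ?p ?q z" using lo_empty_det3[OF Q d l] by auto
          then show "?a \<bullet> ?p \<le> ?a \<bullet> z" unfolding det by linarith
        qed
      next
        assume h: "hi n U d = {}"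
        have a': "- ?a \<noteq> 0" using a by (simp only: neg_equal_0_iff_equal not_False_eq_True)
        show ?F
        proof (rule supporting_segment_frontier[OF a' _ pq refl])
          fix z assume "z \<in> ?S"
          then have "det3 ?p ?q z \<le> 0" using hi_empty_det3[OF Q d h] by auto
          then show "- ?a \<bullet> ?p \<le> - ?a \<bullet> z" unfolding det inner_minus_left by linarith
        next
          show "- ?a \<bullet> ?q = - ?a \<bullet> ?p" unfolding inner_minus_left using aq by simp
        qed
      qed
    }
    show "lo n U d = {} \<or> hi n U d = {}" if ?F
    proof (rule ccontr)
      assume "\<not> ?thesis"
      then obtain k l where "k \<in> lo n U d" "l \<in> hi n U d" by blast
      then obtain m m' where m: "m \<le> n + 1" "det3 ?p ?q (v m) < 0" "m' \<le> n + 1" "0 < det3 ?p ?q (v m')"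
        using lo_vertex_below[OF Q d] hi_vertex_above[OF Q d] by blast
      then show False
        using segment_not_frontier[OF pq, of "v m" "v m'"] x that by auto
    qed
  qed
  note fr = this
  have "d \<in> diagonals n v \<longleftrightarrow> d \<in> diag n U" for d
    using fr[of d] by (cases d) (simp add: diagonals_def diag_def, blast)
  then show ?thesis by blast
qed

text \<open>\<open>crosses\<close> holds between a diagonal and itself, \<open>ccross\<close> does
  not; but pairwise non-crossing and maximality only compare distinct diagonals.\<close>

lemma triangulation_eq:
  assumes Q: "polygon_Q n U v"
  shows "triangulation n v T \<longleftrightarrow> ctri n U T"
proof -
  have cr: "crosses v d e \<longleftrightarrow> ccross n U d e" if "d \<in> diag n U" "e \<in> diag n U" "d \<noteq> e" for d e
    using that ccross_imp_crosses[OF Q, of d e] crosses_imp_ccross[OF Q, of d e] diagD by blast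
  have "pairwise (\<lambda>d e. \<not> crosses v d e) T \<longleftrightarrow> (\<forall>d\<in>T. \<forall>e\<in>T. \<not> ccross n U d e)"
    if "T \<subseteq> diag n U"
    using that cr ccross_irrefl unfolding pairwise_def by (metis subsetD)
  moreover have "(\<forall>d\<in>diag n U - T. \<exists>e\<in>T. crosses v d e) \<longleftrightarrow> (\<forall>d\<in>diag n U - T. \<exists>e\<in>T. ccross n U d e)"
    if "T \<subseteq> diag n U"
    using that cr by (metis Diff_iff subsetD)
  ultimately show ?thesis unfolding triangulation_def ctri_def diagonals_eq[OF Q] by blast
qed

subsection \<open>The Cambrian lattice\<close>

lemma flip_up_adj:
  assumes Q: "polygon_Q n U v" and I: "biclosed n I" and ac: "adj n I a c" "a < c"
    and ne: "tri n U (swp I a c) \<noteq> tri n U I"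
  shows "flip_up n v (tri n U I) (tri n U (swp I a c))"
proof -
  let ?J = "swp I a c"
  have J: "biclosed n ?J" by (rule swp_biclosed[OF I ac(1)])
  obtain d d' where d: "d \<in> tri n U I" "d' \<notin> tri n U I" "tri n U ?J = insert d' (tri n U I - {d})"
    and l: "a \<in> lo n U d" "c \<in> hi n U d" "c \<in> lo n U d'" "a \<in> hi n U d'"
    using adj_flip[OF I ac(1) ne] by blast
  have "d' \<in> tri n U ?J" using d(3) by simp
  then have "slope v d < slope v d'"
    by (rule slope_less[OF Q tri_diag[OF d(1)] tri_diag ac(2) l])
  moreover have "triangulation n v (tri n U I)" "triangulation n v (tri n U ?J)"
    using tri_ctri[OF I] tri_ctri[OF J] triangulation_eq[OF Q] by auto
  ultimately show ?thesis unfolding flip_up_def using d by blast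
qed

lemma tri_le_mono:
  assumes Q: "polygon_Q n U v" and "biclosed n I" "biclosed n J" "I \<subseteq> J"
  shows "tri_le n v (tri n U I) (tri n U J)"
  using assms(2-)
proof (induction "card (J - I)" arbitrary: I rule: less_induct)
  case less
  note I = less.prems(1)
  show ?case
  proof (cases "I = J")
    case True
    then show ?thesis by (simp add: tri_le_def)
  next
    case False
    then have "I \<subset> J" using less.prems by blast
    then obtain a c where ac: "(a, c) \<in> J" "(a, c) \<notin> I" and I': "biclosed n (insert (a, c) I)"
      using biclosed_chain_step[OF I less.prems(2)] by blast
    have lt: "a < c" using biclosed_range[OF less.prems(2) ac(1)] by auto
    have adj: "adj n I a c" by (rule adj_of_cover[OF I I' ac(2)])
    have sw: "swp I a c = insert (a, c) I" using lt by (simp add: swp_def)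
    have "tri_le n v (tri n U I) (tri n U (insert (a, c) I))"
    proof (cases "tri n U (insert (a, c) I) = tri n U I")
      case True
      then show ?thesis by (simp add: tri_le_def)
    next
      case False
      then show ?thesis using flip_up_adj[OF Q I adj lt] sw by (simp add: tri_le_def r_into_rtranclp)
    qed
    moreover have "card (J - insert (a, c) I) < card (J - I)"
      using ac by (intro psubset_card_mono) (auto simp: biclosed_finite[OF less.prems(2)])
    then have "tri_le n v (tri n U (insert (a, c) I)) (tri n U J)"
      using less.hyps I' less.prems ac(1) by auto
    ultimately show ?thesis unfolding tri_le_def by (rule rtranclp_trans)
  qed
qed

text \<open>The flip is an exchange of neighbours \<open>a\<close> and \<open>c\<close> in some word
  of the fibre; with \<open>c < a\<close> the slope comparison would run the other way.\<close>

lemma flip_up_cover: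
  assumes Q: "polygon_Q n U v" and f: "flip_up n v T T'"
  obtains I a c where "biclosed n I" "adj n I a c" "a < c" "tri n U I = T" "tri n U (swp I a c) = T'"
proof -
  have T: "ctri n U T" "ctri n U T'" using f triangulation_eq[OF Q] unfolding flip_up_def by auto
  obtain d d' where d: "d \<in> T" "d' \<notin> T" "T' = insert d' (T - {d})" and sl: "slope v d < slope v d'"
    using f unfolding flip_up_def by blast
  obtain I0 where I0: "biclosed n I0" "tri n U I0 = T" by (rule ctri_surj[OF T(1)])
  obtain I a c where I: "biclosed n I" "tri n U I = T" "adj n I a c" "tri n U (swp I a c) = T'"
    and l: "a \<in> lo n U d" "c \<in> hi n U d" "c \<in> lo n U d'" "a \<in> hi n U d'"
    using flip_representative[OF I0(1) T(2)] d I0(2) by metis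
  have D: "d \<in> diag n U" "d' \<in> diag n U" using T d unfolding ctri_def by blast+
  have "\<not> c < a"
  proof
    assume "c < a"
    then have "slope v d' < slope v d" by (rule slope_less[OF Q D(2,1) _ l(3,4,1,2)])
    then show False using sl by simp
  qed
  then have "a < c" using adj_neq[OF I(1,3)] by simp
  then show thesis using that I by blast
qed

text \<open>A sortable set below a word is still below it after an upward exchange, hence below the
  least word of the new fibre. This lets the induction pass to an arbitrary \<open>J\<close> of that
  fibre.\<close>

lemma tri_le_sortable:
  assumes Q: "polygon_Q n U v" and le: "tri_le n v T T'"
    and I: "biclosed n I" "sortable U I" "tri n U I = T"
    and J: "biclosed n J" "tri n U J = T'"
  shows "I \<subseteq> J"
  using le[unfolded tri_le_def] J
proof (induction arbitrary: J rule: rtranclp_induct)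
  case base
  then show ?case using I sortable_le[OF I(1,2)] by simp
next
  case (step T' T'')
  obtain K a c where K: "biclosed n K" "adj n K a c" "a < c" "tri n U K = T'" "tri n U (swp K a c) = T''"
    by (rule flip_up_cover[OF Q step(2)])
  have K': "biclosed n (swp K a c)" by (rule swp_biclosed[OF K(1,2)])
  have "I \<subseteq> K" using step(3)[OF K(1,4)] .
  also have "\<dots> \<subseteq> swp K a c" using K(3) by (auto simp: swp_def)
  finally have "I \<subseteq> dn n U (swp K a c)" by (rule dn_greatest[OF K' I(2)])
  also have "\<dots> \<subseteq> J" using K(5) step(5) by (intro tri_subset_dn[OF K' step(4)]) simp
  finally show ?case .
qed

lemma tri_le_antisym:
  assumes Q: "polygon_Q n U v" and T: "triangulation n v T" "triangulation n v T'"
    and le: "tri_le n v T T'" "tri_le n v T' T"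
  shows "T = T'"
proof -
  obtain I J where I: "biclosed n I" "tri n U I = T" and J: "biclosed n J" "tri n U J = T'"
    using T ctri_surj triangulation_eq[OF Q] by metis
  note dI = dn_biclosed[OF I(1), of U] dn_sortable[OF I(1), of U] tri_dn[OF I(1), of U, unfolded I(2)]
  note dJ = dn_biclosed[OF J(1), of U] dn_sortable[OF J(1), of U] tri_dn[OF J(1), of U, unfolded J(2)]
  have "dn n U I \<subseteq> dn n U J" by (rule tri_le_sortable[OF Q le(1) dI dJ(1,3)])
  moreover have "dn n U J \<subseteq> dn n U I" by (rule tri_le_sortable[OF Q le(2) dJ dI(1,3)])
  ultimately show ?thesis using dI(3) dJ(3) by simp
qed

lemma flip_up_neq: "flip_up n v T T' \<Longrightarrow> T \<noteq> T'"
  unfolding flip_up_def by blast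

section \<open>Cover relations and the isomorphism\<close>

text \<open>A flip is the image of a cover from \<open>I\<close> to \<open>insert (a, c) I\<close>.
  The least element \<open>M\<close> of an intermediate fibre lies below the top. If it misses
  \<open>(a, c)\<close> it lies below \<open>I\<close>; otherwise \<open>up n U M\<close> lies above
  the top. So nothing is strictly between.\<close>

lemma tri_covers_eq:
  assumes Q: "polygon_Q n U v" and T: "triangulation n v T" "triangulation n v T'"
  shows "tri_covers n v T T' \<longleftrightarrow> flip_up n v T T'"
proof
  assume c: "tri_covers n v T T'"
  then have ne: "T \<noteq> T'" and le: "(flip_up n v)\<^sup>*\<^sup>* T T'" by (auto simp: tri_covers_def tri_le_def)
  from le ne obtain Z where Z: "flip_up n v T Z" "(flip_up n v)\<^sup>*\<^sup>* Z T'"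
    by (cases rule: converse_rtranclpE) auto
  have "triangulation n v Z" using Z(1) by (simp add: flip_up_def)
  moreover have "Z \<noteq> T" using flip_up_neq[OF Z(1)] by simp
  moreover have "tri_le n v T Z" "tri_le n v Z T'" using Z by (simp_all add: tri_le_def r_into_rtranclp)
  ultimately have "Z = T'" using c unfolding tri_covers_def by blast
  then show "flip_up n v T T'" using Z by simp
next
  assume f: "flip_up n v T T'"
  obtain I a c where I: "biclosed n I" "adj n I a c" "a < c" "tri n U I = T" "tri n U (swp I a c) = T'"
    by (rule flip_up_cover[OF Q f])
  let ?J = "swp I a c"
  have J: "biclosed n ?J" by (rule swp_biclosed[OF I(1,2)])
  have Jeq: "?J = insert (a, c) I" using I(3) by (simp add: swp_def)
  have "Z = T \<or> Z = T'" if Z: "triangulation n v Z" "tri_le n v T Z" "tri_le n v Z T'" for Z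
  proof -
    obtain K where K: "biclosed n K" "tri n U K = Z"
      using Z(1) ctri_surj triangulation_eq[OF Q] by metis
    define M where "M = dn n U K"
    have M: "biclosed n M" "sortable U M" "tri n U M = Z"
      using dn_biclosed[OF K(1)] dn_sortable[OF K(1)] tri_dn[OF K(1)] K(2) by (auto simp: M_def)
    have MJ: "M \<subseteq> ?J" by (rule tri_le_sortable[OF Q Z(3) M J I(5)])
    show ?thesis
    proof (cases "(a, c) \<in> M")
      case False
      then have "M \<subseteq> I" using MJ unfolding Jeq by blast
      then have "tri_le n v Z T" using tri_le_mono[OF Q M(1) I(1)] M(3) I(4) by simp
      then show ?thesis using tri_le_antisym[OF Q T(1) Z(1) Z(2)] by simp
    next
      case True
      have "dn n U I \<subseteq> M"
        using tri_dn[OF I(1), of U] I(4)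
        by (intro tri_le_sortable[OF Q Z(2) dn_biclosed[OF I(1)] dn_sortable[OF I(1)] _ M(1,3)]) simp
      also have "M \<subseteq> up n U M" by (rule up_superset[OF M(1)])
      finally have "I \<subseteq> up n U M" by (rule dn_antisortable[OF I(1) up_antisortable[OF M(1)]])
      then have "?J \<subseteq> up n U M" using True up_superset[OF M(1), of U] unfolding Jeq by blast
      then have "tri_le n v T' Z"
        using tri_le_mono[OF Q J up_biclosed[OF M(1), of U]] tri_up[OF M(1), of U] M(3) I(5) by simp
      then show ?thesis using tri_le_antisym[OF Q T(2) Z(1) _ Z(3)] by simp
    qed
  qed
  moreover have "tri_le n v T T'" using f by (simp add: tri_le_def r_into_rtranclp)
  ultimately show "tri_covers n v T T'" unfolding tri_covers_def using flip_up_neq[OF f] by blast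
qed

lemma tri_cong_equiv: "equiv (perms n) (tri_cong n U)"
  using tri_cong_lattice unfolding lattice_congruence_def by blast

lemma tri_congD: "(x, y) \<in> tri_cong n U \<Longrightarrow> tri n U (inv_set n x) = tri n U (inv_set n y)"
  by (simp add: tri_cong_def)

text \<open>The least element of the lower class lies below every representative of the upper one,
  so it witnesses the existential order on classes.\<close>

lemma class_le_tri_le:
  assumes Q: "polygon_Q n U v" and x: "x \<in> perms n" and y: "y \<in> perms n"
  shows "class_le n (tri_cong n U `` {x}) (tri_cong n U `` {y}) \<longleftrightarrow>
    tri_le n v (tri n U (inv_set n x)) (tri n U (inv_set n y))"
proof
  assume "class_le n (tri_cong n U `` {x}) (tri_cong n U `` {y})"
  then obtain x' y' where "(x, x') \<in> tri_cong n U" "(y, y') \<in> tri_cong n U" "weak_le n x' y'"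
    unfolding class_le_def by blast
  then show "tri_le n v (tri n U (inv_set n x)) (tri n U (inv_set n y))"
    using tri_le_mono[OF Q, of "inv_set n x'" "inv_set n y'"]
    by (simp add: tri_cong_def weak_le_def inv_set_biclosed)
next
  assume le: "tri_le n v (tri n U (inv_set n x)) (tri n U (inv_set n y))"
  have b: "biclosed n (inv_set n x)" "biclosed n (inv_set n y)" using x y inv_set_biclosed by auto
  obtain z where z: "z \<in> perms n" "inv_set n z = dn n U (inv_set n x)"
    using biclosed_perm[OF dn_biclosed[OF b(1)]] .
  have "inv_set n z \<subseteq> inv_set n y" unfolding z(2)
    by (rule tri_le_sortable[OF Q le dn_biclosed[OF b(1)] dn_sortable[OF b(1)] tri_dn[OF b(1)] b(2) refl])
  then have "weak_le n z y" by (simp add: weak_le_def)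
  moreover have "z \<in> tri_cong n U `` {x}" "y \<in> tri_cong n U `` {y}"
    using x y z tri_dn[OF b(1), of U] by (auto simp: tri_cong_def)
  ultimately show "class_le n (tri_cong n U `` {x}) (tri_cong n U `` {y})"
    unfolding class_le_def by blast
qed

theorem theorem6p3:
  fixes n :: nat and E :: "(nat \<times> nat) set" and U :: "nat set" and v :: "nat \<Rightarrow> real \<times> real"
  assumes "1 \<le> n"
    and "orientation n E"
    and "\<forall>b\<in>{2..n - 1}. (b \<in> U \<longleftrightarrow> (b, b - 1) \<in> E) \<and> (b \<notin> U \<longleftrightarrow> (b - 1, b) \<in> E)"
    and "polygon_Q n U v"
  shows "(\<exists>f. bij_betw f (perms n // cambrian_cong n E) {T. triangulation n v T} \<and>
            (\<forall>X\<in>perms n // cambrian_cong n E. \<forall>Y\<in>perms n // cambrian_cong n E.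
                class_le n X Y \<longleftrightarrow> tri_le n v (f X) (f Y)))
         \<and> (\<forall>T T'. triangulation n v T \<and> triangulation n v T' \<longrightarrow>
                (tri_covers n v T T' \<longleftrightarrow> flip_up n v T T'))"
proof
  note Q = assms(4)
  note eq = tri_cong_equiv[of n U]
  \<comment> \<open>The chosen representative does not matter, since the triangulation is constant
    on classes.\<close>
  define f where "f X = tri n U (inv_set n (SOME x. x \<in> X))" for X
  have f: "f (tri_cong n U `` {x}) = tri n U (inv_set n x)" if "x \<in> perms n" for x
  proof -
    have x: "x \<in> tri_cong n U `` {x}" using that by (simp add: tri_cong_def)
    have "(SOME y. y \<in> tri_cong n U `` {x}) \<in> tri_cong n U `` {x}"
      by (rule someI[of "\<lambda>y. y \<in> tri_cong n U `` {x}", OF x])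
    from tri_congD[OF this[unfolded Image_singleton_iff]] show ?thesis
      unfolding f_def Image_singleton_iff by (rule sym)
  qed
  have "bij_betw f (perms n // tri_cong n U) {T. triangulation n v T}"
  proof (rule bij_betw_imageI)
    show "inj_on f (perms n // tri_cong n U)"
    proof (rule inj_onI)
      fix X Y assume "X \<in> perms n // tri_cong n U" "Y \<in> perms n // tri_cong n U" and e: "f X = f Y"
      then obtain x y where xy: "x \<in> perms n" "X = tri_cong n U `` {x}" "y \<in> perms n" "Y = tri_cong n U `` {y}"
        by (auto elim!: quotientE)
      then have "(x, y) \<in> tri_cong n U" using e f by (simp add: tri_cong_def)
      then show "X = Y" using xy equiv_class_eq[OF eq] by simp
    qed
    show "f ` (perms n // tri_cong n U) = {T. triangulation n v T}"
    proof
      show "f ` (perms n // tri_cong n U) \<subseteq> {T. triangulation n v T}"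
        using f tri_ctri inv_set_biclosed triangulation_eq[OF Q] by (auto elim!: quotientE)
      show "{T. triangulation n v T} \<subseteq> f ` (perms n // tri_cong n U)"
      proof
        fix T assume "T \<in> {T. triangulation n v T}"
        then have "ctri n U T" using triangulation_eq[OF Q] by simp
        then obtain I where I: "biclosed n I" "tri n U I = T" by (rule ctri_surj)
        obtain x where x: "x \<in> perms n" "inv_set n x = I" by (rule biclosed_perm[OF I(1)])
        have "f (tri_cong n U `` {x}) = T" using f[OF x(1)] x(2) I(2) by simp
        then show "T \<in> f ` (perms n // tri_cong n U)" using quotientI[OF x(1)] by blast
      qed
    qed
  qed
  moreover have "class_le n X Y \<longleftrightarrow> tri_le n v (f X) (f Y)"
    if "X \<in> perms n // tri_cong n U" "Y \<in> perms n // tri_cong n U" for X Y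
    using that class_le_tri_le[OF Q] f by (auto elim!: quotientE)
  ultimately show "\<exists>f. bij_betw f (perms n // cambrian_cong n E) {T. triangulation n v T} \<and>
      (\<forall>X\<in>perms n // cambrian_cong n E. \<forall>Y\<in>perms n // cambrian_cong n E.
        class_le n X Y \<longleftrightarrow> tri_le n v (f X) (f Y))"
    unfolding cambrian_cong_eq[OF assms(2,3)] by blast
  show "\<forall>T T'. triangulation n v T \<and> triangulation n v T' \<longrightarrow>
      (tri_covers n v T T' \<longleftrightarrow> flip_up n v T T')"
    using tri_covers_eq[OF Q] by blast
qed

end
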